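(* Let $a,k\in L^1_{loc}(\mathbb{R}_+)$ be positive Laplace transformable functions with $k\in\mathcal{C}(0,\infty)$, and let $\{S(t)\}_{t>0}$ be a Laplace transformable, commutative, locally integrable and strongly continuous family of bounded linear operators on $X$. Then $\{S(t)\}_{t>0}$ is an $(a,k)$-regularized resolvent family if and only if $\lim_{t\to0^+}\frac{S(t)x}{k(t)}=x$ for all $x\in X$ and $$\left(a^+*_2(S\otimes S)\right)(t,s)x=\left(k*(a*S)_t\right)(s)x-\left(k_t*(a*S)\right)(s)x,\qquad t,s>0,\ x\in X.$$
   Context: $X$ is a complex Banach space, $\mathbb{R}_+=[0,\infty)$. Convolution: $(f*g)(t)=\int_0^t f(t-s)g(s)\,ds$; for an operator family, $(f*S)(t)x=\int_0^t f(t-s)S(s)x\,ds$. Translation: $f_t(s)=f(s+t)$ for $s,t\ge0$, similarly for operator families. $a^+(t,s)=a(t+s)$, $(S\otimes S)(t,s)=S(t)S(s)$, and $(a^+*_2(S\otimes S))(t,s)x=\int_0^t\int_0^s a(t+s-r_1-r_2)S(r_1)S(r_2)x\,dr_2\,dr_1$. Thus the right-hand side of the functional equation is $\int_t^{t+s}\int_0^r k(s+t-r)a(r-\tau)S(\tau)x\,d\tau\,dr-\int_0^s\int_0^r k(s+t-r)a(r-\tau)S(\tau)x\,d\tau\,dr$. A locally integrable function $f$ is Laplace transformable if $\hat f(\lambda)=\lim_{\rho\to\infty}\int_0^\rho e^{-\lambda t}f(t)\,dt$ exists for all $\Re\lambda$ larger than some $\omega\in\mathbb{R}$; $\{S(t)\}$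 is Laplace transformable if there is $\omega\in\mathbb{R}$ such that $\hat S(\lambda)x=\int_0^\infty e^{-\lambda t}S(t)x\,dt$ converges for all $\Re\lambda>\omega$, $x\in X$. Definition. A strongly continuous family $\{S(t)\}_{t>0}$ of bounded linear operators on $X$ is an $(a,k)$-regularized resolvent family if there is a closed operator $A$ with domain $D(A)$ (the generator) such that: (i) $\lim_{t\to0^+}S(t)x/k(t)=x$ for all $x\in X$; (ii) $S(t)A\subset AS(t)$ for $t>0$; (iii) $(a*S)(t)x\in D(A)$ and $A(a*S)(t)x=S(t)x-k(t)x$ for all $x\in X$, $t>0$.
   Formalization: Since a*S may diverge at some t, the equivalence is proved with condition (iii) and the functional equation holding almost everywhere for all a, k, S, and with both holding for every t,s>0 when a*k exists and is continuous on (0,∞). *)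

theory Defs
  imports "HOL-Analysis.Analysis"
begin

class complex_banach = banach +
  fixes scaleC :: "complex \<Rightarrow> 'a \<Rightarrow> 'a" (infixr "*\<^sub>C" 75)
  assumes scaleC_add_right: "c *\<^sub>C (x + y) = c *\<^sub>C x + c *\<^sub>C y"
    and scaleC_add_left: "(c + d) *\<^sub>C x = c *\<^sub>C x + d *\<^sub>C x"
    and scaleC_scaleC: "c *\<^sub>C d *\<^sub>C x = (c * d) *\<^sub>C x"
    and scaleC_of_real: "complex_of_real r *\<^sub>C x = r *\<^sub>R x"
    and norm_scaleC: "norm (c *\<^sub>C x) = cmod c * norm x"

instantiation complex :: complex_banach
begin

definition scaleC_complex :: "complex \<Rightarrow> complex \<Rightarrow> complex" where
  "scaleC_complex c z = c * z"

instance
  by standard (simp_all add: scaleC_complex_def algebra_simps norm_mult scaleR_conv_of_real)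

end

definition bounded_clinear :: "('a::complex_banach \<Rightarrow> 'a) \<Rightarrow> bool" where
  "bounded_clinear T \<longleftrightarrow> bounded_linear T \<and> (\<forall>c x. T (c *\<^sub>C x) = c *\<^sub>C T x)"

text \<open>An unbounded operator is a domain \<open>D\<close> together with a function \<open>A\<close> whose values outside
  \<open>D\<close> are irrelevant. Density of \<open>D\<close> is not required.\<close>

definition closed_operator :: "'a::complex_banach set \<Rightarrow> ('a \<Rightarrow> 'a) \<Rightarrow> bool" where
  "closed_operator D A \<longleftrightarrow>
     0 \<in> D \<and>
     (\<forall>x\<in>D. \<forall>y\<in>D. x + y \<in> D \<and> A (x + y) = A x + A y) \<and>
     (\<forall>c. \<forall>x\<in>D. c *\<^sub>C x \<in> D \<and> A (c *\<^sub>C x) = c *\<^sub>C A x) \<and>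
     closed ((\<lambda>x. (x, A x)) ` D)"

text \<open>Integrals are gauge integrals, because the library's Bochner integral is restricted to
  second-countable (separable) codomains. The vector-valued integrands below are products of
  measurable scalar functions and functions that are strongly continuous on \<open>(0, \<infinity>)\<close> (or integrals
  of such products), and when their norm is integrable both integrals exist and agree. Functions on
  the half-line are functions on \<open>real\<close> whose values on the negative half-line, and for
  operator families also at \<open>0\<close>, are never relevant.\<close>

definition conv :: "(real \<Rightarrow> real) \<Rightarrow> (real \<Rightarrow> 'a::real_normed_vector) \<Rightarrow> real \<Rightarrow> 'a" where
  "conv f g t = integral {0..t} (\<lambda>s. f (t - s) *\<^sub>R g s)"

definition conv2 ::
  "(real \<Rightarrow> real \<Rightarrow> real) \<Rightarrow> (real \<Rightarrow> real \<Rightarrow> 'a::real_normed_vector) \<Rightarrow> real \<Rightarrow> real \<Rightarrow> 'a" where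
  "conv2 F G t s =
     integral {0..t} (\<lambda>r1. integral {0..s} (\<lambda>r2. F (t - r1) (s - r2) *\<^sub>R G r1 r2))"

definition translate :: "real \<Rightarrow> (real \<Rightarrow> 'a) \<Rightarrow> real \<Rightarrow> 'a" where
  "translate t f = (\<lambda>s. f (s + t))"

definition laplace_converges :: "(real \<Rightarrow> 'a::complex_banach) \<Rightarrow> complex \<Rightarrow> bool" where
  "laplace_converges f z \<longleftrightarrow>
     (\<exists>l. ((\<lambda>\<rho>. integral {0..\<rho>} (\<lambda>t. exp (- z * of_real t) *\<^sub>C f t)) \<longlongrightarrow> l) at_top)"

definition laplace_transformable :: "(real \<Rightarrow> real) \<Rightarrow> bool" where
  "laplace_transformable f \<longleftrightarrow>
     (\<exists>\<omega>. \<forall>z. \<omega> < Re z \<longrightarrow> laplace_converges (\<lambda>t. complex_of_real (f t)) z)"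

definition laplace_transformable_family :: "(real \<Rightarrow> 'a::complex_banach \<Rightarrow> 'a) \<Rightarrow> bool" where
  "laplace_transformable_family S \<longleftrightarrow>
     (\<exists>\<omega>. \<forall>z x. \<omega> < Re z \<longrightarrow> laplace_converges (\<lambda>t. S t x) z)"

definition locally_integrable :: "(real \<Rightarrow> real) \<Rightarrow> bool" where
  "locally_integrable f \<longleftrightarrow> (\<forall>T>0. f absolutely_integrable_on {0..T})"

definition strongly_continuous_family :: "(real \<Rightarrow> 'a::complex_banach \<Rightarrow> 'a) \<Rightarrow> bool" where
  "strongly_continuous_family S \<longleftrightarrow>
     (\<forall>t>0. bounded_clinear (S t)) \<and> (\<forall>x. continuous_on {0<..} (\<lambda>t. S t x))"

text \<open>For a strongly continuous family the orbits are strongly measurable, so integrability of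
  their norms is local Bochner integrability.\<close>

definition locally_integrable_family :: "(real \<Rightarrow> 'a::complex_banach \<Rightarrow> 'a) \<Rightarrow> bool" where
  "locally_integrable_family S \<longleftrightarrow> (\<forall>x. \<forall>T>0. (\<lambda>t. norm (S t x)) integrable_on {0..T})"

definition commutative_family :: "(real \<Rightarrow> 'a \<Rightarrow> 'a) \<Rightarrow> bool" where
  "commutative_family S \<longleftrightarrow> (\<forall>t>0. \<forall>s>0. \<forall>x. S t (S s x) = S s (S t x))"

definition commutes_with ::
  "(real \<Rightarrow> 'a \<Rightarrow> 'a) \<Rightarrow> 'a set \<Rightarrow> ('a \<Rightarrow> 'a) \<Rightarrow> bool" where
  "commutes_with S D A \<longleftrightarrow> (\<forall>t>0. \<forall>x\<in>D. S t x \<in> D \<and> A (S t x) = S t (A x))"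

definition resolvent_identity_at ::
  "(real \<Rightarrow> real) \<Rightarrow> (real \<Rightarrow> real) \<Rightarrow> (real \<Rightarrow> 'a::complex_banach \<Rightarrow> 'a) \<Rightarrow> 'a set \<Rightarrow> ('a \<Rightarrow> 'a)
     \<Rightarrow> real \<Rightarrow> 'a \<Rightarrow> bool" where
  "resolvent_identity_at a k S D A t x \<longleftrightarrow>
     (\<lambda>s. a (t - s) *\<^sub>R S s x) integrable_on {0..t} \<and>
     conv a (\<lambda>s. S s x) t \<in> D \<and>
     A (conv a (\<lambda>s. S s x) t) = S t x - k t *\<^sub>R x"

definition regularized_resolvent_family ::
  "(real \<Rightarrow> real) \<Rightarrow> (real \<Rightarrow> real) \<Rightarrow> (real \<Rightarrow> 'a::complex_banach \<Rightarrow> 'a) \<Rightarrow> bool" where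
  "regularized_resolvent_family a k S \<longleftrightarrow>
     strongly_continuous_family S \<and>
     (\<exists>D A. closed_operator D A \<and>
        (\<forall>x. ((\<lambda>t. S t x /\<^sub>R k t) \<longlongrightarrow> x) (at_right 0)) \<and>
        commutes_with S D A \<and>
        (\<forall>x. \<forall>t>0. resolvent_identity_at a k S D A t x))"

definition functional_equation_at ::
  "(real \<Rightarrow> real) \<Rightarrow> (real \<Rightarrow> real) \<Rightarrow> (real \<Rightarrow> 'a::complex_banach \<Rightarrow> 'a)
     \<Rightarrow> real \<Rightarrow> real \<Rightarrow> 'a \<Rightarrow> bool" where
  "functional_equation_at a k S t s x \<longleftrightarrow>
     conv2 (\<lambda>t s. a (t + s)) (\<lambda>t s. S t (S s x)) t s =
     conv k (translate t (conv a (\<lambda>r. S r x))) s - conv (translate t k) (conv a (\<lambda>r. S r x)) s"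

text \<open>The convolution of two locally integrable functions is in general defined only almost
  everywhere: the singularity of \<open>S\<close> at \<open>0\<close> can meet a singularity of \<open>a\<close> at some \<open>t > 0\<close>.
  For general \<open>a\<close> and \<open>k\<close>, identities between convolutions are therefore identities between
  locally integrable functions, i.e. they hold almost everywhere.\<close>

definition regularized_resolvent_family_ae ::
  "(real \<Rightarrow> real) \<Rightarrow> (real \<Rightarrow> real) \<Rightarrow> (real \<Rightarrow> 'a::complex_banach \<Rightarrow> 'a) \<Rightarrow> bool" where
  "regularized_resolvent_family_ae a k S \<longleftrightarrow>
     strongly_continuous_family S \<and>
     (\<exists>D A. closed_operator D A \<and>
        (\<forall>x. ((\<lambda>t. S t x /\<^sub>R k t) \<longlongrightarrow> x) (at_right 0)) \<and>
        commutes_with S D A \<and>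
        (\<forall>x. AE t in lebesgue. 0 < t \<longrightarrow> resolvent_identity_at a k S D A t x))"

text \<open>Under the following condition, if \<open>S t x / k t\<close> tends to \<open>x\<close> as \<open>t\<close> tends to \<open>0\<close>, all
  convolutions of \<open>a\<close>, \<open>k\<close> and \<open>S\<close> exist and are continuous at every point of \<open>(0, \<infinity>)\<close>, so
  that the pointwise identities are meaningful. It holds, for instance, if \<open>a\<close> is locally bounded on \<open>(0, \<infinity>)\<close>
  or \<open>k\<close> is bounded near \<open>0\<close>.\<close>

definition continuous_convolution :: "(real \<Rightarrow> real) \<Rightarrow> (real \<Rightarrow> real) \<Rightarrow> bool" where
  "continuous_convolution a k \<longleftrightarrow>
     (\<forall>t>0. (\<lambda>s. a (t - s) * k s) integrable_on {0..t}) \<and> continuous_on {0<..} (conv a k)"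

end

theory Submission
  imports Defs
begin

text \<open>Write \<open>B = a * S\<close>. For a commutative family with generator \<open>A\<close>, applying \<open>S(p) - k(p) = A B(p)\<close> to
  \<open>B(q)x\<close> gives the resolvent equation
  \<open>S(p)B(q)x - k(p)B(q)x = S(q)B(p)x - k(q)B(p)x\<close>. Let \<open>W(p,q)\<close> be the difference of its two sides.
  By Fubini's theorem the functional equation at \<open>(t,s)\<close> says that the integral of \<open>W(r, t+s-r)\<close> over \<open>0 \<le> r \<le> s\<close> vanishes;
  letting \<open>s\<close> vary with \<open>t + s\<close> fixed, it is equivalent to the resolvent equation. Conversely the
  resolvent equation says that \<open>B(q)x\<close> belongs to the domain of the operator mapping \<open>x\<close> to the \<open>y\<close> with
  \<open>S(t)x - k(t)x = B(t)y\<close> for almost every \<open>t\<close>. Such a \<open>y\<close> is unique because \<open>B(t)y\<close> is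
  asymptotic to \<open>(a * k)(t)y\<close> as \<open>t\<close> tends to \<open>0\<close> and \<open>a * k > 0\<close>. All of this is local in time, and
  the uniform boundedness principle gives \<open>\<parallel>S(t)\<parallel> \<le> M k(t)\<close> on bounded intervals.\<close>

subsection \<open>Strongly integrable functions with values in a Banach space\<close>

text \<open>The obstacle is that convolutions exist only off null sets, and these depend on the
  vector and on the other variable. Hence the iterated form \<open>AE q. AE p\<close> of the
  resolvent equation, and the care with measurability whenever statements on sections and on the
  plane are exchanged. Along an antidiagonal p + q = \<tau> a single condition, finiteness of the
  triple convolution a * k * k at \<tau>, makes all terms of the functional equation absolutely
  convergent for every splitting \<tau> = t + s. The bound by M k(t) is what reduces every question
  of integrability to such scalar convolutions. Cutting \<open>a\<close>, \<open>k\<close>,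
  \<open>S\<close> off at T turns them into integrable functions on the whole line, where shears and
  reflections preserve measure. The pointwise statement borrows its operator from the almost
  everywhere statement: once A is available, continuity of B = a * S and closedness of A extend the
  identity to all t > 0.\<close>

text \<open>The library's Bochner integral requires a second-countable codomain. The following class replaces
  Bochner integrability: it is the closure, in mean, of the finite sums of integrable scalar functions
  times vectors, so that its properties follow by rule induction.\<close>

inductive bochner_L1 :: "'m measure \<Rightarrow> ('m \<Rightarrow> 'a::banach) \<Rightarrow> bool" for M where
  base: "integrable M \<phi> \<Longrightarrow> bochner_L1 M (\<lambda>x. \<phi> x *\<^sub>R v)" for \<phi> :: "'m \<Rightarrow> real"
| add: "bochner_L1 M f \<Longrightarrow> bochner_L1 M g \<Longrightarrow> bochner_L1 M (\<lambda>x. f x + g x)"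
| lim: "(\<And>e::real. e > 0 \<Longrightarrow> \<exists>g h. bochner_L1 M g \<and> integrable M h
          \<and> (AE x in M. norm (f x - g x) \<le> h x) \<and> integral\<^sup>L M h < e) \<Longrightarrow> bochner_L1 M f"

text \<open>Common to the inductions over \<open>bochner_L1.lim\<close>: the \<epsilon>-form of the
  approximation becomes a sequence that also converges almost everywhere. The class \<open>P\<close>
  of approximants is left open; it is instantiated with simple functions, gauge integrable functions
  and functions satisfying Fubini's theorem.\<close>

lemma approx_sequence:
  fixes f :: "'m \<Rightarrow> 'a::real_normed_vector"
  assumes "\<And>e::real. e > 0 \<Longrightarrow> \<exists>g h. P g \<and> integrable M h
          \<and> (AE x in M. norm (f x - g x) \<le> h x) \<and> integral\<^sup>L M h < e"
  shows "\<exists>g h. (\<forall>n::nat. P (g n) \<and> integrable M (h n)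
      \<and> (AE x in M. norm (f x - g n x) \<le> h n x) \<and> (\<forall>x. 0 \<le> h n x))
    \<and> (\<lambda>n. integral\<^sup>L M (h n)) \<longlonglongrightarrow> 0 \<and> (AE x in M. (\<lambda>n. h n x) \<longlonglongrightarrow> 0)
    \<and> (AE x in M. (\<lambda>n. g n x) \<longlonglongrightarrow> f x)"
proof -
  have "\<forall>n. \<exists>p. P (fst p) \<and> integrable M (snd p) \<and> (AE x in M. norm (f x - fst p x) \<le> snd p x)
          \<and> integral\<^sup>L M (snd p) < inverse (real (Suc n))"
  proof
    fix n
    obtain g h where "P g \<and> integrable M h
          \<and> (AE x in M. norm (f x - g x) \<le> h x) \<and> integral\<^sup>L M h < inverse (real (Suc n))"
      using assms[of "inverse (real (Suc n))"] by auto
    then show "\<exists>p. P (fst p) \<and> integrable M (snd p) \<and> (AE x in M. norm (f x - fst p x) \<le> snd p x)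
          \<and> integral\<^sup>L M (snd p) < inverse (real (Suc n))" by (intro exI[of _ "(g, h)"]) auto
  qed
  from choice[OF this] obtain p where
    "\<forall>n. P (fst (p n)) \<and> integrable M (snd (p n)) \<and> (AE x in M. norm (f x - fst (p n) x) \<le> snd (p n) x)
          \<and> integral\<^sup>L M (snd (p n)) < inverse (real (Suc n))" ..
  then have p: "\<And>n. P (fst (p n))" "\<And>n. integrable M (snd (p n))"
    "\<And>n. AE x in M. norm (f x - fst (p n) x) \<le> snd (p n) x"
    "\<And>n. integral\<^sup>L M (snd (p n)) < inverse (real (Suc n))" by auto
  define g where "g n = fst (p n)" for n
  \<comment> \<open>The absolute value makes the majorant nonnegative at every point. The original
    one dominates a norm almost everywhere, so the integral does not change.\<close>
  define h where "h n x = \<bar>snd (p n) x\<bar>" for n x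
  have hi: "integrable M (h n)" for n unfolding h_def using p(2) by auto
  have hle: "AE x in M. norm (f x - g n x) \<le> h n x" for n
    using p(3)[of n] unfolding g_def h_def by eventually_elim auto
  have heq: "integral\<^sup>L M (h n) = integral\<^sup>L M (snd (p n))" for n
  proof (rule integral_cong_AE)
    show "AE x in M. h n x = snd (p n) x"
      using p(3)[of n] unfolding h_def
      by eventually_elim (metis abs_of_nonneg norm_ge_zero order_trans)
  qed (use hi p(2) in auto)
  have hlim: "(\<lambda>n. integral\<^sup>L M (h n)) \<longlonglongrightarrow> 0"
  proof (rule tendsto_sandwich[OF _ _ tendsto_const LIMSEQ_inverse_real_of_nat])
    show "\<forall>\<^sub>F n in sequentially. 0 \<le> integral\<^sup>L M (h n)"
      by (intro always_eventually allI integral_nonneg_AE) (auto simp: h_def)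
    show "\<forall>\<^sub>F n in sequentially. integral\<^sup>L M (h n) \<le> inverse (real (Suc n))"
      using p(4) heq by (auto intro!: always_eventually less_imp_le)
  qed
  \<comment> \<open>Convergence in mean gives convergence almost everywhere only along a
    subsequence.\<close>
  have "\<exists>r. strict_mono r \<and> (AE x in M. (\<lambda>n. h (r n) x) \<longlonglongrightarrow> 0)"
  proof (rule tendsto_L1_AE_subseq)
    show "(\<lambda>n. \<integral>x. norm (h n x) \<partial>M) \<longlonglongrightarrow> 0" using hlim by (simp add: h_def[abs_def])
  qed (use hi in auto)
  then obtain r :: "nat \<Rightarrow> nat" where r: "strict_mono r" "AE x in M. (\<lambda>n. h (r n) x) \<longlonglongrightarrow> 0" by blast
  have gl: "AE x in M. (\<lambda>n. g (r n) x) \<longlonglongrightarrow> f x"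
  proof -
    have "AE x in M. \<forall>n. norm (f x - g (r n) x) \<le> h (r n) x"
      using hle by (simp add: AE_all_countable)
    with r(2) show ?thesis
    proof eventually_elim
      case (elim x)
      have "(\<lambda>n. g (r n) x - f x) \<longlonglongrightarrow> 0"
        by (rule Lim_null_comparison[OF _ elim(1)]) (use elim(2) in \<open>auto simp: norm_minus_commute\<close>)
      then show ?case by (simp add: LIM_zero_iff)
    qed
  qed
  have "(\<lambda>n. integral\<^sup>L M (h (r n))) \<longlonglongrightarrow> 0"
    using LIMSEQ_subseq_LIMSEQ[OF hlim r(1)] by (simp add: o_def)
  then show ?thesis
    using p(1) hi hle r(2) gl
    by (intro exI[of _ "\<lambda>n. g (r n)"] exI[of _ "\<lambda>n. h (r n)"]) (simp add: g_def h_def)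
qed

text \<open>With all approximants equal to 0, the almost everywhere limit is both \<open>f\<close>
  and 0.\<close>

lemma AE_zero_if_dominated:
  fixes f :: "'m \<Rightarrow> 'a::real_normed_vector"
  assumes "\<And>e::real. e > 0 \<Longrightarrow> \<exists>h. integrable M h \<and> (AE x in M. norm (f x) \<le> h x) \<and> integral\<^sup>L M h < e"
  shows "AE x in M. f x = 0"
proof -
  have *: "\<exists>g h. g = (\<lambda>x. 0) \<and> integrable M h
          \<and> (AE x in M. norm (f x - g x) \<le> h x) \<and> integral\<^sup>L M h < e" if "e > 0" for e :: real
    using assms[OF that] by simp
  obtain g where g: "\<And>n::nat. g n = (\<lambda>x. 0)" "AE x in M. (\<lambda>n. g n x) \<longlonglongrightarrow> f x"
    using approx_sequence[where P = "\<lambda>g. g = (\<lambda>x. 0)", OF *] by blast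
  from g(2) show ?thesis
    by eventually_elim (simp add: g(1) tendsto_const_iff)
qed

lemma bochner_L1_lim_sequence:
  assumes "\<And>n::nat. bochner_L1 M (g n)" "\<And>n. integrable M (h n)"
    "\<And>n. AE x in M. norm (f x - g n x) \<le> h n x" "(\<lambda>n. integral\<^sup>L M (h n)) \<longlonglongrightarrow> (0::real)"
  shows "bochner_L1 M f"
proof (rule bochner_L1.lim)
  fix e :: real assume "e > 0"
  then obtain n where "integral\<^sup>L M (h n) < e"
    using order_tendstoD(2)[OF assms(4)] by (meson eventually_happens trivial_limit_sequentially)
  then show "\<exists>g h. bochner_L1 M g \<and> integrable M h
          \<and> (AE x in M. norm (f x - g x) \<le> h x) \<and> integral\<^sup>L M h < e"
    using assms by blast
qed

lemma bochner_L1_zero: "bochner_L1 M (\<lambda>x. 0)"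
  using bochner_L1.base[of M "\<lambda>x. 0" 0] by simp

lemma bochner_L1_AE_cong:
  assumes "bochner_L1 M f" "AE x in M. f x = g x"
  shows "bochner_L1 M g"
proof (rule bochner_L1_lim_sequence[where g = "\<lambda>n. f" and h = "\<lambda>n x. 0"])
  show "AE x in M. norm (g x - f x) \<le> 0" using assms(2) by eventually_elim simp
qed (use assms in auto)

text \<open>A scalar integrable majorant stands in for the integrability of \<open>norm f\<close>,
  whose measurability is obtained only later, through simple functions.\<close>

lemma bochner_L1_bound:
  assumes "bochner_L1 M f"
  shows "\<exists>w. integrable M w \<and> (AE x in M. norm (f x) \<le> w x)"
  using assms
proof induction
  case (base \<phi> v)
  then show ?case by (intro exI[of _ "\<lambda>x. \<bar>\<phi> x\<bar> * norm v"]) auto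
next
  case (add f g)
  then obtain u v where "integrable M u" "AE x in M. norm (f x) \<le> u x"
    "integrable M v" "AE x in M. norm (g x) \<le> v x" by blast
  then show ?case
    by (intro exI[of _ "\<lambda>x. u x + v x"]) (auto elim!: eventually_elim2 intro: norm_triangle_mono)
next
  case (lim f)
  then obtain g h w where *: "integrable M h" "AE x in M. norm (f x - g x) \<le> h x"
    "integrable M w" "AE x in M. norm (g x) \<le> w x" by (meson zero_less_one)
  have "AE x in M. norm (f x) \<le> h x + w x"
    using *(2,4) by eventually_elim (metis add_mono norm_triangle_sub order_trans add.commute)
  with * show ?case by (intro exI[of _ "\<lambda>x. h x + w x"]) auto
qed

text \<open>One closure principle for multiplication, linear maps, substitutions and tensor
  products. It suffices to check multiples of a fixed vector, because passing from \<open>h\<close>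
  to \<open>m z * h (\<pi> z)\<close> increases integrals at most by the factor \<open>C\<close> and
  hence carries small errors to small errors.\<close>

lemma bochner_L1_pointwise_linear:
  assumes "bochner_L1 M f"
    and base: "\<And>\<phi> v. integrable M \<phi> \<Longrightarrow> bochner_L1 N (\<lambda>z. T z (\<phi> (\<pi> z) *\<^sub>R v))"
    and add: "\<And>z v w. T z (v + w) = T z v + T z w"
    and bound: "\<And>z v w. norm (T z v - T z w) \<le> m z * norm (v - w)"
    and m: "\<And>z. 0 \<le> m z"
    and int: "\<And>h. integrable M h \<Longrightarrow> integrable N (\<lambda>z. m z * h (\<pi> z))"
    and intb: "\<And>h. integrable M h \<Longrightarrow> integral\<^sup>L N (\<lambda>z. m z * h (\<pi> z)) \<le> C * integral\<^sup>L M h"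
    and AE: "\<And>Q. AE x in M. Q x \<Longrightarrow> AE z in N. Q (\<pi> z)"
  shows "bochner_L1 N (\<lambda>z. T z (f (\<pi> z)))"
  using assms(1)
proof induction
  case (base \<phi> v)
  then show ?case by (rule assms(2))
next
  case (add f g)
  then show ?case using bochner_L1.add by (simp add: assms(3))
next
  case (lim f)
  show ?case
  proof (rule bochner_L1.lim)
    fix e :: real assume "e > 0"
    \<comment> \<open>The absolute value and the summand 1 cover a constant \<open>C\<close> of
      unknown sign, possibly 0.\<close>
    then have "e / (\<bar>C\<bar> + 1) > 0" by auto
    from lim.IH[OF this] obtain g h where *: "bochner_L1 N (\<lambda>z. T z (g (\<pi> z)))" "integrable M h"
      "AE x in M. norm (f x - g x) \<le> h x" "integral\<^sup>L M h < e / (\<bar>C\<bar> + 1)" by blast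
    have "0 \<le> integral\<^sup>L M h"
      by (rule integral_nonneg_AE) (use *(3) in \<open>eventually_elim, metis norm_ge_zero order_trans\<close>)
    then have "C * integral\<^sup>L M h \<le> (\<bar>C\<bar> + 1) * integral\<^sup>L M h"
      by (intro mult_right_mono) auto
    also have "\<dots> < e" using *(4) by (simp add: field_simps)
    finally have "integral\<^sup>L N (\<lambda>z. m z * h (\<pi> z)) < e" using intb[OF *(2)] by linarith
    moreover have "AE z in N. norm (T z (f (\<pi> z)) - T z (g (\<pi> z))) \<le> m z * h (\<pi> z)"
      using AE[OF *(3)] by eventually_elim (meson bound m mult_left_mono order_trans)
    ultimately show "\<exists>g h. bochner_L1 N g \<and> integrable N h
        \<and> (AE x in N. norm (T x (f (\<pi> x)) - g x) \<le> h x) \<and> integral\<^sup>L N h < e"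
      using *(1) int[OF *(2)]
      by (intro exI[of _ "\<lambda>z. T z (g (\<pi> z))"] exI[of _ "\<lambda>z. m z * h (\<pi> z)"]) simp
  qed
qed

lemma bochner_L1_linear:
  fixes T :: "'a::banach \<Rightarrow> 'b::banach"
  assumes "bochner_L1 M f" "bounded_linear T"
  shows "bochner_L1 M (\<lambda>x. T (f x))"
proof -
  interpret bounded_linear T by fact
  obtain K where K: "\<And>x. norm (T x) \<le> norm x * K" "K \<ge> 0" using nonneg_bounded by blast
  show ?thesis
    by (rule bochner_L1_pointwise_linear[OF assms(1), where m = "\<lambda>_. K" and \<pi> = "\<lambda>x. x" and T = "\<lambda>_. T" and C = K])
       (use K in \<open>auto simp: scaleR add diff[symmetric] mult.commute bochner_L1.base\<close>)
qed

lemma bochner_L1_scaleR: "bochner_L1 M f \<Longrightarrow> bochner_L1 M (\<lambda>x. c *\<^sub>R f x)"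
  using bochner_L1_linear bounded_linear_scaleR_right by blast

lemma bochner_L1_diff:
  "bochner_L1 M f \<Longrightarrow> bochner_L1 M g \<Longrightarrow> bochner_L1 M (\<lambda>x. f x - g x)"
  using bochner_L1.add[of M f "\<lambda>x. (-1) *\<^sub>R g x"] bochner_L1_scaleR[of M g "-1"] by simp

lemma bochner_L1_bounded_mult:
  assumes "bochner_L1 M f" and [measurable]: "m \<in> borel_measurable M" and "\<And>x. \<bar>m x\<bar> \<le> C"
  shows "bochner_L1 M (\<lambda>x. m x *\<^sub>R f x)"
proof -
  have int: "integrable M (\<lambda>x. m x * h x)" if "integrable M h" for h :: "_ \<Rightarrow> real"
    by (rule Bochner_Integration.integrable_bound[where f = "\<lambda>x. C * h x"])
       (use that assms(3) in \<open>auto simp: abs_mult intro!: mult_right_mono AE_I2 intro: order_trans[OF _ abs_ge_self]\<close>)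
  have C: "C \<ge> 0" using assms(3) abs_ge_zero order_trans by blast
  show ?thesis
    by (rule bochner_L1_pointwise_linear[OF assms(1), where m = "\<lambda>_. C" and \<pi> = "\<lambda>x. x" and T = "\<lambda>z. (*\<^sub>R) (m z)" and C = C])
       (use assms(3) C int in \<open>auto simp: scaleR_add_right scaleR_diff_right[symmetric] bochner_L1.base intro!: mult_right_mono\<close>)
qed

text \<open>The multiplier is cut off at height \<open>n\<close>; the discarded part is dominated by
  \<open>w\<close> on the set where |m| > n, and these sets decrease to the empty set.\<close>

lemma bochner_L1_mult:
  assumes "bochner_L1 M f" and [measurable]: "m \<in> borel_measurable M" and w: "integrable M w"
    and le: "AE x in M. \<bar>m x\<bar> * norm (f x) \<le> w x"
  shows "bochner_L1 M (\<lambda>x. m x *\<^sub>R f x)"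
proof (rule bochner_L1_lim_sequence)
  note [measurable] = borel_measurable_integrable[OF w]
  let ?m = "\<lambda>n x. if \<bar>m x\<bar> \<le> real n then m x else 0"
  let ?h = "\<lambda>n x. if \<bar>m x\<bar> \<le> real n then 0 else w x"
  show "bochner_L1 M (\<lambda>x. ?m n x *\<^sub>R f x)" for n
    by (rule bochner_L1_bounded_mult[OF assms(1), where C = n]) auto
  show "integrable M (?h n)" for n
    by (rule Bochner_Integration.integrable_bound[OF w]) auto
  show "AE x in M. norm (m x *\<^sub>R f x - ?m n x *\<^sub>R f x) \<le> ?h n x" for n
    using le by eventually_elim auto
  have "(\<lambda>n. integral\<^sup>L M (?h n)) \<longlonglongrightarrow> integral\<^sup>L M (\<lambda>x. 0)"
  proof (rule integral_dominated_convergence[where w = "\<lambda>x. \<bar>w x\<bar>"])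
    show "AE x in M. (\<lambda>n. ?h n x) \<longlonglongrightarrow> 0"
    proof (intro AE_I2)
      fix x
      obtain N :: nat where "\<bar>m x\<bar> \<le> real N" using real_arch_simple by blast
      then have "\<forall>\<^sub>F n in sequentially. ?h n x = 0"
        by (intro eventually_sequentiallyI[of N]) auto
      then show "(\<lambda>n. ?h n x) \<longlonglongrightarrow> 0" by (rule tendsto_eventually)
    qed
  qed (use w in auto)
  then show "(\<lambda>n. integral\<^sup>L M (?h n)) \<longlonglongrightarrow> 0" by simp
qed

lemma bochner_L1_measure_preserving:
  assumes f: "bochner_L1 N f" and [measurable]: "T \<in> measurable M N" and "distr M N T = N"
  shows "bochner_L1 M (\<lambda>x. f (T x))"
proof -
  have int: "integrable M (\<lambda>x. h (T x))" "integral\<^sup>L M (\<lambda>x. h (T x)) = integral\<^sup>L N h"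
    if "integrable N h" for h :: "_ \<Rightarrow> real"
    using integrable_distr[of T M N h] integral_distr[of T M N h] that assms(3) by auto
  have AE: "AE x in M. Q (T x)" if "AE x in N. Q x" for Q
    using AE_distrD[of T M N Q] that assms(2,3) by metis
  show ?thesis
    by (rule bochner_L1_pointwise_linear[OF f, where m = "\<lambda>_. 1" and \<pi> = T and T = "\<lambda>_ v. v" and C = 1])
       (use int AE in \<open>auto intro: bochner_L1.base\<close>)
qed

text \<open>Finitely many values bring back measurability, which \<open>bochner_L1\<close> does not
  mention: the norm becomes a limit of measurable functions, and the level sets of an approximant
  can serve as test sets.\<close>

lemma bochner_L1_simple_approx:
  assumes "bochner_L1 M f" "e > (0::real)"
  shows "\<exists>g h. simple_function M g \<and> integrable M h \<and> (AE x in M. norm (f x - g x) \<le> h x) \<and> integral\<^sup>L M h < e"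
  using assms
proof (induction arbitrary: e)
  case (base \<phi> v)
  then have [measurable]: "\<phi> \<in> borel_measurable M" by auto
  from borel_measurable_implies_sequence_metric[OF this, of 0]
  obtain F where F: "\<And>i. simple_function M (F i :: _ \<Rightarrow> real)" "\<And>x. x \<in> space M \<Longrightarrow> (\<lambda>i. F i x) \<longlonglongrightarrow> \<phi> x"
    "\<And>i x. x \<in> space M \<Longrightarrow> \<bar>F i x\<bar> \<le> 2 * \<bar>\<phi> x\<bar>" by (auto simp: dist_real_def) metis
  note [measurable] = borel_measurable_simple_function[OF F(1)]
  define h where "h i x = \<bar>\<phi> x - F i x\<bar> * norm v" for i x
  \<comment> \<open>3 = 1 + 2, where 2 is the factor in the bound on the approximating simple
    functions.\<close>
  have le: "\<bar>h i x\<bar> \<le> (3 * \<bar>\<phi> x\<bar>) * norm v" if "x \<in> space M" for i x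
    unfolding h_def abs_mult using F(3)[OF that, of i]
    by (intro mult_mono) auto
  have hi: "integrable M (h i)" for i
    by (rule Bochner_Integration.integrable_bound[where f = "\<lambda>x. (3 * \<bar>\<phi> x\<bar>) * norm v"])
       (use base(1) le in \<open>auto simp: h_def[abs_def] abs_mult\<close>)
  have "(\<lambda>i. integral\<^sup>L M (h i)) \<longlonglongrightarrow> integral\<^sup>L M (\<lambda>x. 0)"
  proof (rule integral_dominated_convergence[where w = "\<lambda>x. (3 * \<bar>\<phi> x\<bar>) * norm v"])
    show "AE x in M. (\<lambda>i. h i x) \<longlonglongrightarrow> 0"
    proof (intro AE_I2)
      fix x assume "x \<in> space M"
      from tendsto_diff[OF tendsto_const F(2)[OF this], of "\<phi> x"]
      have "(\<lambda>i. \<phi> x - F i x) \<longlonglongrightarrow> 0" by simp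
      from tendsto_mult_left_zero[OF tendsto_rabs_zero[OF this], of "norm v"]
      show "(\<lambda>i. h i x) \<longlonglongrightarrow> 0" unfolding h_def .
    qed
  qed (use base(1) le in \<open>auto simp: h_def[abs_def]\<close>)
  then have "\<forall>\<^sub>F i in sequentially. integral\<^sup>L M (h i) < e"
    using base(2) by (intro order_tendstoD(2)) auto
  then obtain i where i: "integral\<^sup>L M (h i) < e" using eventually_happens by fastforce
  have "norm (\<phi> x *\<^sub>R v - F i x *\<^sub>R v) = h i x" for x
    unfolding h_def by (simp add: scaleR_diff_left[symmetric])
  moreover have "simple_function M (\<lambda>x. F i x *\<^sub>R v)"
    using simple_function_compose2[OF F(1)[of i] simple_function_const[of M v], of "(*\<^sub>R)"] by simp
  ultimately show ?case using hi i
    by (intro exI[of _ "\<lambda>x. F i x *\<^sub>R v"] exI[of _ "h i"]) auto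
next
  case (add f g)
  have "e / 2 > 0" using add.prems by simp
  from add.IH(1)[OF this] add.IH(2)[OF this] obtain f' h1 g' h2 where *: "simple_function M f'" "integrable M h1" 
    "AE x in M. norm (f x - f' x) \<le> h1 x" "integral\<^sup>L M h1 < e / 2"
    "simple_function M g'" "integrable M h2" 
    "AE x in M. norm (g x - g' x) \<le> h2 x" "integral\<^sup>L M h2 < e / 2" by blast
  have "AE x in M. norm (f x + g x - (f' x + g' x)) \<le> h1 x + h2 x"
    using *(3,7) by eventually_elim (metis add_diff_add norm_triangle_mono)
  moreover have "simple_function M (\<lambda>x. f' x + g' x)"
    using simple_function_compose2[OF *(1) *(5), of "(+)"] .
  ultimately show ?case using *
    by (intro exI[of _ "\<lambda>x. f' x + g' x"] exI[of _ "\<lambda>x. h1 x + h2 x"]) auto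
next
  case (lim f)
  have e2: "e / 2 > 0" using lim.prems by simp
  from lim.IH[OF this] obtain g h where *: "integrable M h"
    "AE x in M. norm (f x - g x) \<le> h x" "integral\<^sup>L M h < e / 2"
    and gs: "\<And>e. e > 0 \<Longrightarrow> \<exists>g' h. simple_function M g' \<and> integrable M h \<and> (AE x in M. norm (g x - g' x) \<le> h x) \<and> integral\<^sup>L M h < e"
    by blast
  obtain g' h' where **: "simple_function M g'" "integrable M h'"
    "AE x in M. norm (g x - g' x) \<le> h' x" "integral\<^sup>L M h' < e / 2"
    using gs[OF e2] by blast
  have "AE x in M. norm (f x - g' x) \<le> h x + h' x"
    using *(2) **(3) by eventually_elim (metis (no_types) diff_add_cancel add_diff_eq norm_triangle_mono)
  then show ?case using * **
    by (intro exI[of _ "g'"] exI[of _ "\<lambda>x. h x + h' x"]) auto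
qed

text \<open>Only equality almost everywhere with a measurable function is claimed, since
  \<open>M\<close> need not be complete. This is what makes the zero set of \<open>f\<close>
  accessible to Fubini's theorem for null sets.\<close>

lemma bochner_L1_norm_measurable:
  assumes "bochner_L1 M f"
  shows "\<exists>n\<in>borel_measurable M. AE x in M. norm (f x) = n x"
proof -
  obtain g where g: "\<And>n::nat. simple_function M (g n)" "AE x in M. (\<lambda>n. g n x) \<longlonglongrightarrow> f x"
    using approx_sequence[where P = "simple_function M", OF bochner_L1_simple_approx[OF assms]] by blast
  have [measurable]: "(\<lambda>x. norm (g n x)) \<in> borel_measurable M" for n
    by (rule borel_measurable_simple_function[OF simple_function_compose1[OF g(1)]])
  show ?thesis
  proof (rule bexI[of _ "\<lambda>x. lim (\<lambda>n. norm (g n x))"])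
    show "AE x in M. norm (f x) = lim (\<lambda>n. norm (g n x))"
      using g(2) by eventually_elim (metis limI tendsto_norm)
  qed measurable
qed

section \<open>Gauge integrals of strongly integrable functions\<close>

hide_const (open) Polynomial.content

lemma AE_lborel_iff_negligible:
  "(AE x in lborel. P x) \<longleftrightarrow> negligible {x :: 'n::euclidean_space. \<not> P x}"
proof -
  have "(AE x in lborel. P x) \<longleftrightarrow> (AE x in lebesgue. P x)" by (simp add: AE_completion_iff)
  also have "\<dots> \<longleftrightarrow> {x. \<not> P x} \<in> null_sets lebesgue"
  proof
    assume "AE x in lebesgue. P x"
    then obtain N where "N \<in> null_sets lebesgue" "{x. \<not> P x} \<subseteq> N"
      by (auto simp: eventually_ae_filter)
    then show "{x. \<not> P x} \<in> null_sets lebesgue"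
      using negligible_subset negligible_iff_null_sets by blast
  qed (auto simp: eventually_ae_filter)
  finally show ?thesis by (simp add: negligible_iff_null_sets)
qed

lemma integral_UNIV_AE_cong:
  fixes f :: "'n::euclidean_space \<Rightarrow> 'a::banach"
  assumes "AE x in lborel. f x = g x"
  shows "integral UNIV f = integral UNIV g"
  by (rule integral_spike[of "{x. \<not> f x = g x}"])
     (use assms in \<open>auto simp: AE_lborel_iff_negligible\<close>)

text \<open>At common tags the Riemann sums of \<open>f\<close> and \<open>g\<close> differ by at
  most the Riemann sum of \<open>h\<close>, so the Cauchy criterion passes from \<open>g\<close> to
  \<open>f\<close>. The domination is required at every point because any point can be a
  tag.\<close>

lemma integrable_cbox_approx:
  fixes f :: "'n::euclidean_space \<Rightarrow> 'a::banach"
  assumes "\<And>e. e > 0 \<Longrightarrow> \<exists>g h. g integrable_on cbox a b \<and> h integrable_on cbox a b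
      \<and> (\<forall>x\<in>cbox a b. norm (f x - g x) \<le> h x) \<and> integral (cbox a b) h < e"
  shows "f integrable_on cbox a b"
  unfolding integrable_Cauchy
proof (intro allI impI)
  fix e :: real assume "e > 0"
  \<comment> \<open>The integral of \<open>h\<close> and its Riemann error give e/3, the Riemann
    error of \<open>g\<close> another e/6, and comparing two divisions doubles the resulting
    e/2.\<close>
  then have e6: "e / 6 > 0" by simp
  obtain g h where g: "g integrable_on cbox a b" and h: "h integrable_on cbox a b"
    and le: "\<And>x. x \<in> cbox a b \<Longrightarrow> norm (f x - g x) \<le> h x" and small: "integral (cbox a b) h < e / 6"
    using assms[OF e6] by blast
  obtain \<gamma>1 where \<gamma>1: "gauge \<gamma>1" "\<And>\<D>. \<D> tagged_division_of (cbox a b) \<Longrightarrow> \<gamma>1 fine \<D> \<Longrightarrow>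
      norm ((\<Sum>(x,k)\<in>\<D>. content k *\<^sub>R g x) - integral (cbox a b) g) < e / 6"
    using has_integralD[OF integrable_integral[OF g] e6] by blast
  obtain \<gamma>2 where \<gamma>2: "gauge \<gamma>2" "\<And>\<D>. \<D> tagged_division_of (cbox a b) \<Longrightarrow> \<gamma>2 fine \<D> \<Longrightarrow>
      norm ((\<Sum>(x,k)\<in>\<D>. content k *\<^sub>R h x) - integral (cbox a b) h) < e / 6"
    using has_integralD[OF integrable_integral[OF h] e6] by blast
  have close: "norm ((\<Sum>(x,k)\<in>\<D>. content k *\<^sub>R f x) - integral (cbox a b) g) < e / 2"
    if \<D>: "\<D> tagged_division_of (cbox a b)" "(\<lambda>x. \<gamma>1 x \<inter> \<gamma>2 x) fine \<D>" for \<D>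
  proof -
    have fine: "\<gamma>1 fine \<D>" "\<gamma>2 fine \<D>" using \<D>(2) by (auto simp: fine_Int)
    have "norm ((\<Sum>(x,k)\<in>\<D>. content k *\<^sub>R f x) - (\<Sum>(x,k)\<in>\<D>. content k *\<^sub>R g x))
        = norm (\<Sum>(x,k)\<in>\<D>. content k *\<^sub>R (f x - g x))"
      by (simp add: sum_subtractf[symmetric] split_def scaleR_diff_right)
    also have "\<dots> \<le> (\<Sum>(x,k)\<in>\<D>. content k *\<^sub>R h x)"
    proof (rule sum_norm_le)
      fix p assume "p \<in> \<D>"
      moreover obtain x k where p: "p = (x, k)" by (cases p)
      ultimately have "x \<in> cbox a b" using \<D>(1) by (auto dest: tagged_division_ofD(2,3))
      then show "norm (case p of (x,k) \<Rightarrow> content k *\<^sub>R (f x - g x)) \<le> (case p of (x,k) \<Rightarrow> content k *\<^sub>R h x)"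
        using le by (simp add: p mult_left_mono)
    qed
    also have "\<dots> < integral (cbox a b) h + e / 6"
      using \<gamma>2(2)[OF \<D>(1) fine(2)] unfolding real_norm_def real_scaleR_def by linarith
    finally have "norm ((\<Sum>(x,k)\<in>\<D>. content k *\<^sub>R f x) - (\<Sum>(x,k)\<in>\<D>. content k *\<^sub>R g x)) < e / 3"
      using small by simp
    with \<gamma>1(2)[OF \<D>(1) fine(1)] show ?thesis
      using norm_triangle_lt[of "(\<Sum>(x,k)\<in>\<D>. content k *\<^sub>R f x) - (\<Sum>(x,k)\<in>\<D>. content k *\<^sub>R g x)"
        "(\<Sum>(x,k)\<in>\<D>. content k *\<^sub>R g x) - integral (cbox a b) g" "e / 2"] by simp
  qed
  show "\<exists>\<gamma>. gauge \<gamma> \<and> (\<forall>\<D>1 \<D>2. \<D>1 tagged_division_of cbox a b \<and> \<gamma> fine \<D>1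
      \<and> \<D>2 tagged_division_of cbox a b \<and> \<gamma> fine \<D>2 \<longrightarrow>
      norm ((\<Sum>(x,k)\<in>\<D>1. content k *\<^sub>R f x) - (\<Sum>(x,k)\<in>\<D>2. content k *\<^sub>R f x)) < e)"
  proof (intro exI[of _ "\<lambda>x. \<gamma>1 x \<inter> \<gamma>2 x"] conjI allI impI)
    show "gauge (\<lambda>x. \<gamma>1 x \<inter> \<gamma>2 x)" using \<gamma>1(1) \<gamma>2(1) by (rule gauge_Int)
    fix \<D>1 \<D>2
    assume "\<D>1 tagged_division_of cbox a b \<and> (\<lambda>x. \<gamma>1 x \<inter> \<gamma>2 x) fine \<D>1
      \<and> \<D>2 tagged_division_of cbox a b \<and> (\<lambda>x. \<gamma>1 x \<inter> \<gamma>2 x) fine \<D>2"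
    then show "norm ((\<Sum>(x,k)\<in>\<D>1. content k *\<^sub>R f x) - (\<Sum>(x,k)\<in>\<D>2. content k *\<^sub>R f x)) < e"
      by (intro norm_triangle_half_l[OF close close]) auto
  qed
qed

text \<open>In the limit case \<open>f\<close> is redefined as 0 on a null set so that all bounds
  hold everywhere. The approximation then gives integrability on boxes, and the global majorant
  \<open>w\<close> extends it to the whole space.\<close>

lemma bochner_L1_integrable_on:
  fixes f :: "'n::euclidean_space \<Rightarrow> 'a::banach"
  assumes "bochner_L1 lborel f"
  shows "f integrable_on UNIV"
  using assms
proof induction
  case (base \<phi> v)
  then show ?case by (intro integrable_on_scaleR_left integrable_on_lborel)
next
  case (add f g)
  then show ?case by (intro integrable_add)
next
  case (lim f)
  have f: "bochner_L1 lborel f" by (rule bochner_L1.lim) (use lim in blast)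
  have "\<exists>g h. g integrable_on UNIV \<and> integrable lborel h
          \<and> (AE x in lborel. norm (f x - g x) \<le> h x) \<and> integral\<^sup>L lborel h < e" if "e > 0" for e :: real
    using lim[OF that] by blast
  from approx_sequence[where P = "\<lambda>g. g integrable_on UNIV", OF this] obtain g h where
    gh: "\<And>n::nat. g n integrable_on UNIV" "\<And>n. integrable lborel (h n)"
    "\<And>n. AE x in lborel. norm (f x - g n x) \<le> h n x" "\<And>n x. 0 \<le> h n x"
    "(\<lambda>n. integral\<^sup>L lborel (h n)) \<longlonglongrightarrow> 0" by blast
  obtain w where w: "integrable lborel w" "AE x in lborel. norm (f x) \<le> w x"
    using bochner_L1_bound[OF f] by blast
  define N where "N = {x. \<not> (norm (f x) \<le> w x \<and> (\<forall>n. norm (f x - g n x) \<le> h n x))}"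
  have "AE x in lborel. norm (f x) \<le> w x \<and> (\<forall>n. norm (f x - g n x) \<le> h n x)"
    using w(2) gh(3) by (simp add: AE_all_countable)
  then have N: "negligible N" unfolding N_def AE_lborel_iff_negligible .
  define f' where "f' x = (if x \<in> N then 0 else f x)" for x
  have "f' integrable_on UNIV"
  proof (rule integrable_on_all_intervals_UNIV)
    show "norm (f' x) \<le> \<bar>w x\<bar>" for x unfolding f'_def N_def by auto
    show "(\<lambda>x. \<bar>w x\<bar>) integrable_on UNIV" using w(1) by (intro integrable_on_lborel) simp
    fix a b :: 'n
    show "f' integrable_on cbox a b"
    proof (rule integrable_cbox_approx)
      fix e :: real assume "e > 0"
      then obtain n where n: "integral\<^sup>L lborel (h n) < e"
        using order_tendstoD(2)[OF gh(5)] by (meson eventually_happens trivial_limit_sequentially)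
      have "integral (cbox a b) (h n) \<le> integral UNIV (h n)"
        by (rule integral_subset_le)
           (use gh(4) integrable_on_lborel[OF gh(2)] in \<open>auto intro: integrable_on_subcbox[where S = UNIV]\<close>)
      then have "integral (cbox a b) (h n) < e" using n integral_lborel[OF gh(2)] by simp
      moreover have "(\<lambda>x. if x \<in> N then 0 else g n x) integrable_on cbox a b"
        by (rule integrable_spike[where f = "g n" and S = N])
           (use gh(1) N in \<open>auto intro: integrable_on_subcbox[where S = UNIV]\<close>)
      moreover have "h n integrable_on cbox a b"
        using integrable_on_lborel[OF gh(2)] by (auto intro: integrable_on_subcbox[where S = UNIV])
      moreover have "norm (f' x - (if x \<in> N then 0 else g n x)) \<le> h n x" for x
        unfolding f'_def using gh(4) by (auto simp: N_def)
      ultimately show "\<exists>g h. g integrable_on cbox a b \<and> h integrable_on cbox a b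
        \<and> (\<forall>x\<in>cbox a b. norm (f' x - g x) \<le> h x) \<and> integral (cbox a b) h < e" by blast
    qed
  qed
  then show ?case
    by (rule integrable_spike[OF _ N]) (auto simp: f'_def)
qed

lemma norm_integral_bochner_L1_le:
  fixes f :: "'n::euclidean_space \<Rightarrow> 'a::banach"
  assumes f: "bochner_L1 lborel f" and h: "integrable lborel h"
    and le: "AE x in lborel. norm (f x) \<le> h x"
  shows "norm (integral UNIV f) \<le> integral\<^sup>L lborel h"
proof -
  let ?N = "{x. \<not> norm (f x) \<le> h x}"
  have N: "negligible ?N" using le by (simp add: AE_lborel_iff_negligible)
  have "norm (integral UNIV (\<lambda>x. if x \<in> ?N then 0 else f x)) \<le> integral UNIV (\<lambda>x. if x \<in> ?N then 0 else h x)"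
    by (rule Henstock_Kurzweil_Integration.integral_norm_bound_integral)
       (use N bochner_L1_integrable_on[OF f] integrable_on_lborel[OF h] in
         \<open>auto intro: integrable_spike[where S = ?N and f = f] integrable_spike[where S = ?N and f = h]\<close>)
  also have "integral UNIV (\<lambda>x. if x \<in> ?N then 0 else f x) = integral UNIV f"
    by (rule integral_spike[OF N]) auto
  also have "integral UNIV (\<lambda>x. if x \<in> ?N then 0 else h x) = integral UNIV h"
    by (rule integral_spike[OF N]) auto
  also have "\<dots> = integral\<^sup>L lborel h" by (rule integral_lborel[OF h])
  finally show ?thesis .
qed

lemma integral_bochner_L1_diff:
  fixes f g :: "'n::euclidean_space \<Rightarrow> 'a::banach"
  assumes "bochner_L1 lborel f" "bochner_L1 lborel g"
  shows "integral UNIV (\<lambda>x. f x - g x) = integral UNIV f - integral UNIV g"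
  using assms by (intro Henstock_Kurzweil_Integration.integral_diff bochner_L1_integrable_on)

lemma integral_bochner_L1_add:
  fixes f g :: "'n::euclidean_space \<Rightarrow> 'a::banach"
  assumes "bochner_L1 lborel f" "bochner_L1 lborel g"
  shows "integral UNIV (\<lambda>x. f x + g x) = integral UNIV f + integral UNIV g"
  using assms by (intro Henstock_Kurzweil_Integration.integral_add bochner_L1_integrable_on)

lemma integral_bochner_L1_linear:
  fixes f :: "'n::euclidean_space \<Rightarrow> 'a::banach"
  assumes "bochner_L1 lborel f" "bounded_linear T"
  shows "integral UNIV (\<lambda>x. T (f x)) = T (integral UNIV f)"
  using integral_linear[OF bochner_L1_integrable_on[OF assms(1)] assms(2)] by (simp add: o_def)

lemma integral_bochner_L1_tendsto:
  fixes f :: "'n::euclidean_space \<Rightarrow> 'a::banach"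
  assumes "bochner_L1 lborel f" "\<And>n::nat. bochner_L1 lborel (g n)" "\<And>n. integrable lborel (h n)"
    "\<And>n. AE x in lborel. norm (f x - g n x) \<le> h n x" "(\<lambda>n. integral\<^sup>L lborel (h n)) \<longlonglongrightarrow> 0"
  shows "(\<lambda>n. integral UNIV (g n)) \<longlonglongrightarrow> integral UNIV f"
proof -
  have "norm (integral UNIV (g n) - integral UNIV f) \<le> integral\<^sup>L lborel (h n)" for n
    unfolding norm_minus_commute[of "integral UNIV (g n)"]
      integral_bochner_L1_diff[OF assms(1,2), symmetric]
    by (intro norm_integral_bochner_L1_le bochner_L1_diff assms)
  then have "(\<lambda>n. integral UNIV (g n) - integral UNIV f) \<longlonglongrightarrow> 0"
    by (intro Lim_null_comparison[OF _ assms(5)] always_eventually allI)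
  then show ?thesis by (simp add: LIM_zero_iff)
qed

text \<open>Dominated convergence when only a scalar factor varies: the error is controlled by
  \<open>\<bar>m' x - m n x\<bar> * \<bar>w x\<bar>\<close>, to which the scalar theorem
  applies.\<close>

lemma integral_bochner_L1_dominated_mult:
  fixes f :: "'n::euclidean_space \<Rightarrow> 'a::banach"
  assumes f: "bochner_L1 lborel f" and [measurable]: "\<And>n::nat. m n \<in> borel_measurable lborel"
    "m' \<in> borel_measurable lborel"
    and bd: "\<And>n x. \<bar>m n x\<bar> \<le> 1" "\<And>x. \<bar>m' x\<bar> \<le> 1"
    and conv: "AE x in lborel. (\<lambda>n. m n x) \<longlonglongrightarrow> m' x"
  shows "(\<lambda>n. integral UNIV (\<lambda>x. m n x *\<^sub>R f x)) \<longlonglongrightarrow> integral UNIV (\<lambda>x. m' x *\<^sub>R f x)"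
proof -
  obtain w where w: "integrable lborel w" "AE x in lborel. norm (f x) \<le> w x"
    using bochner_L1_bound[OF f] by blast
  note [measurable] = borel_measurable_integrable[OF w(1)]
  have le: "\<bar>m' x - m n x\<bar> * \<bar>w x\<bar> \<le> 2 * \<bar>w x\<bar>" for n x
    using bd(1)[of n x] bd(2)[of x] by (intro mult_right_mono) auto
  show ?thesis
  proof (rule integral_bochner_L1_tendsto)
    show "bochner_L1 lborel (\<lambda>x. m' x *\<^sub>R f x)" "bochner_L1 lborel (\<lambda>x. m n x *\<^sub>R f x)" for n
      by (rule bochner_L1_bounded_mult[OF f _ bd(2)] bochner_L1_bounded_mult[OF f _ bd(1)], measurable)+
    show "integrable lborel (\<lambda>x. \<bar>m' x - m n x\<bar> * \<bar>w x\<bar>)" for n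
      by (rule Bochner_Integration.integrable_bound[where f = "\<lambda>x. 2 * \<bar>w x\<bar>"])
         (use w le in \<open>auto simp: abs_mult\<close>)
    show "AE x in lborel. norm (m' x *\<^sub>R f x - m n x *\<^sub>R f x) \<le> \<bar>m' x - m n x\<bar> * \<bar>w x\<bar>" for n
      using w(2) by eventually_elim (auto simp: scaleR_diff_left[symmetric] intro!: mult_left_mono)
    have "(\<lambda>n. integral\<^sup>L lborel (\<lambda>x. \<bar>m' x - m n x\<bar> * \<bar>w x\<bar>)) \<longlonglongrightarrow> integral\<^sup>L lborel (\<lambda>x::'n. 0)"
    proof (rule Bochner_Integration.integral_dominated_convergence[where w = "\<lambda>x. 2 * \<bar>w x\<bar>"])
      show "AE x in lborel. (\<lambda>n. \<bar>m' x - m n x\<bar> * \<bar>w x\<bar>) \<longlonglongrightarrow> 0"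
        using conv
      proof eventually_elim
        case (elim x)
        from tendsto_diff[OF tendsto_const elim, of "m' x"]
        have "(\<lambda>n. m' x - m n x) \<longlonglongrightarrow> 0" by simp
        then show ?case by (intro tendsto_mult_left_zero tendsto_rabs_zero)
      qed
    qed (use w le in \<open>auto simp: abs_mult\<close>)
    then show "(\<lambda>n. integral\<^sup>L lborel (\<lambda>x. \<bar>m' x - m n x\<bar> * \<bar>w x\<bar>)) \<longlonglongrightarrow> 0" by simp
  qed
qed

lemma integral_bochner_L1_measure_preserving:
  fixes f :: "'n::euclidean_space \<Rightarrow> 'a::banach" and T :: "'k::euclidean_space \<Rightarrow> 'n"
  assumes "bochner_L1 lborel f" and T[measurable]: "T \<in> borel_measurable borel"
    and distr: "distr lborel borel T = lborel"
  shows "integral UNIV (\<lambda>x. f (T x)) = integral UNIV f"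
proof -
  have distr': "distr lborel lborel T = lborel"
    using distr by (simp add: distr_cong[OF refl sets_lborel refl])
  have T': "T \<in> measurable lborel lborel" by simp
  have int: "integrable lborel (\<lambda>x. h (T x))" "integral\<^sup>L lborel (\<lambda>x. h (T x)) = integral\<^sup>L lborel h"
    if "integrable lborel h" for h :: "_ \<Rightarrow> real"
    using integrable_distr[of T lborel lborel h] integral_distr[of T lborel lborel h] that distr' by auto
  have AE: "AE x in lborel. Q (T x)" if "AE x in lborel. Q x" for Q
    using AE_distrD[of T lborel lborel Q] that distr' T' by metis
  have pres: "bochner_L1 lborel (\<lambda>x. f (T x))" if "bochner_L1 lborel f" for f :: "'n \<Rightarrow> 'a"
    by (rule bochner_L1_measure_preserving[OF that T' distr'])
  show ?thesis using assms(1)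
  proof induction
    case (base \<phi> v)
    have "((\<lambda>x. \<phi> x *\<^sub>R v) has_integral integral\<^sup>L lborel \<phi> *\<^sub>R v) UNIV"
      "((\<lambda>x. \<phi> (T x) *\<^sub>R v) has_integral integral\<^sup>L lborel \<phi> *\<^sub>R v) UNIV"
      using has_integral_integral_lborel[OF int(1)[OF base]] has_integral_integral_lborel[OF base] int(2)[OF base]
      by (auto intro: has_integral_scaleR_left)
    then show ?case using integral_unique by metis
  next
    case (add f g)
    then show ?case by (simp add: integral_bochner_L1_add pres)
  next
    case (lim f)
    have f: "bochner_L1 lborel f" by (rule bochner_L1.lim) (use lim in blast)
    have "\<exists>g h. (bochner_L1 lborel g \<and> integral UNIV (\<lambda>x. g (T x)) = integral UNIV g) \<and> integrable lborel h
          \<and> (AE x in lborel. norm (f x - g x) \<le> h x) \<and> integral\<^sup>L lborel h < e" if "e > 0" for e :: real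
      using lim[OF that] by blast
    from approx_sequence[where P = "\<lambda>g. bochner_L1 lborel g \<and> integral UNIV (\<lambda>x. g (T x)) = integral UNIV g", OF this]
    obtain g h where gh: "\<And>n::nat. bochner_L1 lborel (g n)"
      "\<And>n. integral UNIV (\<lambda>x. g n (T x)) = integral UNIV (g n)" "\<And>n. integrable lborel (h n)"
      "\<And>n. AE x in lborel. norm (f x - g n x) \<le> h n x"
      "(\<lambda>n. integral\<^sup>L lborel (h n)) \<longlonglongrightarrow> 0" by blast
    have "(\<lambda>n. integral UNIV (g n)) \<longlonglongrightarrow> integral UNIV f"
      by (rule integral_bochner_L1_tendsto[OF f gh(1,3,4,5)])
    moreover have "(\<lambda>n. integral UNIV (\<lambda>x. g n (T x))) \<longlonglongrightarrow> integral UNIV (\<lambda>x. f (T x))"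
      by (rule integral_bochner_L1_tendsto[where h = "\<lambda>n x. h n (T x)"])
         (use f gh int AE[OF gh(4)] pres in auto)
    ultimately show ?case unfolding gh(2) by (rule LIMSEQ_unique[symmetric])
  qed
qed

subsection \<open>Product measures and Fubini's theorem\<close>

abbreviation plane :: "(real \<times> real) measure" where
  "plane \<equiv> lborel \<Otimes>\<^sub>M lborel"

lemma AE_pair_fst:
  assumes "AE x in lborel. Q x"
  shows "AE z in plane. Q (fst (z :: real \<times> real))"
proof -
  obtain N where N: "N \<in> null_sets lborel" "{x. \<not> Q x} \<subseteq> N"
    using assms by (auto simp: eventually_ae_filter)
  then have [measurable]: "N \<in> sets borel" by auto
  have "AE z in plane. fst z \<notin> N"
  proof (rule lborel_pair.AE_pair_measure)
    show "{z \<in> space plane. fst z \<notin> N} \<in> sets plane"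
      by measurable
  qed (use AE_not_in[OF N(1)] in auto)
  then show ?thesis by eventually_elim (use N(2) in auto)
qed

lemma AE_pair_snd:
  assumes "AE x in lborel. Q x"
  shows "AE z in plane. Q (snd (z :: real \<times> real))"
proof -
  obtain N where N: "N \<in> null_sets lborel" "{x. \<not> Q x} \<subseteq> N"
    using assms by (auto simp: eventually_ae_filter)
  then have [measurable]: "N \<in> sets borel" by auto
  have "AE z in plane. snd z \<notin> N"
  proof (rule lborel_pair.AE_pair_measure)
    show "{z \<in> space plane. snd z \<notin> N} \<in> sets plane"
      by measurable
  qed (use AE_not_in[OF N(1)] in auto)
  then show ?thesis by eventually_elim (use N(2) in auto)
qed

lemma integrable_tensor:
  fixes f g :: "real \<Rightarrow> real"
  assumes f: "integrable lborel f" and g: "integrable lborel g"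
  shows "integrable plane (\<lambda>z. f (fst z) * g (snd z))"
    and "integral\<^sup>L plane (\<lambda>z. f (fst z) * g (snd z)) = integral\<^sup>L lborel f * integral\<^sup>L lborel g"
proof -
  note [measurable] = borel_measurable_integrable[OF f] borel_measurable_integrable[OF g]
  show int: "integrable plane (\<lambda>z. f (fst z) * g (snd z))"
    by (rule lborel_pair.Fubini_integrable) (use f g in \<open>auto simp: abs_mult\<close>)
  show "integral\<^sup>L plane (\<lambda>z. f (fst z) * g (snd z)) = integral\<^sup>L lborel f * integral\<^sup>L lborel g"
    using lborel_pair.integral_fst'[OF int] by simp
qed

lemma bochner_L1_tensor:
  fixes f :: "real \<Rightarrow> 'a::banach" and \<psi> :: "real \<Rightarrow> real"
  assumes f: "bochner_L1 lborel f" and \<psi>: "integrable lborel \<psi>"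
  shows "bochner_L1 plane (\<lambda>z. \<psi> (snd z) *\<^sub>R f (fst z))"
proof (rule bochner_L1_pointwise_linear[OF f, where T = "\<lambda>z. (*\<^sub>R) (\<psi> (snd z))" and \<pi> = fst
      and m = "\<lambda>z. \<bar>\<psi> (snd z)\<bar>" and C = "integral\<^sup>L lborel (\<lambda>x. \<bar>\<psi> x\<bar>)"])
  fix \<phi> :: "real \<Rightarrow> real" and v :: 'a assume "integrable lborel \<phi>"
  from bochner_L1.base[OF integrable_tensor(1)[OF this \<psi>]]
  show "bochner_L1 plane (\<lambda>z. \<psi> (snd z) *\<^sub>R \<phi> (fst z) *\<^sub>R v)"
    by (simp add: mult.commute)
next
  fix h :: "real \<Rightarrow> real" assume "integrable lborel h"
  from integrable_tensor[OF this integrable_abs[OF \<psi>]]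
  show "integrable plane (\<lambda>z. \<bar>\<psi> (snd z)\<bar> * h (fst z))"
    "integral\<^sup>L plane (\<lambda>z. \<bar>\<psi> (snd z)\<bar> * h (fst z)) \<le> integral\<^sup>L lborel (\<lambda>x. \<bar>\<psi> x\<bar>) * integral\<^sup>L lborel h"
    by (simp_all add: mult.commute)
qed (auto simp: scaleR_add_right scaleR_diff_right[symmetric] intro: AE_pair_fst)

text \<open>Makes S(p)B(q)x jointly integrable although S is only strongly integrable: for f =
  \<phi> v the function is a scalar function of q times an orbit in p, and the operator bound
  \<open>\<kappa>\<close> carries the approximation in \<open>f\<close>.\<close>

lemma bochner_L1_operator_tensor:
  fixes f :: "real \<Rightarrow> 'a::banach" and T :: "real \<Rightarrow> 'a \<Rightarrow> 'b::banach"
  assumes f: "bochner_L1 lborel f" and lin: "\<And>p. bounded_linear (T p)"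
    and T: "\<And>v. bochner_L1 lborel (\<lambda>p. T p v)"
    and bd: "\<And>p v. norm (T p v) \<le> \<kappa> p * norm v" and \<kappa>: "integrable lborel \<kappa>" "\<And>p. 0 \<le> \<kappa> p"
  shows "bochner_L1 plane (\<lambda>z. T (fst z) (f (snd z)))"
proof (rule bochner_L1_pointwise_linear[OF f, where T = "\<lambda>z. T (fst z)" and \<pi> = snd
      and m = "\<lambda>z. \<kappa> (fst z)" and C = "integral\<^sup>L lborel \<kappa>"])
  fix \<phi> :: "real \<Rightarrow> real" and v :: 'a assume "integrable lborel \<phi>"
  from bochner_L1_tensor[OF T this, of v]
  show "bochner_L1 plane (\<lambda>z. T (fst z) (\<phi> (snd z) *\<^sub>R v))"
    by (simp add: linear_simps[OF lin])
next
  fix h :: "real \<Rightarrow> real" assume "integrable lborel h"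
  from integrable_tensor[OF \<kappa>(1) this]
  show "integrable plane (\<lambda>z. \<kappa> (fst z) * h (snd z))"
    "integral\<^sup>L plane (\<lambda>z. \<kappa> (fst z) * h (snd z)) \<le> integral\<^sup>L lborel \<kappa> * integral\<^sup>L lborel h"
    by simp_all
next
  show "norm (T (fst z) v - T (fst z) w) \<le> \<kappa> (fst z) * norm (v - w)" for z :: "real \<times> real" and v w
    using bd[of "fst z" "v - w"] by (simp add: linear_simps(2)[OF lin])
qed (use \<kappa> in \<open>auto simp: linear_simps(1)[OF lin] intro: AE_pair_snd\<close>)

lemma distr_lborel_affine:
  fixes t c :: real
  assumes "\<bar>c\<bar> = 1"
  shows "distr lborel borel (\<lambda>x. t + c * x) = lborel"
proof -
  have "c \<noteq> 0" using assms by auto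
  from lborel_real_affine[OF this, of t] show ?thesis
    unfolding assms ennreal_1 density_1 by (rule sym)
qed

text \<open>Each horizontal section is merely translated. With c = 1 or c = -1 and the swap of
  coordinates, shears turn tensor products into convolution integrands and product coordinates into
  antidiagonal ones.\<close>

lemma distr_shear:
  fixes c :: real
  shows "distr plane plane (\<lambda>z. (fst z + c * snd z, snd z)) = plane"
    (is "distr plane plane ?T = plane")
proof (rule pair_measure_eqI[symmetric])
  fix A B :: "real set" assume "A \<in> sets lborel" "B \<in> sets lborel"
  then have [measurable]: "A \<in> sets borel" "B \<in> sets borel" by auto
  have T: "?T \<in> measurable plane plane" by measurable
  have AB: "A \<times> B \<in> sets plane" by simp
  have "emeasure (distr plane plane ?T) (A \<times> B) = emeasure plane (?T -` (A \<times> B) \<inter> space plane)"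
    by (rule emeasure_distr[OF T AB])
  also have "\<dots> = (\<integral>\<^sup>+y. emeasure lborel ((\<lambda>x. (x, y)) -` (?T -` (A \<times> B) \<inter> space plane)) \<partial>lborel)"
    by (rule lborel_pair.emeasure_pair_measure_alt2) (use measurable_sets[OF T AB] in simp)
  also have "\<dots> = (\<integral>\<^sup>+y. emeasure lborel A * indicator B y \<partial>lborel)"
  proof (rule nn_integral_cong)
    fix y :: real
    have "emeasure lborel A = emeasure (distr lborel borel (\<lambda>x. c * y + 1 * x)) A"
      by (subst distr_lborel_affine) simp_all
    also have "\<dots> = emeasure lborel ((\<lambda>x. x + c * y) -` A)"
      by (subst emeasure_distr) (auto simp: add.commute)
    finally show "emeasure lborel ((\<lambda>x. (x, y)) -` (?T -` (A \<times> B) \<inter> space plane)) = emeasure lborel A * indicator B y"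
      by (auto simp: vimage_def space_pair_measure indicator_def)
  qed
  also have "\<dots> = emeasure lborel A * emeasure lborel B"
    by (subst nn_integral_cmult) auto
  finally show "emeasure lborel A * emeasure lborel B = emeasure (distr plane plane ?T) (A \<times> B)" ..
qed (auto intro: sigma_finite_lborel)

lemma measurable_shear [measurable]:
  "(\<lambda>z. (fst z + c * snd z, snd z)) \<in> measurable plane plane" for c :: real
  by measurable

lemma AE_shear:
  fixes c :: real
  assumes "AE z in plane. Q z"
  shows "AE z in plane. Q (fst z + c * snd z, snd z)"
  using AE_distrD[OF measurable_shear[of c], of Q] assms unfolding distr_shear by simp

lemma distr_swap_lborel:
  "distr plane plane (\<lambda>z. (snd z, fst z)) = plane"
  using lborel_pair.distr_pair_swap[where ?'a = real and ?'b = real, symmetric] by (simp add: split_def)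

lemma AE_swap:
  assumes "AE z in plane. Q (z :: real \<times> real)"
  shows "AE z in plane. Q (snd z, fst z)"
proof -
  have "(\<lambda>z. (snd z, fst z)) \<in> measurable plane plane"
    by measurable
  from AE_distrD[OF this, of Q] assms show ?thesis unfolding distr_swap_lborel by simp
qed

lemma bochner_L1_shear:
  fixes F :: "real \<times> real \<Rightarrow> 'a::banach"
  shows "bochner_L1 plane F \<Longrightarrow>
    bochner_L1 plane (\<lambda>z. F (fst z + c * snd z, snd z))"
  by (rule bochner_L1_measure_preserving[OF _ measurable_shear distr_shear])

lemma bochner_L1_swap:
  fixes F :: "real \<times> real \<Rightarrow> 'a::banach"
  shows "bochner_L1 plane F \<Longrightarrow> bochner_L1 plane (\<lambda>z. F (snd z, fst z))"
  by (rule bochner_L1_measure_preserving[OF _ _ distr_swap_lborel]) measurable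

lemma section_bound:
  assumes h: "integrable plane h"
    and F: "AE z in plane. norm (F z) \<le> h (z :: real \<times> real)"
    and L1: "AE x in lborel. bochner_L1 lborel (\<lambda>y. F (x, y))"
  shows "AE x in lborel. norm (integral UNIV (\<lambda>y. F (x, y))) \<le> (\<integral>y. h (x, y) \<partial>lborel)"
  using lborel_pair.AE_pair[OF F] L1 lborel_pair.AE_integrable_fst'[OF h]
  by eventually_elim (rule norm_integral_bochner_L1_le)

text \<open>Integrating a majorant over y gives a majorant of the inner integral. Convergence of
  these to 0 in mean suffices for the outer function; the sections need a subsequence along which
  they tend to 0 almost everywhere.\<close>

lemma bochner_L1_sections:
  fixes F :: "real \<times> real \<Rightarrow> 'a::banach"
  assumes "bochner_L1 plane F"
  shows "(AE x in lborel. bochner_L1 lborel (\<lambda>y. F (x, y)))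
    \<and> bochner_L1 lborel (\<lambda>x. integral UNIV (\<lambda>y. F (x, y)))"
  using assms
proof induction
  case (base \<phi> v)
  have 1: "AE x in lborel. bochner_L1 lborel (\<lambda>y. \<phi> (x, y) *\<^sub>R v)"
    using lborel_pair.AE_integrable_fst'[OF base] by eventually_elim (rule bochner_L1.base)
  have "AE x in lborel. (\<integral>y. \<phi> (x, y) \<partial>lborel) *\<^sub>R v = integral UNIV (\<lambda>y. \<phi> (x, y) *\<^sub>R v)"
    using lborel_pair.AE_integrable_fst'[OF base]
    by eventually_elim (metis has_integral_integral_lborel has_integral_scaleR_left integral_unique)
  from bochner_L1_AE_cong[OF bochner_L1.base[OF lborel_pair.integrable_fst'[OF base]] this] 1
  show ?case by simp
next
  case (add f g)
  have 1: "AE x in lborel. bochner_L1 lborel (\<lambda>y. f (x, y) + g (x, y))"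
    using add.IH[THEN conjunct1] by eventually_elim (rule bochner_L1.add)
  have "AE x in lborel. integral UNIV (\<lambda>y. f (x, y)) + integral UNIV (\<lambda>y. g (x, y)) = integral UNIV (\<lambda>y. f (x, y) + g (x, y))"
    using add.IH[THEN conjunct1] by eventually_elim (rule integral_bochner_L1_add[symmetric])
  from bochner_L1_AE_cong[OF bochner_L1.add[OF add.IH[THEN conjunct2]] this] 1
  show ?case by simp
next
  case (lim F)
  define P where "P g \<longleftrightarrow> (AE x in lborel. bochner_L1 lborel (\<lambda>y. g (x, y)))
    \<and> bochner_L1 lborel (\<lambda>x. integral UNIV (\<lambda>y. g (x, y)))" for g :: "real \<times> real \<Rightarrow> 'a"
  have "\<exists>g h. P g \<and> integrable plane h
      \<and> (AE z in plane. norm (F z - g z) \<le> h z) \<and> integral\<^sup>L plane h < e" if "e > 0" for e :: real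
    using lim[OF that] unfolding P_def by blast
  from approx_sequence[where P = P, OF this] obtain g h where
    P: "\<And>n::nat. P (g n)" and h: "\<And>n. integrable plane (h n)"
    and le: "\<And>n. AE z in plane. norm (F z - g n z) \<le> h n z"
    and h0: "\<And>n z. 0 \<le> h n z"
    and hlim: "(\<lambda>n. integral\<^sup>L plane (h n)) \<longlonglongrightarrow> 0" by blast
  define H where "H n x = (\<integral>y. h n (x, y) \<partial>lborel)" for n x
  have H: "integrable lborel (H n)" "integral\<^sup>L lborel (H n) = integral\<^sup>L plane (h n)" for n
    unfolding H_def using lborel_pair.integrable_fst'[OF h] lborel_pair.integral_fst'[OF h] by auto
  have H0: "0 \<le> H n x" for n x unfolding H_def using h0 by simp
  have Hlim: "(\<lambda>n. integral\<^sup>L lborel (H n)) \<longlonglongrightarrow> 0" using hlim by (simp add: H(2))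
  have "\<exists>r. strict_mono r \<and> (AE x in lborel. (\<lambda>n. H (r n) x) \<longlonglongrightarrow> 0)"
    by (rule tendsto_L1_AE_subseq) (use H(1) Hlim H0 in auto)
  then obtain r where r: "AE x in lborel. (\<lambda>n. H (r n) x) \<longlonglongrightarrow> 0" by blast
  have gx: "AE x in lborel. \<forall>n. bochner_L1 lborel (\<lambda>y. g n (x, y))"
    using P unfolding P_def by (simp add: AE_all_countable)
  have hx: "AE x in lborel. \<forall>n. integrable lborel (\<lambda>y. h n (x, y))"
    using lborel_pair.AE_integrable_fst'[OF h] by (simp add: AE_all_countable)
  have lex: "AE x in lborel. \<forall>n. AE y in lborel. norm (F (x, y) - g n (x, y)) \<le> h n (x, y)"
    using lborel_pair.AE_pair[OF le] by (simp add: AE_all_countable)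
  have Fx: "AE x in lborel. bochner_L1 lborel (\<lambda>y. F (x, y))"
    using r gx hx lex
  proof eventually_elim
    case (elim x)
    show ?case
      by (rule bochner_L1_lim_sequence[where g = "\<lambda>n y. g (r n) (x, y)" and h = "\<lambda>n y. h (r n) (x, y)"])
         (use elim in \<open>auto simp: H_def\<close>)
  qed
  have "bochner_L1 lborel (\<lambda>x. integral UNIV (\<lambda>y. F (x, y)))"
  proof (rule bochner_L1_lim_sequence[OF _ H(1) _ Hlim])
    show "bochner_L1 lborel (\<lambda>x. integral UNIV (\<lambda>y. g n (x, y)))" for n
      using P unfolding P_def by blast
    show "AE x in lborel. norm (integral UNIV (\<lambda>y. F (x, y)) - integral UNIV (\<lambda>y. g n (x, y))) \<le> H n x" for n
      using Fx gx hx lex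
    proof eventually_elim
      case (elim x)
      then have "norm (integral UNIV (\<lambda>y. F (x, y) - g n (x, y))) \<le> H n x"
        unfolding H_def by (intro norm_integral_bochner_L1_le bochner_L1_diff) auto
      then show ?case using elim by (subst integral_bochner_L1_diff[symmetric]) auto
    qed
  qed
  with Fx show ?case by blast
qed

lemma iterated_integral_tendsto:
  fixes F :: "real \<times> real \<Rightarrow> 'a::banach"
  assumes F: "bochner_L1 plane F" and g: "\<And>n::nat. bochner_L1 plane (g n)"
    and h: "\<And>n. integrable plane (h n)"
    and le: "\<And>n. AE z in plane. norm (F z - g n z) \<le> h n z"
    and hlim: "(\<lambda>n. integral\<^sup>L plane (h n)) \<longlonglongrightarrow> 0"
  shows "(\<lambda>n. integral UNIV (\<lambda>x. integral UNIV (\<lambda>y. g n (x, y))))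
    \<longlonglongrightarrow> integral UNIV (\<lambda>x. integral UNIV (\<lambda>y. F (x, y)))"
proof (rule integral_bochner_L1_tendsto)
  show "AE x in lborel. norm (integral UNIV (\<lambda>y. F (x, y)) - integral UNIV (\<lambda>y. g n (x, y))) \<le> (\<integral>y. h n (x, y) \<partial>lborel)" for n
  proof -
    have "AE x in lborel. norm (integral UNIV (\<lambda>y. F (x, y) - g n (x, y))) \<le> (\<integral>y. h n (x, y) \<partial>lborel)"
      by (rule section_bound[OF h le bochner_L1_sections[THEN conjunct1]]) (intro bochner_L1_diff F g)
    with bochner_L1_sections[THEN conjunct1, OF F] bochner_L1_sections[THEN conjunct1, OF g[of n]]
    show ?thesis by eventually_elim (simp add: integral_bochner_L1_diff)
  qed
  show "(\<lambda>n. \<integral>x. (\<integral>y. h n (x, y) \<partial>lborel) \<partial>lborel) \<longlonglongrightarrow> 0"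
    using hlim lborel_pair.integral_fst'[OF h] by simp
qed (use bochner_L1_sections[THEN conjunct2] F g lborel_pair.integrable_fst'[OF h] in auto)

text \<open>In the scalar case both orders equal the integral over the plane. The limit case uses
  that an iterated integral is continuous for domination in mean, the second order being handled by
  the swap.\<close>

lemma Fubini_bochner_L1:
  fixes F :: "real \<times> real \<Rightarrow> 'a::banach"
  assumes "bochner_L1 plane F"
  shows "integral UNIV (\<lambda>x. integral UNIV (\<lambda>y. F (x, y))) = integral UNIV (\<lambda>y. integral UNIV (\<lambda>x. F (x, y)))"
  using assms
proof induction
  case (base \<phi> v)
  have iter: "integral UNIV (\<lambda>x. integral UNIV (\<lambda>y. \<psi> (x, y) *\<^sub>R v)) = integral\<^sup>L plane \<psi> *\<^sub>R v"
    if \<psi>: "integrable plane \<psi>" for \<psi> :: "real \<times> real \<Rightarrow> real"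
  proof -
    have "AE x in lborel. integral UNIV (\<lambda>y. \<psi> (x, y) *\<^sub>R v) = (\<integral>y. \<psi> (x, y) \<partial>lborel) *\<^sub>R v"
      using lborel_pair.AE_integrable_fst'[OF \<psi>]
      by eventually_elim (metis has_integral_integral_lborel has_integral_scaleR_left integral_unique)
    then have "integral UNIV (\<lambda>x. integral UNIV (\<lambda>y. \<psi> (x, y) *\<^sub>R v)) = integral UNIV (\<lambda>x. (\<integral>y. \<psi> (x, y) \<partial>lborel) *\<^sub>R v)"
      by (rule integral_UNIV_AE_cong)
    also have "\<dots> = (\<integral>x. (\<integral>y. \<psi> (x, y) \<partial>lborel) \<partial>lborel) *\<^sub>R v"
      using has_integral_integral_lborel[OF lborel_pair.integrable_fst'[OF \<psi>]]
      by (metis has_integral_scaleR_left integral_unique)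
    finally show ?thesis by (simp add: lborel_pair.integral_fst'[OF \<psi>])
  qed
  have swap: "(\<lambda>z. (snd z, fst z)) \<in> measurable plane plane"
    by measurable
  have "integrable plane (\<lambda>z. \<phi> (snd z, fst z))"
    "integral\<^sup>L plane (\<lambda>z. \<phi> (snd z, fst z)) = integral\<^sup>L plane \<phi>"
    using integrable_distr[OF swap, of \<phi>] integral_distr[OF swap, of \<phi>] base
    unfolding distr_swap_lborel by auto
  from iter[OF this(1)] this(2) iter[OF base] show ?case by simp
next
  case (add f g)
  have iter: "integral UNIV (\<lambda>x. integral UNIV (\<lambda>y. u (x, y) + w (x, y)))
      = integral UNIV (\<lambda>x. integral UNIV (\<lambda>y. u (x, y))) + integral UNIV (\<lambda>x. integral UNIV (\<lambda>y. w (x, y)))"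
    if u: "bochner_L1 plane u" and w: "bochner_L1 plane w"
    for u w :: "real \<times> real \<Rightarrow> 'a"
  proof -
    have "AE x in lborel. integral UNIV (\<lambda>y. u (x, y) + w (x, y)) = integral UNIV (\<lambda>y. u (x, y)) + integral UNIV (\<lambda>y. w (x, y))"
      using bochner_L1_sections[THEN conjunct1, OF u] bochner_L1_sections[THEN conjunct1, OF w]
      by eventually_elim (rule integral_bochner_L1_add)
    from integral_UNIV_AE_cong[OF this] show ?thesis
      unfolding integral_bochner_L1_add[OF bochner_L1_sections[THEN conjunct2, OF u] bochner_L1_sections[THEN conjunct2, OF w]] .
  qed
  from add show ?case
    using iter[of f g] iter[OF bochner_L1_swap[OF add.hyps(1)] bochner_L1_swap[OF add.hyps(2)]] by simp
next
  case (lim F)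
  have F: "bochner_L1 plane F" by (rule bochner_L1.lim) (use lim in blast)
  define Q where "Q g \<longleftrightarrow> bochner_L1 plane g \<and> integral UNIV (\<lambda>x. integral UNIV (\<lambda>y. g (x, y)))
    = integral UNIV (\<lambda>y. integral UNIV (\<lambda>x. g (x, y)))" for g :: "real \<times> real \<Rightarrow> 'a"
  have "\<exists>g h. Q g \<and> integrable plane h
      \<and> (AE z in plane. norm (F z - g z) \<le> h z) \<and> integral\<^sup>L plane h < e" if "e > 0" for e :: real
    using lim[OF that] unfolding Q_def by blast
  from approx_sequence[where P = Q, OF this] obtain g h where
    Q: "\<And>n::nat. Q (g n)" and h: "\<And>n. integrable plane (h n)"
    and le: "\<And>n. AE z in plane. norm (F z - g n z) \<le> h n z"
    and hlim: "(\<lambda>n. integral\<^sup>L plane (h n)) \<longlonglongrightarrow> 0" by blast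
  have g: "bochner_L1 plane (g n)" for n using Q unfolding Q_def by blast
  have swap: "(\<lambda>z. (snd z, fst z)) \<in> measurable plane plane" by measurable
  have h': "integrable plane (\<lambda>z. h n (snd z, fst z))"
    "integral\<^sup>L plane (\<lambda>z. h n (snd z, fst z)) = integral\<^sup>L plane (h n)" for n
    using integrable_distr[OF swap, of "h n"] integral_distr[OF swap, of "h n"] h
    unfolding distr_swap_lborel by auto
  have "(\<lambda>n. integral UNIV (\<lambda>x. integral UNIV (\<lambda>y. g n (snd (x, y), fst (x, y)))))
    \<longlonglongrightarrow> integral UNIV (\<lambda>x. integral UNIV (\<lambda>y. F (snd (x, y), fst (x, y))))"
    by (rule iterated_integral_tendsto[OF bochner_L1_swap[OF F] bochner_L1_swap[OF g] h'(1) AE_swap[OF le]])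
       (use hlim h'(2) in simp)
  moreover have "(\<lambda>n. integral UNIV (\<lambda>x. integral UNIV (\<lambda>y. g n (x, y))))
    \<longlonglongrightarrow> integral UNIV (\<lambda>x. integral UNIV (\<lambda>y. F (x, y)))"
    by (rule iterated_integral_tendsto[OF F g h le hlim])
  ultimately show ?case using Q unfolding Q_def by (simp add: LIMSEQ_unique)
qed

subsection \<open>Functions with vanishing integrals\<close>

lemma isCont_initial_integral:
  fixes f :: "real \<Rightarrow> 'a::banach"
  assumes f: "bochner_L1 lborel f"
  shows "isCont (\<lambda>s. integral UNIV (\<lambda>x. indicat_real {..s} x *\<^sub>R f x)) s"
  unfolding isCont_def
proof (subst tendsto_at_iff_sequentially, intro allI impI)
  fix X :: "nat \<Rightarrow> real" assume X: "\<forall>i. X i \<in> UNIV - {s}" "X \<longlonglongrightarrow> s"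
  have "(\<lambda>n. integral UNIV (\<lambda>x. indicat_real {..X n} x *\<^sub>R f x)) \<longlonglongrightarrow> integral UNIV (\<lambda>x. indicat_real {..s} x *\<^sub>R f x)"
  proof (rule integral_bochner_L1_dominated_mult[OF f])
    show "AE x in lborel. (\<lambda>n. indicat_real {..X n} x) \<longlonglongrightarrow> indicat_real {..s} x"
      using AE_lborel_singleton[of s]
    proof eventually_elim
      case (elim x)
      have "\<forall>\<^sub>F n in sequentially. indicat_real {..X n} x = indicat_real {..s} x"
      proof (cases "x < s")
        case True
        from order_tendstoD(1)[OF X(2) this] show ?thesis
          by eventually_elim (use True in \<open>auto simp: indicator_def\<close>)
      next
        case False
        with elim have "s < x" by auto
        from order_tendstoD(2)[OF X(2) this] show ?thesis
          by eventually_elim (use \<open>s < x\<close> in \<open>auto simp: indicator_def\<close>)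
      qed
      then show ?case by (rule tendsto_eventually)
    qed
  qed (auto simp: indicator_def)
  then show "((\<lambda>s. integral UNIV (\<lambda>x. indicat_real {..s} x *\<^sub>R f x)) \<circ> X) \<longlonglongrightarrow> integral UNIV (\<lambda>x. indicat_real {..s} x *\<^sub>R f x)"
    by (simp add: o_def)
qed

text \<open>Half-lines are stable under intersection and generate the Borel sets, so the
  \<pi>-\<lambda> argument applies.\<close>

lemma integral_borel_set_zero:
  fixes f :: "real \<Rightarrow> 'a::banach"
  assumes f: "bochner_L1 lborel f"
    and zero: "\<And>s. integral UNIV (\<lambda>x. indicat_real {..s} x *\<^sub>R f x) = 0"
    and E: "E \<in> sets borel"
  shows "integral UNIV (\<lambda>x. indicat_real E x *\<^sub>R f x) = 0"
proof -
  have borel: "sets borel = sigma_sets UNIV (range (\<lambda>a::real. {..a}))"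
    by (subst borel_eq_atMost) simp
  have "Int_stable (range (\<lambda>a::real. {..a}))"
    by (auto simp: Int_stable_def)
  moreover have "range (\<lambda>a::real. {..a}) \<subseteq> Pow UNIV" by simp
  moreover have "E \<in> sigma_sets UNIV (range (\<lambda>a::real. {..a}))" using E borel by simp
  ultimately show ?thesis
  proof (induction rule: sigma_sets_induct_disjoint)
    case (basic A)
    then show ?case using zero by auto
  next
    case empty
    then show ?case by simp
  next
    case (compl A)
    then have [measurable]: "A \<in> sets borel" using borel by simp
    \<comment> \<open>Complements need the total integral to vanish; it is the limit of the
      integrals over the half-lines up to \<open>n\<close>.\<close>
    have "(\<lambda>n. integral UNIV (\<lambda>x. indicat_real {..real n} x *\<^sub>R f x)) \<longlonglongrightarrow> integral UNIV (\<lambda>x. 1 *\<^sub>R f x)"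
    proof (rule integral_bochner_L1_dominated_mult[OF f])
      show "AE x in lborel. (\<lambda>n. indicat_real {..real n} x) \<longlonglongrightarrow> 1"
      proof (intro AE_I2 tendsto_eventually)
        fix x :: real
        obtain N :: nat where "x \<le> real N" using real_arch_simple by blast
        then show "\<forall>\<^sub>F n in sequentially. indicat_real {..real n} x = 1"
          by (intro eventually_sequentiallyI[of N]) (auto simp: indicator_def)
      qed
    qed (auto simp: indicator_def)
    then have all: "integral UNIV f = 0" by (simp add: zero LIMSEQ_const_iff)
    have "bochner_L1 lborel (\<lambda>x. indicat_real A x *\<^sub>R f x)"
      by (rule bochner_L1_bounded_mult[OF f, where C = 1]) (auto simp: indicator_def)
    from integral_bochner_L1_diff[OF f this]
    have "integral UNIV (\<lambda>x. f x - indicat_real A x *\<^sub>R f x) = 0" using all compl by simp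
    moreover have "f x - indicat_real A x *\<^sub>R f x = indicat_real (UNIV - A) x *\<^sub>R f x" for x
      by (auto simp: indicator_def)
    ultimately show ?case by simp
  next
    case (union A)
    then have [measurable]: "\<And>i. A i \<in> sets borel" using borel by auto
    have L1: "bochner_L1 lborel (\<lambda>x. indicat_real B x *\<^sub>R f x)" if [measurable]: "B \<in> sets borel" for B
      by (rule bochner_L1_bounded_mult[OF f, where C = 1]) (auto simp: indicator_def)
    have fin: "integral UNIV (\<lambda>x. indicat_real (\<Union>i<n. A i) x *\<^sub>R f x) = 0" for n
    proof (induction n)
      case (Suc n)
      have "indicat_real (\<Union>i<Suc n. A i) x = indicat_real (\<Union>i<n. A i) x + indicat_real (A n) x" for x
      proof -
        have "x \<notin> A i \<or> x \<notin> A n" if "i < n" for i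
          using disjoint_family_onD[OF union(1), of i n] that by auto
        then show ?thesis by (auto simp: indicator_def lessThan_Suc)
      qed
      then have "integral UNIV (\<lambda>x. indicat_real (\<Union>i<Suc n. A i) x *\<^sub>R f x)
          = integral UNIV (\<lambda>x. indicat_real (\<Union>i<n. A i) x *\<^sub>R f x + indicat_real (A n) x *\<^sub>R f x)"
        by (simp add: scaleR_add_left)
      also have "\<dots> = 0" using Suc union(3)[of n]
        by (subst integral_bochner_L1_add) (auto intro!: L1)
      finally show ?case .
    qed simp
    have "(\<lambda>n. integral UNIV (\<lambda>x. indicat_real (\<Union>i<n. A i) x *\<^sub>R f x)) \<longlonglongrightarrow> integral UNIV (\<lambda>x. indicat_real (\<Union>i. A i) x *\<^sub>R f x)"
    proof (rule integral_bochner_L1_dominated_mult[OF f])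
      show "AE x in lborel. (\<lambda>n. indicat_real (\<Union>i<n. A i) x) \<longlonglongrightarrow> indicat_real (\<Union>i. A i) x"
      proof (intro AE_I2 tendsto_eventually)
        fix x :: real
        show "\<forall>\<^sub>F n in sequentially. indicat_real (\<Union>i<n. A i) x = indicat_real (\<Union>i. A i) x"
        proof (cases "x \<in> (\<Union>i. A i)")
          case True
          then obtain i where "x \<in> A i" by blast
          then show ?thesis
            by (intro eventually_sequentiallyI[of "Suc i"]) (auto simp: indicator_def)
        qed auto
      qed
    qed (auto simp: indicator_def)
    then show ?case by (simp add: fin LIMSEQ_const_iff)
  qed
qed

text \<open>The test sets are the level sets of a simple approximant g with error h. On E = {g = v}
  the integral of f vanishes, so the measure of E times the norm of v is at most the integral of h
  over E. Summing over v, the integral of the norm of g is at most that of h, and the norm of f has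
  the majorant |g| + h of arbitrarily small integral.\<close>

lemma AE_zero_if_initial_integrals_zero:
  fixes f :: "real \<Rightarrow> 'a::banach"
  assumes f: "bochner_L1 lborel f"
    and zero: "\<And>s. integral UNIV (\<lambda>x. indicat_real {..s} x *\<^sub>R f x) = 0"
  shows "AE x in lborel. f x = 0"
proof (rule AE_zero_if_dominated)
  fix e :: real assume "e > 0"
  then have e2: "e / 2 > 0" by simp
  obtain g h where g: "simple_function lborel g" and h: "integrable lborel h"
    and le: "AE x in lborel. norm (f x - g x) \<le> h x" and small: "integral\<^sup>L lborel h < e / 2"
    using bochner_L1_simple_approx[OF f e2] by blast
  obtain w where w: "integrable lborel w" "AE x in lborel. norm (f x) \<le> w x"
    using bochner_L1_bound[OF f] by blast
  have fin: "finite (range g)" using simple_functionD(1)[OF g] by simp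
  have E[measurable]: "g -` {v} \<in> sets borel" for v using simple_functionD(2)[OF g, of "{v}"] by simp
  have [measurable]: "(\<lambda>x. norm (g x)) \<in> borel_measurable lborel"
    by (rule borel_measurable_simple_function[OF simple_function_compose1[OF g]])
  have "AE x in lborel. norm (g x) \<le> w x + h x"
    using w(2) le
  proof eventually_elim
    case (elim x)
    then show ?case using norm_triangle_ineq2[of "g x" "f x"] norm_minus_commute[of "f x" "g x"] by linarith
  qed
  then have "AE x in lborel. norm (norm (g x)) \<le> norm (w x + h x)"
    by eventually_elim auto
  then have ng: "integrable lborel (\<lambda>x. norm (g x))"
    by (rule Bochner_Integration.integrable_bound[OF Bochner_Integration.integrable_add[OF w(1) h], rotated]) simp
  have sum1: "(\<Sum>v\<in>range g. indicat_real (g -` {v}) x * c v) = c (g x)" for x and c :: "'a \<Rightarrow> real"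
  proof -
    have "(\<Sum>v\<in>range g. indicat_real (g -` {v}) x * c v) = (\<Sum>v\<in>range g. if v = g x then c v else 0)"
      by (intro sum.cong) (auto simp: indicator_def)
    then show ?thesis using fin by simp
  qed
  have nv: "integrable lborel (\<lambda>x. indicat_real (g -` {v}) x * norm v)" for v
    by (rule Bochner_Integration.integrable_bound[OF ng]) (auto split: split_indicator)
  have hE: "integrable lborel (\<lambda>x. indicat_real (g -` {v}) x * h x)" for v
    by (rule Bochner_Integration.integrable_bound[OF h]) (use h in \<open>auto split: split_indicator\<close>)
  have piece: "(\<integral>x. indicat_real (g -` {v}) x * norm v \<partial>lborel) \<le> (\<integral>x. indicat_real (g -` {v}) x * h x \<partial>lborel)" for v
  proof (cases "v = 0")
    case True
    have "AE x in lborel. 0 \<le> h x" using le by eventually_elim (metis norm_ge_zero order_trans)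
    then have "0 \<le> (\<integral>x. indicat_real (g -` {v}) x * h x \<partial>lborel)"
      by (intro integral_nonneg_AE) (auto elim!: eventually_mono simp: indicator_def)
    with True show ?thesis by simp
  next
    case False
    \<comment> \<open>Finite measure of the level set comes from the integrability of
      \<open>norm g\<close> and is available only for \<open>v \<noteq> 0\<close>.\<close>
    have ind: "integrable lborel (indicat_real (g -` {v}))"
      using nv[of v] False by (simp add: integrable_mult_left_iff)
    define m where "m = (\<integral>x. indicat_real (g -` {v}) x \<partial>lborel)"
    have m0: "m \<ge> 0" unfolding m_def by (intro Bochner_Integration.integral_nonneg) simp
    have 1: "integral UNIV (\<lambda>x. indicat_real (g -` {v}) x *\<^sub>R v) = m *\<^sub>R v"
      unfolding m_def using has_integral_integral_lborel[OF ind]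
      by (metis has_integral_scaleR_left integral_unique)
    have L1v: "bochner_L1 lborel (\<lambda>x. indicat_real (g -` {v}) x *\<^sub>R v)"
      by (rule bochner_L1.base[OF ind])
    have L1f: "bochner_L1 lborel (\<lambda>x. indicat_real (g -` {v}) x *\<^sub>R f x)"
      by (rule bochner_L1_bounded_mult[OF f, where C = 1]) (auto split: split_indicator)
    have "integral UNIV (\<lambda>x. indicat_real (g -` {v}) x *\<^sub>R f x - indicat_real (g -` {v}) x *\<^sub>R v) = - (m *\<^sub>R v)"
      using integral_borel_set_zero[OF f zero E] 1 by (subst integral_bochner_L1_diff[OF L1f L1v]) simp
    moreover have "norm (integral UNIV (\<lambda>x. indicat_real (g -` {v}) x *\<^sub>R f x - indicat_real (g -` {v}) x *\<^sub>R v))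
        \<le> (\<integral>x. indicat_real (g -` {v}) x * h x \<partial>lborel)"
      by (rule norm_integral_bochner_L1_le[OF bochner_L1_diff[OF L1f L1v] hE])
         (use le in \<open>eventually_elim, auto simp: indicator_def\<close>)
    ultimately have "m * norm v \<le> (\<integral>x. indicat_real (g -` {v}) x * h x \<partial>lborel)"
      using m0 by simp
    then show ?thesis unfolding m_def by (simp add: ind)
  qed
  have "(\<integral>x. norm (g x) \<partial>lborel) = (\<integral>x. (\<Sum>v\<in>range g. indicat_real (g -` {v}) x * norm v) \<partial>lborel)"
    by (simp add: sum1)
  also have "\<dots> = (\<Sum>v\<in>range g. \<integral>x. indicat_real (g -` {v}) x * norm v \<partial>lborel)"
    by (rule Bochner_Integration.integral_sum) (rule nv)
  also have "\<dots> \<le> (\<Sum>v\<in>range g. \<integral>x. indicat_real (g -` {v}) x * h x \<partial>lborel)"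
    by (rule sum_mono) (rule piece)
  also have "\<dots> = (\<integral>x. (\<Sum>v\<in>range g. indicat_real (g -` {v}) x * h x) \<partial>lborel)"
    by (rule Bochner_Integration.integral_sum[symmetric]) (rule hE)
  also have "\<dots> = integral\<^sup>L lborel h"
    by (rule Bochner_Integration.integral_cong[OF refl]) (rule sum1)
  finally have "(\<integral>x. norm (g x) + h x \<partial>lborel) < e"
    using small unfolding Bochner_Integration.integral_add[OF ng h] by linarith
  moreover have "AE x in lborel. norm (f x) \<le> norm (g x) + h x"
    using le
  proof eventually_elim
    case (elim x)
    then show ?case using norm_triangle_sub[of "f x" "g x"] by linarith
  qed
  ultimately show "\<exists>h. integrable lborel h \<and> (AE x in lborel. norm (f x) \<le> h x) \<and> integral\<^sup>L lborel h < e"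
    using Bochner_Integration.integrable_add[OF ng h] by blast
qed

subsection \<open>The uniform boundedness principle\<close>

text \<open>A direct construction of nested balls: on each ball some member of the family exceeds a
  bound that grows with the index, so the family is unbounded at the common point.\<close>

lemma uniform_boundedness:
  fixes T :: "'i \<Rightarrow> 'a::banach \<Rightarrow> 'b::real_normed_vector"
  assumes lin: "\<And>i. i \<in> I \<Longrightarrow> bounded_linear (T i)"
    and pw: "\<And>x. \<exists>B. \<forall>i\<in>I. norm (T i x) \<le> B"
  obtains C where "C > 0" "\<And>i x. i \<in> I \<Longrightarrow> norm (T i x) \<le> C * norm x"
proof -
  have "\<exists>C. \<forall>i\<in>I. \<forall>x. norm (T i x) \<le> C * norm x"
  proof (rule ccontr)
    assume unb: "\<not> (\<exists>C. \<forall>i\<in>I. \<forall>x. norm (T i x) \<le> C * norm x)"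
    \<comment> \<open>Large values occur near any x: as 2 T u = T(x + u) - T(x - u), the value at x
      + u or at x - u is at least as large in norm as the one at u.\<close>
    have step: "\<exists>y i. i \<in> I \<and> norm (y - x) \<le> r \<and> norm (T i y) > K * r" if "r > 0" for x K r
    proof -
      from unb obtain i z where i: "i \<in> I" and z: "norm (T i z) > \<bar>K\<bar> * norm z" by (meson not_le)
      interpret bounded_linear "T i" by (rule lin[OF i])
      have "z \<noteq> 0" using z by (auto simp: zero)
      define u where "u = (r / norm z) *\<^sub>R z"
      have u: "norm u = r" using \<open>z \<noteq> 0\<close> \<open>r > 0\<close> by (simp add: u_def)
      have "K * r \<le> (r / norm z) * (\<bar>K\<bar> * norm z)"
        using \<open>z \<noteq> 0\<close> \<open>r > 0\<close> by (simp add: abs_ge_self)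
      also have "\<dots> < (r / norm z) * norm (T i z)"
        using z \<open>r > 0\<close> \<open>z \<noteq> 0\<close> by (intro mult_strict_left_mono) auto
      also have "\<dots> = norm (T i u)" using \<open>r > 0\<close> by (simp add: u_def scaleR)
      finally have Tu: "norm (T i u) > K * r" .
      have "2 *\<^sub>R T i u = T i (x + u) - T i (x - u)" by (simp add: add diff scaleR_2)
      then have "2 * norm (T i u) \<le> norm (T i (x + u)) + norm (T i (x - u))"
        using norm_triangle_ineq4[of "T i (x + u)" "T i (x - u)"] norm_scaleR[of 2 "T i u"] by simp
      with Tu have "norm (T i (x + u)) > K * r \<or> norm (T i (x - u)) > K * r" by linarith
      then show ?thesis
      proof
        assume "norm (T i (x + u)) > K * r"
        then show ?thesis using u i by (intro exI[of _ "x + u"] exI[of _ i]) simp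
      next
        assume "norm (T i (x - u)) > K * r"
        then show ?thesis using u i by (intro exI[of _ "x - u"] exI[of _ i]) simp
      qed
    qed
    \<comment> \<open>A pair is a centre with a radius; radii of at most 1/(n+1) shrink the nested
      balls to one point.\<close>
    define P where "P n p \<longleftrightarrow> 0 < snd p \<and> snd p \<le> inverse (real (Suc n))" for n and p :: "'a \<times> real"
    define Q where "Q n p q \<longleftrightarrow> cball (fst q) (snd q) \<subseteq> cball (fst p) (snd p)
      \<and> (\<exists>i\<in>I. \<forall>z\<in>cball (fst q) (snd q). real n < norm (T i z))" for n and p q :: "'a \<times> real"
    have "\<exists>p. \<forall>n. P n (p n) \<and> Q n (p n) (p (Suc n))"
    proof (rule dependent_nat_choice)
      show "\<exists>p. P 0 p" by (rule exI[of _ "(0, 1)"]) (simp add: P_def)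
      fix p n assume "P n p"
      then have r: "snd p / 2 > 0" by (simp add: P_def)
      obtain y i where yi: "i \<in> I" "norm (y - fst p) \<le> snd p / 2" "norm (T i y) > (real n / (snd p / 2)) * (snd p / 2)"
        using step[OF r] by blast
      then have "norm (T i y) - real n > 0" using r by simp
      moreover have "isCont (\<lambda>z. norm (T i z)) y"
        using linear_continuous_at[OF lin[OF yi(1)]] by (rule continuous_norm)
      ultimately obtain d where d: "d > 0"
        "\<And>z. dist z y < d \<Longrightarrow> dist (norm (T i z)) (norm (T i y)) < norm (T i y) - real n"
        unfolding continuous_at_eps_delta by blast
      \<comment> \<open>d / 2 keeps the closed ball inside the open ball of radius d. Half the old
        radius keeps it inside the old ball, as the centre has moved by at most the other
        half.\<close>
      define s where "s = Min {d / 2, snd p / 2, inverse (real (Suc (Suc n)))}"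
      have s: "s > 0" "s \<le> d / 2" "s \<le> snd p / 2" "s \<le> inverse (real (Suc (Suc n)))"
        using d(1) r by (auto simp: s_def)
      have "cball y s \<subseteq> cball (fst p) (snd p)"
      proof
        fix z assume "z \<in> cball y s"
        then show "z \<in> cball (fst p) (snd p)"
          using yi(2) s(3) dist_triangle[of "fst p" z y] by (simp add: dist_norm norm_minus_commute)
      qed
      moreover have "real n < norm (T i z)" if "z \<in> cball y s" for z
      proof -
        have "dist z y < d" using that s(2) d(1) by (simp add: dist_commute)
        from d(2)[OF this] show ?thesis unfolding dist_real_def by linarith
      qed
      ultimately have "P (Suc n) (y, s) \<and> Q n p (y, s)"
        using s yi(1) unfolding P_def Q_def fst_conv snd_conv by blast
      then show "\<exists>q. P (Suc n) q \<and> Q n p q" ..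
    qed
    then obtain p where p: "\<And>n. P n (p n)" "\<And>n. Q n (p n) (p (Suc n))" by blast
    have nest: "cball (fst (p n)) (snd (p n)) \<subseteq> cball (fst (p m)) (snd (p m))" if "m \<le> n" for m n
    proof (rule lift_Suc_antimono_le[where f = "\<lambda>n. cball (fst (p n)) (snd (p n))", OF _ that])
      show "cball (fst (p (Suc n))) (snd (p (Suc n))) \<subseteq> cball (fst (p n)) (snd (p n))" for n
        using p(2)[of n] unfolding Q_def by blast
    qed
    have pos: "\<not> snd (p n) < 0" "0 < snd (p n)" for n using p(1)[of n] by (auto simp: P_def)
    define D where "D n = cball (fst (p n)) (snd (p n))" for n
    have closed: "closed (D n)" and ne: "D n \<noteq> {}" for n
      using pos(1)[of n] by (simp_all add: D_def)
    have mono: "D n \<subseteq> D m" if "m \<le> n" for m n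
      unfolding D_def by (rule nest[OF that])
    have small: "\<exists>n. \<forall>x\<in>D n. \<forall>y\<in>D n. dist x y < e" if "e > 0" for e
    proof -
      from that have "0 < e / 2" by simp
      from reals_Archimedean[OF this] obtain n where n: "inverse (real (Suc n)) < e / 2" by blast
      have "snd (p n) < e / 2" using p(1)[of n] n unfolding P_def by linarith
      then have "dist x y < e" if "x \<in> D n" "y \<in> D n" for x y
        using that dist_triangle3[of x y "fst (p n)"] unfolding D_def mem_cball by linarith
      then show ?thesis by blast
    qed
    obtain a where "\<Inter> (range D) = {a}"
      using decreasing_closed_nest_sing[of D, OF closed ne mono small] by blast
    then have a: "a \<in> cball (fst (p n)) (snd (p n))" for n unfolding D_def by blast
    obtain B where B: "\<And>i. i \<in> I \<Longrightarrow> norm (T i a) \<le> B" using pw[of a] by blast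
    obtain n :: nat where n: "B \<le> real n" using real_arch_simple by blast
    obtain i where i: "i \<in> I" "real n < norm (T i a)"
      using p(2)[of n] a[of "Suc n"] unfolding Q_def by blast
    from B[OF i(1)] n i(2) show False by linarith
  qed
  then obtain C where C: "\<And>i x. i \<in> I \<Longrightarrow> norm (T i x) \<le> C * norm x" by blast
  show thesis
  proof (rule that[of "\<bar>C\<bar> + 1"])
    show "norm (T i x) \<le> (\<bar>C\<bar> + 1) * norm x" if "i \<in> I" for i x
    proof -
      have "C * norm x \<le> (\<bar>C\<bar> + 1) * norm x" by (rule mult_right_mono) auto
      with C[OF that, of x] show ?thesis by linarith
    qed
  qed simp
qed

subsection \<open>Continuous functions and convolutions\<close>

lemma bochner_L1_sum:
  assumes "finite I" "\<And>i. i \<in> I \<Longrightarrow> bochner_L1 M (f i)"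
  shows "bochner_L1 M (\<lambda>x. \<Sum>i\<in>I. f i x)"
  using assms by (induction I) (simp_all add: bochner_L1_zero bochner_L1.add)

text \<open>Uniform continuity puts \<open>f\<close> within \<open>e'\<close> of a step function on
  a mesh finer than \<open>d\<close>. The interval is half-open so that the mesh index
  \<open>q t\<close> always stays below \<open>N\<close>.\<close>

lemma bochner_L1_continuous_interval:
  fixes f :: "real \<Rightarrow> 'a::banach"
  assumes cont: "continuous_on {a..b} f" and "a < b"
  shows "bochner_L1 lborel (\<lambda>t. indicat_real {a..<b} t *\<^sub>R f t)"
proof (rule bochner_L1.lim)
  fix e :: real assume "e > 0"
  define e' where "e' = e / (2 * (b - a))"
  have e': "e' > 0" "e' * (b - a) < e" using \<open>e > 0\<close> \<open>a < b\<close> by (auto simp: e'_def field_simps)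
  from compact_uniformly_continuous[OF cont compact_Icc] e'(1)
  obtain d where d: "d > 0" "\<And>x y. x \<in> {a..b} \<Longrightarrow> y \<in> {a..b} \<Longrightarrow> dist y x < d \<Longrightarrow> dist (f y) (f x) < e'"
    unfolding uniformly_continuous_on_def by metis
  obtain N :: nat where N: "(b - a) / d < real N" using reals_Archimedean2 by blast
  have "0 < (b - a) / d" using d(1) \<open>a < b\<close> by simp
  with N have N0: "real N > 0" by linarith
  define h where "h = (b - a) / real N"
  have h: "h > 0" "h < d" "h * real N = b - a"
    using N N0 d(1) \<open>a < b\<close> by (auto simp: h_def field_simps)
  define q where "q t = nat \<lfloor>(t - a) / h\<rfloor>" for t
  have q: "q t < N" "a + h * real (q t) \<le> t" "t < a + h * real (q t) + h" if "t \<in> {a..<b}" for t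
  proof -
    have nn: "0 \<le> (t - a) / h" using that h(1) by auto
    have "(t - a) / h < real N" using that h by (auto simp: divide_less_eq mult.commute)
    moreover have 1: "real (q t) \<le> (t - a) / h" "(t - a) / h < real (q t) + 1"
      unfolding q_def using nn by (simp_all add: of_nat_nat) 
    ultimately show "q t < N" by linarith
    show "a + h * real (q t) \<le> t" "t < a + h * real (q t) + h"
      using 1 h(1) by (simp_all add: field_simps)
  qed
  define g where "g t = (\<Sum>j<N. (indicat_real {a..<b} t * (if q t = j then 1 else 0)) *\<^sub>R f (a + h * real j))" for t
  have [measurable]: "q \<in> measurable borel (count_space UNIV)"
    unfolding q_def by measurable
  have int1: "integrable lborel (indicat_real {a..<b})"
    using \<open>a < b\<close> by (intro integrable_real_indicator) auto
  have L1g: "bochner_L1 lborel g"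
    unfolding g_def
  proof (intro bochner_L1_sum bochner_L1.base finite_lessThan)
    fix j
    show "integrable lborel (\<lambda>x. indicat_real {a..<b} x * (if q x = j then 1 else 0))"
      by (rule Bochner_Integration.integrable_bound[OF int1]) (auto split: split_indicator)
  qed
  have le: "norm (indicat_real {a..<b} t *\<^sub>R f t - g t) \<le> e' * indicat_real {a..<b} t" for t
  proof (cases "t \<in> {a..<b}")
    case True
    have "g t = (\<Sum>j<N. if q t = j then f (a + h * real j) else 0)"
      unfolding g_def using True by (intro sum.cong) auto
    also have "\<dots> = f (a + h * real (q t))" using q(1)[OF True] by simp
    finally have g: "g t = f (a + h * real (q t))" .
    have "a \<le> a + h * real (q t)" using h(1) by simp
    then have "dist (f t) (f (a + h * real (q t))) < e'"
      using True q(2,3)[OF True] h(2) by (intro d(2)) (auto simp: dist_real_def)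
    with True g show ?thesis by (simp add: dist_norm)
  next
    case False
    then have "g t = 0" unfolding g_def by (intro sum.neutral) simp
    with False show ?thesis by simp
  qed
  have "integrable lborel (\<lambda>t. e' * indicat_real {a..<b} t)" using int1 by simp
  moreover have "integral\<^sup>L lborel (\<lambda>t. e' * indicat_real {a..<b} t) < e"
    using \<open>a < b\<close> e'(2) by simp
  ultimately show "\<exists>g h. bochner_L1 lborel g \<and> integrable lborel h
      \<and> (AE t in lborel. norm (indicat_real {a..<b} t *\<^sub>R f t - g t) \<le> h t) \<and> integral\<^sup>L lborel h < e"
    using L1g le by blast
qed

text \<open>Covers orbits that are singular at 0: a part near 0 is removed, and the error is at most
  the integral of |w| there.\<close>

lemma bochner_L1_continuous_dominated:
  fixes f :: "real \<Rightarrow> 'a::banach"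
  assumes cont: "continuous_on {0<..} f" and w: "integrable lborel w" and "T > 0"
    and le: "\<And>t. 0 < t \<Longrightarrow> t < T \<Longrightarrow> norm (f t) \<le> w t"
  shows "bochner_L1 lborel (\<lambda>t. indicat_real {0<..<T} t *\<^sub>R f t)"
proof (rule bochner_L1_lim_sequence)
  note [measurable] = borel_measurable_integrable[OF w]
  \<comment> \<open>Adding 2 keeps the lower end strictly below T for every n.\<close>
  let ?a = "\<lambda>n. T / (real n + 2)"
  have a: "0 < ?a n" "?a n < T" for n using \<open>T > 0\<close> by (auto simp: divide_less_eq)
  let ?h = "\<lambda>n t. indicat_real {0<..<?a n} t * \<bar>w t\<bar>"
  show "bochner_L1 lborel (\<lambda>t. indicat_real {?a n..<T} t *\<^sub>R f t)" for n
    by (rule bochner_L1_continuous_interval[OF continuous_on_subset[OF cont] a(2)])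
       (use a(1)[of n] in auto)
  show "integrable lborel (?h n)" for n
    by (rule Bochner_Integration.integrable_bound[OF w]) (auto split: split_indicator)
  show "AE t in lborel. norm (indicat_real {0<..<T} t *\<^sub>R f t - indicat_real {?a n..<T} t *\<^sub>R f t) \<le> ?h n t" for n
  proof (intro AE_I2)
    fix t
    show "norm (indicat_real {0<..<T} t *\<^sub>R f t - indicat_real {?a n..<T} t *\<^sub>R f t) \<le> ?h n t"
      using le[of t] a[of n] by (auto simp: indicator_def)
  qed
  have "(\<lambda>n. integral\<^sup>L lborel (?h n)) \<longlonglongrightarrow> integral\<^sup>L lborel (\<lambda>t::real. 0)"
  proof (rule Bochner_Integration.integral_dominated_convergence[where w = "\<lambda>t. \<bar>w t\<bar>"])
    have lim: "?a \<longlonglongrightarrow> 0"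
      by (rule real_tendsto_divide_at_top[OF tendsto_const])
         (rule filterlim_tendsto_add_at_top[THEN filterlim_cong[THEN iffD1, OF refl refl, rotated], OF tendsto_const filterlim_real_sequentially],
          simp add: add.commute)
    show "AE t in lborel. (\<lambda>n. ?h n t) \<longlonglongrightarrow> 0"
    proof (intro AE_I2)
      fix t :: real
      show "(\<lambda>n. ?h n t) \<longlonglongrightarrow> 0"
      proof (cases "t > 0")
        case True
        from order_tendstoD(2)[OF lim this] have "\<forall>\<^sub>F n in sequentially. ?h n t = 0"
          by eventually_elim auto
        then show ?thesis by (rule tendsto_eventually)
      qed simp
    qed
  qed (use w in \<open>auto split: split_indicator\<close>)
  then show "(\<lambda>n. integral\<^sup>L lborel (?h n)) \<longlonglongrightarrow> 0" by simp
qed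

lemma distr_reflect: "distr lborel borel (\<lambda>x. t - x) = (lborel :: real measure)"
  using distr_lborel_affine[of "-1" t] by simp

lemma AE_reflect:
  assumes "AE x in lborel. Q (x::real)"
  shows "AE x in lborel. Q (t - x)"
proof -
  have "(\<lambda>x. t - x) \<in> measurable lborel (borel :: real measure)" by simp
  from AE_distrD[OF this, of Q] assms show ?thesis unfolding distr_reflect by simp
qed

lemma integrable_reflect:
  fixes f :: "real \<Rightarrow> real"
  shows "integrable lborel f \<Longrightarrow> integrable lborel (\<lambda>x. f (t - x))"
  using lborel_integrable_real_affine[of f "-1" t] by simp

lemma bochner_L1_reflect:
  fixes f :: "real \<Rightarrow> 'a::banach"
  assumes "bochner_L1 lborel f"
  shows "bochner_L1 lborel (\<lambda>x. f (t - x))"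
proof (rule bochner_L1_measure_preserving[OF assms])
  show "distr lborel lborel (\<lambda>x. t - x) = lborel"
    using distr_reflect[of t] by (simp cong: distr_cong)
qed simp

lemma integral_reflect_bochner_L1:
  fixes f :: "real \<Rightarrow> 'a::banach"
  assumes "bochner_L1 lborel f"
  shows "integral UNIV (\<lambda>x. f (t - x)) = integral UNIV f"
  by (rule integral_bochner_L1_measure_preserving[OF assms _ distr_reflect]) simp

text \<open>The modulus of continuity of \<open>g\<close> is multiplied by the integral of
  |\<alpha>|. Because of the bounded support of \<open>\<alpha>\<close>, only the values of
  \<open>g (t - r)\<close> for r in a compact interval matter for integrability.\<close>

lemma
  fixes g :: "real \<Rightarrow> 'a::banach"
  assumes \<alpha>: "integrable lborel \<alpha>" and supp: "\<And>r. r \<notin> {0..<T} \<Longrightarrow> \<alpha> r = 0" and "T > 0"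
    and g: "uniformly_continuous_on UNIV g" and bd: "\<And>s. norm (g s) \<le> C"
  shows bochner_L1_convolution_continuous: "bochner_L1 lborel (\<lambda>r. \<alpha> r *\<^sub>R g (t - r))"
    and isCont_convolution: "isCont (\<lambda>t. integral UNIV (\<lambda>r. \<alpha> r *\<^sub>R g (t - r))) t"
proof -
  note [measurable] = borel_measurable_integrable[OF \<alpha>]
  have gc: "continuous_on UNIV g" by (rule uniformly_continuous_imp_continuous[OF g])
  have L1: "bochner_L1 lborel (\<lambda>r. \<alpha> r *\<^sub>R g (t - r))" for t
  proof -
    have "continuous_on {0..T} (\<lambda>r. g (t - r))"
      by (rule continuous_on_compose2[OF gc]) (auto intro!: continuous_intros)
    from bochner_L1_continuous_interval[OF this \<open>T > 0\<close>]
    have "bochner_L1 lborel (\<lambda>r. indicat_real {0..<T} r *\<^sub>R g (t - r))" .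
    then have "bochner_L1 lborel (\<lambda>r. \<alpha> r *\<^sub>R indicat_real {0..<T} r *\<^sub>R g (t - r))"
    proof (rule bochner_L1_mult[where w = "\<lambda>r. \<bar>\<alpha> r\<bar> * C"])
      have "C \<ge> 0" using bd[of 0] norm_ge_zero order_trans by blast
      then show "AE r in lborel. \<bar>\<alpha> r\<bar> * norm (indicat_real {0..<T} r *\<^sub>R g (t - r)) \<le> \<bar>\<alpha> r\<bar> * C"
        by (intro AE_I2 mult_left_mono) (auto simp: bd split: split_indicator)
    qed (use \<alpha> in auto)
    moreover have "\<alpha> r *\<^sub>R indicat_real {0..<T} r *\<^sub>R g (t - r) = \<alpha> r *\<^sub>R g (t - r)" for r
      using supp[of r] by (auto simp: indicator_def)
    ultimately show ?thesis by (simp only:)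
  qed
  then show "bochner_L1 lborel (\<lambda>r. \<alpha> r *\<^sub>R g (t - r))" .
  define A where "A = (\<integral>r. \<bar>\<alpha> r\<bar> \<partial>lborel)"
  have A: "A \<ge> 0" unfolding A_def by simp
  show "isCont (\<lambda>t. integral UNIV (\<lambda>r. \<alpha> r *\<^sub>R g (t - r))) t"
    unfolding continuous_at_eps_delta
  proof (intro allI impI)
    fix e :: real assume "e > 0"
    \<comment> \<open>1 is added because the integral A of |\<alpha>| may vanish.\<close>
    then have "e / (A + 1) > 0" using A by simp
    with g obtain d where d: "d > 0" "\<And>x y. dist y x < d \<Longrightarrow> dist (g y) (g x) < e / (A + 1)"
      unfolding uniformly_continuous_on_def by (meson UNIV_I)
    have "dist (integral UNIV (\<lambda>r. \<alpha> r *\<^sub>R g (t' - r))) (integral UNIV (\<lambda>r. \<alpha> r *\<^sub>R g (t - r))) < e"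
      if "dist t' t < d" for t'
    proof -
      have "norm (integral UNIV (\<lambda>r. \<alpha> r *\<^sub>R g (t' - r) - \<alpha> r *\<^sub>R g (t - r))) \<le> (\<integral>r. \<bar>\<alpha> r\<bar> * (e / (A + 1)) \<partial>lborel)"
      proof (rule norm_integral_bochner_L1_le[OF bochner_L1_diff[OF L1 L1]])
        show "AE r in lborel. norm (\<alpha> r *\<^sub>R g (t' - r) - \<alpha> r *\<^sub>R g (t - r)) \<le> \<bar>\<alpha> r\<bar> * (e / (A + 1))"
        proof (intro AE_I2)
          fix r
          have "norm (g (t' - r) - g (t - r)) \<le> e / (A + 1)"
            using d(2)[of "t' - r" "t - r"] that by (simp add: dist_norm)
          then show "norm (\<alpha> r *\<^sub>R g (t' - r) - \<alpha> r *\<^sub>R g (t - r)) \<le> \<bar>\<alpha> r\<bar> * (e / (A + 1))"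
            unfolding scaleR_diff_right[symmetric] norm_scaleR by (rule mult_left_mono) simp
        qed
      qed (use \<alpha> in simp)
      also have "\<dots> = A * (e / (A + 1))" by (simp add: A_def)
      also have "\<dots> < e" using A \<open>e > 0\<close> by (simp add: field_simps)
      finally show ?thesis by (simp add: dist_norm integral_bochner_L1_diff[OF L1 L1])
    qed
    with d(1) show "\<exists>d>0. \<forall>t'. dist t' t < d \<longrightarrow>
        dist (integral UNIV (\<lambda>r. \<alpha> r *\<^sub>R g (t' - r))) (integral UNIV (\<lambda>r. \<alpha> r *\<^sub>R g (t - r))) < e" by blast
  qed
qed

subsection \<open>Convolutions of truncated families\<close>

lemma AE_interval_witness:
  fixes u v :: real
  assumes "AE s in lborel. u < s \<and> s < v \<longrightarrow> P s" "u < v"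
  shows "\<exists>s. u < s \<and> s < v \<and> P s"
proof (rule ccontr)
  assume "\<not> ?thesis"
  with assms(1) have "AE s in lborel. s \<notin> {u<..<v}" by (auto elim!: eventually_mono)
  then have "{u<..<v} \<in> null_sets lborel" by (subst AE_iff_null_sets) auto
  then show False using \<open>u < v\<close> by (auto simp: null_sets_def)
qed

text \<open>A nonzero value at s would persist in a neighbourhood, whose intersection with (u, v)
  has positive length even if s is an endpoint.\<close>

lemma zero_on_interval_if_AE:
  fixes \<Phi> :: "real \<Rightarrow> 'a::real_normed_vector"
  assumes AE: "AE s in lborel. u < s \<and> s < v \<longrightarrow> \<Phi> s = 0" and cont: "isCont \<Phi> s"
    and s: "u \<le> s" "s \<le> v" and "u < v"
  shows "\<Phi> s = 0"
proof (rule ccontr)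
  assume "\<Phi> s \<noteq> 0"
  with cont obtain d where d: "d > 0" "\<And>y. dist y s < d \<Longrightarrow> dist (\<Phi> y) (\<Phi> s) < norm (\<Phi> s)"
    unfolding continuous_at_eps_delta by (metis zero_less_norm_iff)
  have "AE y in lborel. max u (s - d) < y \<and> y < min v (s + d) \<longrightarrow> \<Phi> y = 0"
    using AE by eventually_elim auto
  from AE_interval_witness[OF this] obtain y where y: "max u (s - d) < y" "y < min v (s + d)" "\<Phi> y = 0"
    using s d(1) \<open>u < v\<close> by auto
  then have "dist y s < d" by (auto simp: dist_real_def)
  from d(2)[OF this] y(3) show False by (simp add: dist_norm)
qed

text \<open>Statements on sections pass to the plane only for measurable zero sets. That of
  \<open>W\<close> is not known to be measurable, so a Borel function equal to \<open>norm W\<close>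
  almost everywhere takes the place of \<open>W\<close>. The map from (\<tau>, \<rho>) to (\<rho>,
  \<tau> - \<rho>) is a shear combined with the swap.\<close>

lemma bochner_L1_zero_antidiagonal_iff:
  fixes W :: "real \<times> real \<Rightarrow> 'a::banach"
  assumes W: "bochner_L1 plane W"
  shows "(AE \<tau> in lborel. AE \<rho> in lborel. W (\<rho>, \<tau> - \<rho>) = 0) \<longleftrightarrow> (AE z in plane. W z = 0)"
    and "(AE q in lborel. AE p in lborel. W (p, q) = 0) \<longleftrightarrow> (AE z in plane. W z = 0)"
proof -
  obtain n where n[measurable]: "n \<in> borel_measurable plane"
    and eq: "AE z in plane. norm (W z) = n z"
    using bochner_L1_norm_measurable[OF W] by blast
  have eq0: "AE z in plane. W z = 0 \<longleftrightarrow> n z = 0"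
    using eq by eventually_elim (metis norm_eq_zero)
  have anti: "AE z in plane. Q (snd z, fst z - snd z)"
    if "AE z in plane. Q z" for Q :: "real \<times> real \<Rightarrow> bool"
    using AE_shear[OF AE_swap[OF that], of "-1"] by simp
  have anti': "AE z in plane. Q z"
    if "AE z in plane. Q (snd z, fst z - snd z)" for Q :: "real \<times> real \<Rightarrow> bool"
    using AE_swap[OF AE_shear[OF that, of 1]] by simp
  show "(AE \<tau> in lborel. AE \<rho> in lborel. W (\<rho>, \<tau> - \<rho>) = 0) \<longleftrightarrow> (AE z in plane. W z = 0)"
  proof
    assume "AE \<tau> in lborel. AE \<rho> in lborel. W (\<rho>, \<tau> - \<rho>) = 0"
    moreover have "AE \<tau> in lborel. AE \<rho> in lborel. W (\<rho>, \<tau> - \<rho>) = 0 \<longleftrightarrow> n (\<rho>, \<tau> - \<rho>) = 0"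
      using lborel_pair.AE_pair[OF anti[OF eq0]] by simp
    ultimately have "AE \<tau> in lborel. AE \<rho> in lborel. n (snd (\<tau>, \<rho>), fst (\<tau>, \<rho>) - snd (\<tau>, \<rho>)) = 0"
      by eventually_elim (auto elim: eventually_elim2)
    then have "AE z in plane. n (snd z, fst z - snd z) = 0"
      by (rule lborel_pair.AE_pair_measure[rotated]) measurable
    from anti'[OF this] eq0 show "AE z in plane. W z = 0"
      by eventually_elim auto
  next
    assume "AE z in plane. W z = 0"
    from lborel_pair.AE_pair[OF anti[OF this]]
    show "AE \<tau> in lborel. AE \<rho> in lborel. W (\<rho>, \<tau> - \<rho>) = 0" by simp
  qed
  show "(AE q in lborel. AE p in lborel. W (p, q) = 0) \<longleftrightarrow> (AE z in plane. W z = 0)"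
  proof
    assume "AE q in lborel. AE p in lborel. W (p, q) = 0"
    moreover have "AE q in lborel. AE p in lborel. W (p, q) = 0 \<longleftrightarrow> n (p, q) = 0"
      using lborel_pair.AE_pair[OF AE_swap[OF eq0]] by simp
    ultimately have "AE q in lborel. AE p in lborel. n (snd (q, p), fst (q, p)) = 0"
      by eventually_elim (auto elim: eventually_elim2)
    then have "AE z in plane. n (snd z, fst z) = 0"
      by (rule lborel_pair.AE_pair_measure[rotated]) measurable
    from AE_swap[OF this] eq0 show "AE z in plane. W z = 0"
      by eventually_elim auto
  next
    assume "AE z in plane. W z = 0"
    from lborel_pair.AE_pair[OF AE_swap[OF this]]
    show "AE q in lborel. AE p in lborel. W (p, q) = 0" by simp
  qed
qed

text \<open>Models \<open>a\<close>, \<open>k\<close>, \<open>S\<close> restricted to (0, T) and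
  extended by 0, so that convolutions become integrals over the whole line. Since
  \<open>\<kappa>\<close> bounds the operator norms up to the factor \<open>M\<close>, integrability
  of operator products reduces to that of scalar products.\<close>

locale truncated_family =
  fixes \<alpha> \<kappa> :: "real \<Rightarrow> real" and \<sigma> :: "real \<Rightarrow> 'a::banach \<Rightarrow> 'a" and M :: real
  assumes \<alpha>: "integrable lborel \<alpha>" "\<And>t. 0 \<le> \<alpha> t" "\<And>t. t \<le> 0 \<Longrightarrow> \<alpha> t = 0"
    and \<kappa>: "integrable lborel \<kappa>" "\<And>t. 0 \<le> \<kappa> t" "\<And>t. t \<le> 0 \<Longrightarrow> \<kappa> t = 0"
    and \<sigma>: "\<And>t. bounded_linear (\<sigma> t)" "\<And>x. bochner_L1 lborel (\<lambda>t. \<sigma> t x)"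
    and \<sigma>_bound: "\<And>t x. norm (\<sigma> t x) \<le> M * \<kappa> t * norm x" and M: "0 \<le> M"
    and \<sigma>_commute: "\<And>s t x. \<sigma> s (\<sigma> t x) = \<sigma> t (\<sigma> s x)"
begin

lemmas \<sigma>_simps = linear_simps[OF \<sigma>(1)]

lemma \<sigma>_zero: "\<kappa> t = 0 \<Longrightarrow> \<sigma> t x = 0"
  using \<sigma>_bound[of t x] by simp

lemma borel_measurable_\<alpha>\<kappa> [measurable]: "\<alpha> \<in> borel_measurable borel" "\<kappa> \<in> borel_measurable borel"
  using \<alpha>(1) \<kappa>(1) by auto

definition \<beta> :: "real \<Rightarrow> 'a \<Rightarrow> 'a" where
  "\<beta> q x = integral UNIV (\<lambda>s. \<alpha> (q - s) *\<^sub>R \<sigma> s x)"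

definition c :: "real \<Rightarrow> real" where
  "c q = (\<integral>s. \<alpha> (q - s) * \<kappa> s \<partial>lborel)"

text \<open>The left-hand side of the functional equation. The indicators cut off from above only,
  because \<open>\<sigma>\<close> vanishes for nonpositive arguments.\<close>

abbreviation double_integral :: "real \<Rightarrow> real \<Rightarrow> 'a \<Rightarrow> 'a" where
  "double_integral t s x \<equiv> integral UNIV (\<lambda>r1. integral UNIV (\<lambda>r2. (indicat_real {..t} r1 * indicat_real {..s} r2) *\<^sub>R
           \<alpha> (t + s - r1 - r2) *\<^sub>R \<sigma> r1 (\<sigma> r2 x)))"

text \<open>The points where \<open>\<alpha> * \<kappa>\<close> converges absolutely; elsewhere
  \<open>c\<close> has the default value 0 and carries no information.\<close>

definition good :: "real set" where
  "good = {q. integrable lborel (\<lambda>s. \<alpha> (q - s) * \<kappa> s)}"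

text \<open>The points where the triple convolution \<open>\<alpha> * \<kappa> * \<kappa>\<close>
  converges absolutely. The condition depends only on \<tau> = t + s, so one exceptional null set
  serves all splittings of \<tau>.\<close>

definition good_pairs :: "real set" where
  "good_pairs = {\<tau>. integrable plane (\<lambda>z. \<alpha> (\<tau> - fst z - snd z) * (\<kappa> (fst z) * \<kappa> (snd z)))}"

lemma c_nonneg: "0 \<le> c q"
  unfolding c_def using \<alpha>(2) \<kappa>(2) by simp

lemma integrable_convolution_pair:
  "integrable plane (\<lambda>z. \<alpha> (fst z - snd z) * \<kappa> (snd z))"
proof -
  have "integrable plane (\<lambda>z. \<alpha> (fst z) * \<kappa> (snd z))"
    by (rule integrable_tensor(1)[OF \<alpha>(1) \<kappa>(1)])
  then show ?thesis
    using integrable_distr[OF measurable_shear[of "-1"], of "\<lambda>z. \<alpha> (fst z) * \<kappa> (snd z)"]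
    unfolding distr_shear by simp
qed

lemma AE_good: "AE q in lborel. q \<in> good"
  using lborel_pair.AE_integrable_fst'[OF integrable_convolution_pair] by (simp add: good_def)

lemma integrable_c: "integrable lborel c"
  using lborel_pair.integrable_fst'[OF integrable_convolution_pair] unfolding c_def by simp

lemma norm_integrand_le: "\<bar>\<alpha> r\<bar> * norm (\<sigma> s x) \<le> \<alpha> r * \<kappa> s * (M * norm x)"
proof -
  have "\<alpha> r * norm (\<sigma> s x) \<le> \<alpha> r * (M * \<kappa> s * norm x)"
    by (rule mult_left_mono[OF \<sigma>_bound \<alpha>(2)])
  also have "\<dots> = \<alpha> r * \<kappa> s * (M * norm x)" by (simp only: mult_ac)
  finally show ?thesis using \<alpha>(2)[of r] by simp
qed

lemma bochner_L1_\<beta>_integrand: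
  assumes "q \<in> good"
  shows "bochner_L1 lborel (\<lambda>s. \<alpha> (q - s) *\<^sub>R \<sigma> s x)"
proof (rule bochner_L1_mult[OF \<sigma>(2), where w = "\<lambda>s. (\<alpha> (q - s) * \<kappa> s) * (M * norm x)"])
  show "AE s in lborel. \<bar>\<alpha> (q - s)\<bar> * norm (\<sigma> s x) \<le> \<alpha> (q - s) * \<kappa> s * (M * norm x)"
    by (intro AE_I2 norm_integrand_le)
qed (use assms in \<open>auto simp: good_def\<close>)

lemma norm_\<beta>_le:
  assumes "q \<in> good"
  shows "norm (\<beta> q x) \<le> M * c q * norm x"
proof -
  have "norm (\<beta> q x) \<le> (\<integral>s. (\<alpha> (q - s) * \<kappa> s) * (M * norm x) \<partial>lborel)"
    unfolding \<beta>_def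
  proof (rule norm_integral_bochner_L1_le[OF bochner_L1_\<beta>_integrand[OF assms]])
    show "AE s in lborel. norm (\<alpha> (q - s) *\<^sub>R \<sigma> s x) \<le> \<alpha> (q - s) * \<kappa> s * (M * norm x)"
      unfolding norm_scaleR by (intro AE_I2 norm_integrand_le)
  qed (use assms in \<open>auto simp: good_def\<close>)
  then show ?thesis by (simp add: c_def mult_ac)
qed

lemma \<beta>_nonpos: "q \<le> 0 \<Longrightarrow> \<beta> q x = 0"
proof -
  assume "q \<le> 0"
  then have "\<alpha> (q - s) *\<^sub>R \<sigma> s x = 0" for s
    using \<alpha>(3)[of "q - s"] \<sigma>_zero[OF \<kappa>(3), of s x] by (cases "s \<le> 0") auto
  then show ?thesis unfolding \<beta>_def by (simp only: integral_0)
qed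

lemma bochner_L1_\<beta>: "bochner_L1 lborel (\<lambda>q. \<beta> q x)"
proof -
  have "bochner_L1 plane (\<lambda>z. \<alpha> (fst z) *\<^sub>R \<sigma> (snd z) x)"
    using bochner_L1_swap[OF bochner_L1_tensor[OF \<sigma>(2)[of x] \<alpha>(1)]] by simp
  from bochner_L1_sections[THEN conjunct2, OF bochner_L1_shear[OF this, of "-1"]]
  show ?thesis unfolding \<beta>_def by simp
qed

text \<open>Tonelli's theorem with inner integral \<kappa>(\<rho>) c(\<tau> - \<rho>). The second
  hypothesis is separate because \<open>c\<close> is 0 where its integral diverges; where
  \<open>\<kappa>\<close> vanishes, so does the whole section.\<close>

lemma good_pairsI:
  assumes int: "integrable lborel (\<lambda>\<rho>. \<kappa> \<rho> * c (\<tau> - \<rho>))"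
    and good: "AE \<rho> in lborel. \<kappa> \<rho> \<noteq> 0 \<longrightarrow> \<tau> - \<rho> \<in> good"
  shows "\<tau> \<in> good_pairs"
  unfolding good_pairs_def mem_Collect_eq
proof (rule lborel_pair.Fubini_integrable)
  have inner: "(\<integral>y. norm (\<alpha> (\<tau> - x - y) * (\<kappa> x * \<kappa> y)) \<partial>lborel) = \<kappa> x * c (\<tau> - x)" for x
  proof -
    have "(\<integral>y. norm (\<alpha> (\<tau> - x - y) * (\<kappa> x * \<kappa> y)) \<partial>lborel) = (\<integral>y. \<kappa> x * (\<alpha> (\<tau> - x - y) * \<kappa> y) \<partial>lborel)"
      using \<alpha>(2) \<kappa>(2) by (intro Bochner_Integration.integral_cong) (auto simp: abs_mult)
    then show ?thesis by (simp add: c_def)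
  qed
  show "integrable lborel (\<lambda>x. \<integral>y. norm (\<alpha> (\<tau> - fst (x, y) - snd (x, y)) * (\<kappa> (fst (x, y)) * \<kappa> (snd (x, y)))) \<partial>lborel)"
    unfolding fst_conv snd_conv inner by (rule int)
  show "AE x in lborel. integrable lborel (\<lambda>y. \<alpha> (\<tau> - fst (x, y) - snd (x, y)) * (\<kappa> (fst (x, y)) * \<kappa> (snd (x, y))))"
    using good
  proof eventually_elim
    case (elim x)
    show ?case
    proof (cases "\<kappa> x = 0")
      case False
      with elim have "integrable lborel (\<lambda>y. \<kappa> x * (\<alpha> (\<tau> - x - y) * \<kappa> y))" by (simp add: good_def)
      then show ?thesis by (simp add: mult_ac)
    qed simp
  qed
qed measurable

lemma AE_reflect_good: "AE \<rho> in lborel. \<tau> - \<rho> \<in> good"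
  by (rule AE_reflect[OF AE_good])

lemma AE_good_pairs: "AE \<tau> in lborel. \<tau> \<in> good_pairs"
proof -
  have "integrable plane (\<lambda>z. c (fst z) * \<kappa> (snd z))"
    by (rule integrable_tensor(1)[OF integrable_c \<kappa>(1)])
  then have "integrable plane (\<lambda>z. c (fst z - snd z) * \<kappa> (snd z))"
    using integrable_distr[OF measurable_shear[of "-1"], of "\<lambda>z. c (fst z) * \<kappa> (snd z)"]
    unfolding distr_shear by simp
  from lborel_pair.AE_integrable_fst'[OF this] show ?thesis
  proof eventually_elim
    case (elim \<tau>)
    then show ?case using AE_reflect_good[of \<tau>]
      by (intro good_pairsI) (auto simp: mult.commute elim: eventually_mono)
  qed
qed

lemma good_pairs_sections:
  assumes "\<tau> \<in> good_pairs"
  shows "AE \<rho> in lborel. \<kappa> \<rho> \<noteq> 0 \<longrightarrow> \<tau> - \<rho> \<in> good"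
    and "integrable lborel (\<lambda>\<rho>. \<kappa> \<rho> * c (\<tau> - \<rho>))"
proof -
  note int = assms[unfolded good_pairs_def mem_Collect_eq]
  show "AE \<rho> in lborel. \<kappa> \<rho> \<noteq> 0 \<longrightarrow> \<tau> - \<rho> \<in> good"
    using lborel_pair.AE_integrable_fst'[OF int]
  proof eventually_elim
    case (elim \<rho>)
    show ?case
    proof
      assume "\<kappa> \<rho> \<noteq> 0"
      moreover have "integrable lborel (\<lambda>y. \<kappa> \<rho> * (\<alpha> (\<tau> - \<rho> - y) * \<kappa> y))"
        using elim by (simp add: mult_ac)
      ultimately show "\<tau> - \<rho> \<in> good" by (simp add: good_def)
    qed
  qed
  have "(\<integral>y. \<alpha> (\<tau> - \<rho> - y) * (\<kappa> \<rho> * \<kappa> y) \<partial>lborel) = \<kappa> \<rho> * c (\<tau> - \<rho>)" for \<rho>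
    unfolding c_def integral_mult_right_zero[symmetric]
    by (intro Bochner_Integration.integral_cong) auto
  with lborel_pair.integrable_fst'[OF int]
  show "integrable lborel (\<lambda>\<rho>. \<kappa> \<rho> * c (\<tau> - \<rho>))" by simp
qed

lemma bochner_L1_double:
  assumes "\<tau> \<in> good_pairs"
  shows "bochner_L1 plane (\<lambda>z. \<alpha> (\<tau> - fst z - snd z) *\<^sub>R \<sigma> (fst z) (\<sigma> (snd z) x))"
proof (rule bochner_L1_mult[where w = "\<lambda>z. (\<alpha> (\<tau> - fst z - snd z) * (\<kappa> (fst z) * \<kappa> (snd z))) * (M * M * norm x)"])
  show "bochner_L1 plane (\<lambda>z. \<sigma> (fst z) (\<sigma> (snd z) x))"
    by (rule bochner_L1_operator_tensor[OF \<sigma>(2,1,2) \<sigma>_bound]) (use \<kappa> M in auto)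
  have "norm (\<sigma> p (\<sigma> q x)) \<le> \<kappa> p * \<kappa> q * (M * M * norm x)" for p q
  proof -
    have "norm (\<sigma> p (\<sigma> q x)) \<le> M * \<kappa> p * norm (\<sigma> q x)" by (rule \<sigma>_bound)
    also have "\<dots> \<le> M * \<kappa> p * (M * \<kappa> q * norm x)"
      by (intro mult_left_mono \<sigma>_bound mult_nonneg_nonneg M \<kappa>(2))
    finally show ?thesis by (simp add: mult_ac)
  qed
  then have "\<alpha> r * norm (\<sigma> p (\<sigma> q x)) \<le> \<alpha> r * (\<kappa> p * \<kappa> q * (M * M * norm x))" for p q r
    by (rule mult_left_mono) (rule \<alpha>(2))
  then show "AE z in plane. \<bar>\<alpha> (\<tau> - fst z - snd z)\<bar> * norm (\<sigma> (fst z) (\<sigma> (snd z) x))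
      \<le> \<alpha> (\<tau> - fst z - snd z) * (\<kappa> (fst z) * \<kappa> (snd z)) * (M * M * norm x)"
    using \<alpha>(2) by (intro AE_I2) (simp add: mult.assoc)
  show "integrable plane (\<lambda>z. (\<alpha> (\<tau> - fst z - snd z) * (\<kappa> (fst z) * \<kappa> (snd z))) * (M * M * norm x))"
    using assms by (simp add: good_pairs_def)
qed measurable

text \<open>\<open>\<sigma> \<rho>\<close> is taken out of the convergent inner integral. For almost
  every \<rho> with \<open>\<tau> - \<rho>\<close> not good, \<open>\<kappa> \<rho>\<close> is 0 and
  both sides vanish.\<close>

lemma AE_inner_integral:
  assumes "\<tau> \<in> good_pairs"
  shows "AE \<rho> in lborel. integral UNIV (\<lambda>r. \<alpha> (\<tau> - \<rho> - r) *\<^sub>R \<sigma> \<rho> (\<sigma> r x)) = \<sigma> \<rho> (\<beta> (\<tau> - \<rho>) x)"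
  using good_pairs_sections(1)[OF assms]
proof eventually_elim
  case (elim \<rho>)
  show ?case
  proof (cases "\<kappa> \<rho> = 0")
    case True
    then show ?thesis by (simp add: \<sigma>_zero)
  next
    case False
    then have "\<tau> - \<rho> \<in> good" using elim by simp
    from integral_bochner_L1_linear[OF bochner_L1_\<beta>_integrand[OF this] \<sigma>(1), of \<rho> x]
    show ?thesis by (simp add: \<beta>_def \<sigma>_simps)
  qed
qed

lemma bochner_L1_\<sigma>\<beta>:
  assumes "\<tau> \<in> good_pairs"
  shows "bochner_L1 lborel (\<lambda>\<rho>. \<sigma> \<rho> (\<beta> (\<tau> - \<rho>) x))"
  using bochner_L1_AE_cong[OF bochner_L1_sections[THEN conjunct2, OF bochner_L1_double[OF assms], of x]]
    AE_inner_integral[OF assms, of x] by simp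

lemma bochner_L1_\<kappa>\<beta>:
  assumes "\<tau> \<in> good_pairs"
  shows "bochner_L1 lborel (\<lambda>\<rho>. \<kappa> \<rho> *\<^sub>R \<beta> (\<tau> - \<rho>) x)"
proof (rule bochner_L1_mult[OF bochner_L1_reflect[OF bochner_L1_\<beta>], where w = "\<lambda>\<rho>. \<kappa> \<rho> * c (\<tau> - \<rho>) * (M * norm x)"])
  show "AE \<rho> in lborel. \<bar>\<kappa> \<rho>\<bar> * norm (\<beta> (\<tau> - \<rho>) x) \<le> \<kappa> \<rho> * c (\<tau> - \<rho>) * (M * norm x)"
    using good_pairs_sections(1)[OF assms]
  proof eventually_elim
    case (elim \<rho>)
    show ?case
    proof (cases "\<kappa> \<rho> = 0")
      case False
      with elim have "norm (\<beta> (\<tau> - \<rho>) x) \<le> M * c (\<tau> - \<rho>) * norm x" by (simp add: norm_\<beta>_le)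
      from mult_left_mono[OF this \<kappa>(2)[of \<rho>]] show ?thesis using \<kappa>(2)[of \<rho>] by (simp add: mult_ac)
    qed simp
  qed
  show "integrable lborel (\<lambda>\<rho>. \<kappa> \<rho> * c (\<tau> - \<rho>) * (M * norm x))"
    using good_pairs_sections(2)[OF assms] by simp
qed measurable

definition W :: "'a \<Rightarrow> real \<times> real \<Rightarrow> 'a" where
  "W x z = \<sigma> (fst z) (\<beta> (snd z) x) - \<sigma> (snd z) (\<beta> (fst z) x)
         - (\<kappa> (fst z) *\<^sub>R \<beta> (snd z) x - \<kappa> (snd z) *\<^sub>R \<beta> (fst z) x)"

lemma bochner_L1_W: "bochner_L1 plane (W x)"
proof -
  have 1: "bochner_L1 plane (\<lambda>z. \<sigma> (fst z) (\<beta> (snd z) x))"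
    by (rule bochner_L1_operator_tensor[OF bochner_L1_\<beta> \<sigma>(1,2) \<sigma>_bound]) (use \<kappa> M in auto)
  have 2: "bochner_L1 plane (\<lambda>z. \<kappa> (snd z) *\<^sub>R \<beta> (fst z) x)"
    by (rule bochner_L1_tensor[OF bochner_L1_\<beta> \<kappa>(1)])
  from bochner_L1_diff[OF bochner_L1_diff[OF 1 bochner_L1_swap[OF 1]] bochner_L1_diff[OF bochner_L1_swap[OF 2] 2]]
  show ?thesis unfolding W_def by simp
qed

text \<open>On the support of the integrand, \<open>{r\<^sub>1 \<le> t, r\<^sub>2 \<le> s}\<close> is the difference of \<open>{r\<^sub>2 \<le> s}\<close>
  and \<open>{r\<^sub>1 > t}\<close>, and on each of these two sets one of the integrations is unrestricted.\<close>

lemma double_integral_eq: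
  assumes \<tau>: "t + s \<in> good_pairs"
  shows "double_integral t s x
    = integral UNIV (\<lambda>\<rho>. indicat_real {..s} \<rho> *\<^sub>R (\<sigma> \<rho> (\<beta> (t + s - \<rho>) x) - \<sigma> (t + s - \<rho>) (\<beta> \<rho> x)))"
proof -
  define \<tau> where "\<tau> = t + s"
  define F where "F z = \<alpha> (\<tau> - fst z - snd z) *\<^sub>R \<sigma> (fst z) (\<sigma> (snd z) x)" for z
  have F: "bochner_L1 plane F"
    using bochner_L1_double[OF \<tau>] unfolding F_def \<tau>_def .
  define F1 where "F1 z = indicat_real {..s} (snd z) *\<^sub>R F z" for z
  define F2 where "F2 z = indicat_real {t<..} (fst z) *\<^sub>R F z" for z
  have F1: "bochner_L1 plane F1" unfolding F1_def
  proof (rule bochner_L1_bounded_mult[OF F])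
    show "(\<lambda>z. indicat_real {..s} (snd z)) \<in> borel_measurable plane" by measurable
    show "\<bar>indicat_real {..s} (snd z)\<bar> \<le> 1" for z :: "real \<times> real" by (simp split: split_indicator)
  qed
  have F2: "bochner_L1 plane F2" unfolding F2_def
  proof (rule bochner_L1_bounded_mult[OF F])
    show "(\<lambda>z. indicat_real {t<..} (fst z)) \<in> borel_measurable plane" by measurable
    show "\<bar>indicat_real {t<..} (fst z)\<bar> \<le> 1" for z :: "real \<times> real" by (simp split: split_indicator)
  qed
  \<comment> \<open>If r1 > t and r2 > s, then r1 + r2 exceeds \<tau> and \<open>\<alpha>\<close>
    vanishes; in the other three cases the indicators agree.\<close>
  have split: "(indicat_real {..t} r1 * indicat_real {..s} r2) *\<^sub>R F (r1, r2) = F1 (r1, r2) - F2 (r1, r2)" for r1 r2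
  proof -
    have "F (r1, r2) = 0" if "r1 > t" "r2 > s"
      using that \<alpha>(3)[of "\<tau> - r1 - r2"] by (simp add: F_def \<tau>_def)
    then show ?thesis unfolding F1_def F2_def by (auto simp: indicator_def)
  qed
  have inner: "AE \<rho> in lborel. integral UNIV (\<lambda>r. F (\<rho>, r)) = \<sigma> \<rho> (\<beta> (\<tau> - \<rho>) x)"
    using AE_inner_integral[OF \<tau>, of x] by (simp add: F_def \<tau>_def)
  \<comment> \<open>Commutativity of the family enters here. After Fubini the inner integration of
    \<open>F1\<close> runs over the first variable; symmetry turns it into one over the second, as
    in \<open>inner\<close>.\<close>
  have sym: "F (r, \<rho>) = F (\<rho>, r)" for r \<rho>
    unfolding F_def using \<sigma>_commute[of r \<rho> x] by (simp add: diff_diff_add add.commute)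
  have L: "bochner_L1 lborel (\<lambda>\<rho>. \<sigma> \<rho> (\<beta> (\<tau> - \<rho>) x))"
    using bochner_L1_\<sigma>\<beta>[OF \<tau>] by (simp add: \<tau>_def)
  have L': "bochner_L1 lborel (\<lambda>\<rho>. \<sigma> (\<tau> - \<rho>) (\<beta> \<rho> x))"
    using bochner_L1_reflect[OF L, of \<tau>] by simp
  have bm: "bochner_L1 lborel (\<lambda>\<rho>. indicat_real B \<rho> *\<^sub>R f \<rho>)"
    if "bochner_L1 lborel f" "B \<in> sets borel" for f :: "real \<Rightarrow> 'a" and B
    using that by (intro bochner_L1_bounded_mult[where C = 1]) (auto split: split_indicator)
  have I1: "integral UNIV (\<lambda>r1. integral UNIV (\<lambda>r2. F1 (r1, r2)))
      = integral UNIV (\<lambda>\<rho>. indicat_real {..s} \<rho> *\<^sub>R \<sigma> \<rho> (\<beta> (\<tau> - \<rho>) x))"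
  proof -
    have "integral UNIV (\<lambda>r1. integral UNIV (\<lambda>r2. F1 (r1, r2))) = integral UNIV (\<lambda>r2. integral UNIV (\<lambda>r1. F1 (r1, r2)))"
      by (rule Fubini_bochner_L1[OF F1])
    also have "\<dots> = integral UNIV (\<lambda>r2. indicat_real {..s} r2 *\<^sub>R integral UNIV (\<lambda>r1. F (r2, r1)))"
      unfolding F1_def snd_conv by (simp add: sym)
    also have "\<dots> = integral UNIV (\<lambda>\<rho>. indicat_real {..s} \<rho> *\<^sub>R \<sigma> \<rho> (\<beta> (\<tau> - \<rho>) x))"
      by (rule integral_UNIV_AE_cong) (use inner in \<open>eventually_elim, simp\<close>)
    finally show ?thesis .
  qed
  have I2: "integral UNIV (\<lambda>r1. integral UNIV (\<lambda>r2. F2 (r1, r2)))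
      = integral UNIV (\<lambda>\<rho>. indicat_real {..s} \<rho> *\<^sub>R \<sigma> (\<tau> - \<rho>) (\<beta> \<rho> x))"
  proof -
    have "integral UNIV (\<lambda>r1. integral UNIV (\<lambda>r2. F2 (r1, r2)))
      = integral UNIV (\<lambda>\<rho>. indicat_real {t<..} \<rho> *\<^sub>R \<sigma> \<rho> (\<beta> (\<tau> - \<rho>) x))"
      unfolding F2_def fst_conv
      by (rule integral_UNIV_AE_cong) (use inner in \<open>eventually_elim, simp\<close>)
    \<comment> \<open>The reflection about \<tau> sends r > t to r < s; the missing endpoint s is a
      null set.\<close>
    also have "\<dots> = integral UNIV (\<lambda>\<rho>. indicat_real {t<..} (\<tau> - \<rho>) *\<^sub>R \<sigma> (\<tau> - \<rho>) (\<beta> (\<tau> - (\<tau> - \<rho>)) x))"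
      by (rule integral_reflect_bochner_L1[symmetric]) (rule bm[OF L], simp)
    also have "\<dots> = integral UNIV (\<lambda>\<rho>. indicat_real {..s} \<rho> *\<^sub>R \<sigma> (\<tau> - \<rho>) (\<beta> \<rho> x))"
      by (rule integral_UNIV_AE_cong)
         (use AE_lborel_singleton[of s] in \<open>eventually_elim, auto simp: indicator_def \<tau>_def\<close>)
    finally show ?thesis .
  qed
  have diff: "AE r1 in lborel. integral UNIV (\<lambda>r2. F1 (r1, r2) - F2 (r1, r2))
      = integral UNIV (\<lambda>r2. F1 (r1, r2)) - integral UNIV (\<lambda>r2. F2 (r1, r2))"
    using bochner_L1_sections[THEN conjunct1, OF F1] bochner_L1_sections[THEN conjunct1, OF F2]
    by eventually_elim (rule integral_bochner_L1_diff)
  have "integral UNIV (\<lambda>r1. integral UNIV (\<lambda>r2. (indicat_real {..t} r1 * indicat_real {..s} r2) *\<^sub>R F (r1, r2)))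
      = integral UNIV (\<lambda>r1. integral UNIV (\<lambda>r2. F1 (r1, r2)) - integral UNIV (\<lambda>r2. F2 (r1, r2)))"
    unfolding split by (rule integral_UNIV_AE_cong[OF diff])
  also have "\<dots> = integral UNIV (\<lambda>r1. integral UNIV (\<lambda>r2. F1 (r1, r2))) - integral UNIV (\<lambda>r1. integral UNIV (\<lambda>r2. F2 (r1, r2)))"
    by (rule integral_bochner_L1_diff[OF bochner_L1_sections[THEN conjunct2, OF F1] bochner_L1_sections[THEN conjunct2, OF F2]])
  also have "\<dots> = integral UNIV (\<lambda>\<rho>. indicat_real {..s} \<rho> *\<^sub>R (\<sigma> \<rho> (\<beta> (\<tau> - \<rho>) x) - \<sigma> (\<tau> - \<rho>) (\<beta> \<rho> x)))"
    unfolding I1 I2 scaleR_diff_right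
    by (rule integral_bochner_L1_diff[symmetric]) (intro bm L L'; simp)+
  finally show ?thesis unfolding F_def \<tau>_def by simp
qed

text \<open>The four terms are integrable along the antidiagonal one by one, the second of each pair
  by reflection of the first, so both sides can be collected into one integral of
  \<open>W\<close>.\<close>

lemma functional_equation_iff:
  assumes \<tau>: "t + s \<in> good_pairs"
  shows "double_integral t s x
      = integral UNIV (\<lambda>\<rho>. indicat_real {..s} \<rho> *\<^sub>R \<kappa> \<rho> *\<^sub>R \<beta> (t + s - \<rho>) x)
        - integral UNIV (\<lambda>\<rho>. indicat_real {..s} \<rho> *\<^sub>R \<kappa> (t + s - \<rho>) *\<^sub>R \<beta> \<rho> x)
    \<longleftrightarrow> integral UNIV (\<lambda>\<rho>. indicat_real {..s} \<rho> *\<^sub>R W x (\<rho>, t + s - \<rho>)) = 0"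
    and bochner_L1_W_antidiagonal: "bochner_L1 lborel (\<lambda>\<rho>. W x (\<rho>, t + s - \<rho>))"
proof -
  let ?\<tau> = "t + s"
  have bm: "bochner_L1 lborel (\<lambda>\<rho>. indicat_real {..s} \<rho> *\<^sub>R f \<rho>)" if "bochner_L1 lborel f" for f :: "real \<Rightarrow> 'a"
    using that by (intro bochner_L1_bounded_mult[where C = 1]) (auto split: split_indicator)
  have 1: "bochner_L1 lborel (\<lambda>\<rho>. \<sigma> \<rho> (\<beta> (?\<tau> - \<rho>) x))" by (rule bochner_L1_\<sigma>\<beta>[OF \<tau>])
  have 2: "bochner_L1 lborel (\<lambda>\<rho>. \<sigma> (?\<tau> - \<rho>) (\<beta> \<rho> x))"
    using bochner_L1_reflect[OF 1, of ?\<tau>] by simp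
  have 3: "bochner_L1 lborel (\<lambda>\<rho>. \<kappa> \<rho> *\<^sub>R \<beta> (?\<tau> - \<rho>) x)" by (rule bochner_L1_\<kappa>\<beta>[OF \<tau>])
  have 4: "bochner_L1 lborel (\<lambda>\<rho>. \<kappa> (?\<tau> - \<rho>) *\<^sub>R \<beta> \<rho> x)"
    using bochner_L1_reflect[OF 3, of ?\<tau>] by simp
  note 12 = bochner_L1_diff[OF 1 2] and 34 = bochner_L1_diff[OF 3 4]
  show "bochner_L1 lborel (\<lambda>\<rho>. W x (\<rho>, ?\<tau> - \<rho>))"
    unfolding W_def fst_conv snd_conv by (rule bochner_L1_diff[OF 12 34])
  have "integral UNIV (\<lambda>\<rho>. indicat_real {..s} \<rho> *\<^sub>R W x (\<rho>, ?\<tau> - \<rho>))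
      = integral UNIV (\<lambda>\<rho>. indicat_real {..s} \<rho> *\<^sub>R (\<sigma> \<rho> (\<beta> (?\<tau> - \<rho>) x) - \<sigma> (?\<tau> - \<rho>) (\<beta> \<rho> x)))
        - integral UNIV (\<lambda>\<rho>. indicat_real {..s} \<rho> *\<^sub>R (\<kappa> \<rho> *\<^sub>R \<beta> (?\<tau> - \<rho>) x - \<kappa> (?\<tau> - \<rho>) *\<^sub>R \<beta> \<rho> x))"
    unfolding W_def fst_conv snd_conv scaleR_diff_right[of _ "_ - _"]
    by (rule integral_bochner_L1_diff[OF bm[OF 12] bm[OF 34]])
  moreover have "integral UNIV (\<lambda>\<rho>. indicat_real {..s} \<rho> *\<^sub>R (\<kappa> \<rho> *\<^sub>R \<beta> (?\<tau> - \<rho>) x - \<kappa> (?\<tau> - \<rho>) *\<^sub>R \<beta> \<rho> x))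
      = integral UNIV (\<lambda>\<rho>. indicat_real {..s} \<rho> *\<^sub>R \<kappa> \<rho> *\<^sub>R \<beta> (?\<tau> - \<rho>) x)
        - integral UNIV (\<lambda>\<rho>. indicat_real {..s} \<rho> *\<^sub>R \<kappa> (?\<tau> - \<rho>) *\<^sub>R \<beta> \<rho> x)"
    unfolding scaleR_diff_right by (rule integral_bochner_L1_diff[OF bm[OF 3] bm[OF 4]])
  ultimately show "double_integral t s x
      = integral UNIV (\<lambda>\<rho>. indicat_real {..s} \<rho> *\<^sub>R \<kappa> \<rho> *\<^sub>R \<beta> (t + s - \<rho>) x)
        - integral UNIV (\<lambda>\<rho>. indicat_real {..s} \<rho> *\<^sub>R \<kappa> (t + s - \<rho>) *\<^sub>R \<beta> \<rho> x)
    \<longleftrightarrow> integral UNIV (\<lambda>\<rho>. indicat_real {..s} \<rho> *\<^sub>R W x (\<rho>, t + s - \<rho>)) = 0"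
    unfolding double_integral_eq[OF \<tau>] by simp
qed

lemma W_antidiagonal_outside: "\<rho> \<le> 0 \<or> \<tau> \<le> \<rho> \<Longrightarrow> W x (\<rho>, \<tau> - \<rho>) = 0"
  unfolding W_def by (auto simp: \<beta>_nonpos \<sigma>_zero \<kappa>(3) \<sigma>_simps)

text \<open>The initial integral is continuous in s, so its vanishing for almost every s in (0,
  \<tau>) extends to the closed interval; outside this interval \<open>W\<close> itself is 0 along
  the antidiagonal.\<close>

lemma W_zero_on_antidiagonal:
  assumes \<tau>: "\<tau> \<in> good_pairs" "0 < \<tau>"
    and AE: "AE s in lborel. 0 < s \<and> s < \<tau> \<longrightarrow> integral UNIV (\<lambda>\<rho>. indicat_real {..s} \<rho> *\<^sub>R W x (\<rho>, \<tau> - \<rho>)) = 0"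
  shows "AE \<rho> in lborel. W x (\<rho>, \<tau> - \<rho>) = 0"
proof (rule AE_zero_if_initial_integrals_zero)
  have L1: "bochner_L1 lborel (\<lambda>\<rho>. W x (\<rho>, \<tau> - \<rho>))"
    using bochner_L1_W_antidiagonal[of \<tau> 0] \<tau>(1) by simp
  then show "bochner_L1 lborel (\<lambda>\<rho>. W x (\<rho>, \<tau> - \<rho>))" .
  fix s
  show "integral UNIV (\<lambda>\<rho>. indicat_real {..s} \<rho> *\<^sub>R W x (\<rho>, \<tau> - \<rho>)) = 0"
  proof (cases "s \<le> 0")
    case True
    then have "indicat_real {..s} \<rho> *\<^sub>R W x (\<rho>, \<tau> - \<rho>) = 0" for \<rho>
      using W_antidiagonal_outside[of \<rho> \<tau> x] by (auto simp: indicator_def)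
    then show ?thesis by (simp only: integral_0)
  next
    case False
    have "integral UNIV (\<lambda>\<rho>. indicat_real {..min s \<tau>} \<rho> *\<^sub>R W x (\<rho>, \<tau> - \<rho>)) = 0"
      by (rule zero_on_interval_if_AE[OF AE isCont_initial_integral[OF L1]]) (use False \<tau>(2) in auto)
    moreover have "indicat_real {..min s \<tau>} \<rho> *\<^sub>R W x (\<rho>, \<tau> - \<rho>) = indicat_real {..s} \<rho> *\<^sub>R W x (\<rho>, \<tau> - \<rho>)" for \<rho>
      using W_antidiagonal_outside[of \<rho> \<tau> x] by (cases "\<rho> \<le> \<tau>") (auto simp: indicator_def)
    ultimately show ?thesis by (simp only:)
  qed
qed

end

section \<open>Continuity of the convolution with a singular orbit\<close>

lemma uniformly_continuous_clamp:
  fixes g :: "real \<Rightarrow> 'a::real_normed_vector"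
  assumes "continuous_on {u..v} g" "u \<le> v"
  shows "uniformly_continuous_on UNIV (\<lambda>s. g (max u (min v s)))"
  unfolding uniformly_continuous_on_def
proof (intro allI impI)
  fix e :: real assume "e > 0"
  from compact_uniformly_continuous[OF assms(1) compact_Icc] this
  obtain d where d: "d > 0" "\<And>x y. x \<in> {u..v} \<Longrightarrow> y \<in> {u..v} \<Longrightarrow> dist y x < d \<Longrightarrow> dist (g y) (g x) < e"
    unfolding uniformly_continuous_on_def by metis
  have "dist (g (max u (min v y))) (g (max u (min v x))) < e" if "dist y x < d" for x y
    by (rule d(2)) (use that \<open>u \<le> v\<close> in \<open>auto simp: dist_real_def\<close>)
  with d(1) show "\<exists>d>0. \<forall>x\<in>UNIV. \<forall>y\<in>UNIV. dist y x < d \<longrightarrow> dist (g (max u (min v y))) (g (max u (min v x))) < e"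
    by blast
qed

lemma bounded_clamp:
  fixes g :: "real \<Rightarrow> 'a::real_normed_vector"
  assumes "continuous_on {u..v} g" "u \<le> v"
  obtains C where "\<And>s. norm (g (max u (min v s))) \<le> C"
proof -
  have "bounded (g ` {u..v})"
    by (intro compact_imp_bounded compact_continuous_image assms compact_Icc)
  then obtain C where C: "\<And>y. y \<in> g ` {u..v} \<Longrightarrow> norm y \<le> C" unfolding bounded_iff by blast
  show thesis by (rule that[of C], rule C) (use \<open>u \<le> v\<close> in auto)
qed

context truncated_family
begin

text \<open>The cut-off \<open>\<theta>\<close> splits the convolution into a part with a uniformly continuous factor and a
  part near the singularity of \<open>\<sigma>\<close> at \<open>0\<close>. The latter is dominated by the corresponding part of
  \<open>c\<close>, which is continuous and small at \<open>t\<^sub>0\<close>.\<close>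

lemma isCont_\<beta>:
  assumes supp: "\<And>r. T \<le> r \<Longrightarrow> \<alpha> r = 0" and t0: "0 < t0" "t0 < b" and "0 < T"
    and \<sigma>cont: "\<And>x. continuous_on {0<..b} (\<lambda>s. \<sigma> s x)" and \<kappa>cont: "continuous_on {0<..b} \<kappa>"
    and good: "\<And>t. 0 < t \<Longrightarrow> t < b \<Longrightarrow> t \<in> good" and c: "isCont c t0"
  shows "isCont (\<lambda>t. \<beta> t x) t0"
proof -
  \<comment> \<open>Piecewise linear: 0 up to \<delta>, 1 from 2\<delta> on.\<close>
  define \<theta> :: "real \<Rightarrow> real \<Rightarrow> real" where "\<theta> \<delta> s = max 0 (min 1 ((s - \<delta>) / \<delta>))" for \<delta> s
  have \<theta>: "0 \<le> \<theta> \<delta> s" "\<theta> \<delta> s \<le> 1" for \<delta> s by (auto simp: \<theta>_def)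
  have \<theta>0: "\<theta> \<delta> s = 0" if "0 < \<delta>" "s \<le> \<delta>" for \<delta> s
    unfolding \<theta>_def using that by (intro max_absorb1 min.coboundedI2) (simp add: divide_le_0_iff)
  have \<theta>1: "\<theta> \<delta> s = 1" if "0 < \<delta>" "2 * \<delta> \<le> s" for \<delta> s
    using that by (auto simp: \<theta>_def field_simps max_def min_def)
  have \<theta>m[measurable]: "\<theta> \<delta> \<in> borel_measurable borel" for \<delta> unfolding \<theta>_def by measurable
  have \<theta>c: "continuous_on A (\<theta> \<delta>)" if "0 < \<delta>" for A \<delta>
    unfolding \<theta>_def using that by (intro continuous_intros) auto
  define m where "m \<delta> t = (\<integral>s. \<alpha> (t - s) * ((1 - \<theta> \<delta> s) * \<kappa> s) \<partial>lborel)" for \<delta> t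
  have m_int: "integrable lborel (\<lambda>s. \<alpha> (t - s) * ((1 - \<theta> \<delta> s) * \<kappa> s))" if "t \<in> good" for t \<delta>
  proof (rule Bochner_Integration.integrable_bound[of _ "\<lambda>s. \<alpha> (t - s) * \<kappa> s"])
    show "integrable lborel (\<lambda>s. \<alpha> (t - s) * \<kappa> s)" using that by (simp add: good_def)
    have "(1 - \<theta> \<delta> s) * \<kappa> s \<le> 1 * \<kappa> s" for s by (rule mult_right_mono) (use \<theta> \<kappa>(2) in auto)
    then have "\<alpha> (t - s) * ((1 - \<theta> \<delta> s) * \<kappa> s) \<le> \<alpha> (t - s) * \<kappa> s" for s
      using \<alpha>(2) by (intro mult_left_mono) auto
    moreover have "0 \<le> \<alpha> (t - s) * ((1 - \<theta> \<delta> s) * \<kappa> s)" for s using \<alpha>(2) \<kappa>(2) \<theta> by simp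
    ultimately show "AE s in lborel. norm (\<alpha> (t - s) * ((1 - \<theta> \<delta> s) * \<kappa> s)) \<le> norm (\<alpha> (t - s) * \<kappa> s)"
      by (intro AE_I2) (smt (verit) real_norm_def)
  qed measurable
  have m_nonneg: "0 \<le> m \<delta> t" for \<delta> t unfolding m_def using \<alpha>(2) \<kappa>(2) \<theta> by simp
  have \<alpha>supp: "r \<notin> {0..<T} \<Longrightarrow> \<alpha> r = 0" for r using supp[of r] \<alpha>(3)[of r] by force
  \<comment> \<open>The codomain is arbitrary because this is applied both to the orbits of
    \<open>\<sigma>\<close> and to \<open>\<kappa>\<close>.\<close>
  have smooth: "\<exists>P. isCont P t0 \<and> (\<forall>t. 0 < t \<and> t < b \<longrightarrow> bochner_L1 lborel (\<lambda>s. (\<alpha> (t - s) * \<theta> \<delta> s) *\<^sub>R f s)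
      \<and> P t = integral UNIV (\<lambda>s. (\<alpha> (t - s) * \<theta> \<delta> s) *\<^sub>R f s))"
    if \<delta>: "0 < \<delta>" "\<delta> \<le> b" and f: "continuous_on {0<..b} f"
    for \<delta> and f :: "real \<Rightarrow> 'b::banach"
  proof -
    define g where "g s = \<theta> \<delta> s *\<^sub>R f s" for s
    \<comment> \<open>Clamping makes the factor uniformly continuous on the line without changing
      the product for t < b: \<open>g\<close> vanishes at \<delta>, and
      \<open>\<alpha> (t - s)\<close> vanishes for s \<ge> t.\<close>
    define G where "G s = g (max \<delta> (min b s))" for s
    have gc: "continuous_on {\<delta>..b} g" unfolding g_def
      by (intro continuous_intros \<theta>c \<delta>(1) continuous_on_subset[OF f]) (use \<delta> in auto)
    have uc: "uniformly_continuous_on UNIV G"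
      unfolding G_def by (rule uniformly_continuous_clamp[OF gc \<delta>(2)])
    obtain C where C: "\<And>s. norm (G s) \<le> C"
      unfolding G_def by (rule bounded_clamp[OF gc \<delta>(2)]) blast
    have L1: "bochner_L1 lborel (\<lambda>r. \<alpha> r *\<^sub>R G (t - r))" for t
      by (rule bochner_L1_convolution_continuous[OF \<alpha>(1) \<alpha>supp \<open>0 < T\<close> uc C])
    have eq: "\<alpha> (t - s) *\<^sub>R G s = (\<alpha> (t - s) * \<theta> \<delta> s) *\<^sub>R f s" if "t < b" for t s
    proof (cases "s \<le> \<delta>")
      case True
      then show ?thesis using \<delta> \<theta>0[of \<delta> s] \<theta>0[of \<delta> \<delta>] by (simp add: G_def g_def)
    next
      case False
      show ?thesis
      proof (cases "s < t")
        case True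
        with False that show ?thesis by (simp add: G_def g_def)
      next
        case False
        then show ?thesis using \<alpha>(3)[of "t - s"] by simp
      qed
    qed
    show ?thesis
    proof (intro exI[of _ "\<lambda>t. integral UNIV (\<lambda>r. \<alpha> r *\<^sub>R G (t - r))"] conjI allI impI)
      show "isCont (\<lambda>t. integral UNIV (\<lambda>r. \<alpha> r *\<^sub>R G (t - r))) t0"
        by (rule isCont_convolution[OF \<alpha>(1) \<alpha>supp \<open>0 < T\<close> uc C])
      fix t assume "0 < t \<and> t < b"
      then have eq': "(\<lambda>s. (\<alpha> (t - s) * \<theta> \<delta> s) *\<^sub>R f s) = (\<lambda>s. \<alpha> (t - s) *\<^sub>R G (t - (t - s)))" by (simp add: eq)
      show "bochner_L1 lborel (\<lambda>s. (\<alpha> (t - s) * \<theta> \<delta> s) *\<^sub>R f s)"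
        unfolding eq' by (rule bochner_L1_reflect[OF L1])
      show "integral UNIV (\<lambda>r. \<alpha> r *\<^sub>R G (t - r)) = integral UNIV (\<lambda>s. (\<alpha> (t - s) * \<theta> \<delta> s) *\<^sub>R f s)"
        unfolding eq' by (rule integral_reflect_bochner_L1[OF L1, symmetric])
    qed
  qed
  \<comment> \<open>Continuity of the singular part is not estimated directly but inherited from
    \<open>c\<close> and its smooth part. It lets smallness at t0 spread to a neighbourhood.\<close>
  have m_cont: "isCont (m \<delta>) t0" if \<delta>: "0 < \<delta>" "\<delta> \<le> b" for \<delta>
  proof -
    from smooth[OF \<delta> \<kappa>cont] obtain P where P: "isCont P t0"
      "\<And>t. 0 < t \<Longrightarrow> t < b \<Longrightarrow> P t = integral UNIV (\<lambda>s. (\<alpha> (t - s) * \<theta> \<delta> s) *\<^sub>R \<kappa> s)" by blast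
    have "m \<delta> t = c t - P t" if "0 < t" "t < b" for t
    proof -
      have 1: "integrable lborel (\<lambda>s. \<alpha> (t - s) * \<kappa> s)" using good[OF that] by (simp add: good_def)
      have 2: "integrable lborel (\<lambda>s. (\<alpha> (t - s) * \<theta> \<delta> s) * \<kappa> s)"
        using Bochner_Integration.integrable_diff[OF 1 m_int[OF good[OF that], of \<delta>]]
        by (simp add: algebra_simps)
      have "P t = (\<integral>s. (\<alpha> (t - s) * \<theta> \<delta> s) * \<kappa> s \<partial>lborel)"
        unfolding P(2)[OF that] using integral_lborel[OF 2] by simp
      then show ?thesis
        unfolding m_def c_def using Bochner_Integration.integral_diff[OF 1 2] by (simp add: algebra_simps)
    qed
    then have "\<forall>\<^sub>F t in nhds t0. c t - P t = m \<delta> t"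
      using t0 by (intro eventually_nhds_in_open[of "{0<..<b}", THEN eventually_mono]) auto
    then show ?thesis
      using continuous_diff[OF c P(1)] by (subst isCont_cong) (auto elim: eventually_mono)
  qed
  have t0g: "t0 \<in> good" by (rule good[OF t0])
  have m_small: "(\<lambda>n. m (b / real (Suc n)) t0) \<longlonglongrightarrow> 0"
  proof -
    have "(\<lambda>n. m (b / real (Suc n)) t0) \<longlonglongrightarrow> (\<integral>s. 0 \<partial>(lborel :: real measure))"
      unfolding m_def
    proof (rule Bochner_Integration.integral_dominated_convergence[where w = "\<lambda>s. \<alpha> (t0 - s) * \<kappa> s"])
      show "integrable lborel (\<lambda>s. \<alpha> (t0 - s) * \<kappa> s)" using t0g by (simp add: good_def)
      show "AE s in lborel. norm (\<alpha> (t0 - s) * ((1 - \<theta> (b / real (Suc n)) s) * \<kappa> s)) \<le> \<alpha> (t0 - s) * \<kappa> s" for n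
      proof (intro AE_I2)
        fix s
        have "(1 - \<theta> (b / real (Suc n)) s) * \<kappa> s \<le> 1 * \<kappa> s" by (rule mult_right_mono) (use \<theta> \<kappa>(2) in auto)
        then have "\<alpha> (t0 - s) * ((1 - \<theta> (b / real (Suc n)) s) * \<kappa> s) \<le> \<alpha> (t0 - s) * \<kappa> s"
          using \<alpha>(2) by (intro mult_left_mono) auto
        moreover have "0 \<le> \<alpha> (t0 - s) * ((1 - \<theta> (b / real (Suc n)) s) * \<kappa> s)" using \<alpha>(2) \<kappa>(2) \<theta> by simp
        ultimately show "norm (\<alpha> (t0 - s) * ((1 - \<theta> (b / real (Suc n)) s) * \<kappa> s)) \<le> \<alpha> (t0 - s) * \<kappa> s"
          unfolding real_norm_def by linarith
      qed
      show "AE s in lborel. (\<lambda>n. \<alpha> (t0 - s) * ((1 - \<theta> (b / real (Suc n)) s) * \<kappa> s)) \<longlonglongrightarrow> 0"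
      proof (intro AE_I2 tendsto_eventually)
        fix s :: real
        show "\<forall>\<^sub>F n in sequentially. \<alpha> (t0 - s) * ((1 - \<theta> (b / real (Suc n)) s) * \<kappa> s) = 0"
        proof (cases "s > 0")
          case True
          have "(\<lambda>n. b / real (Suc n)) \<longlonglongrightarrow> 0" by (rule lim_const_over_n[THEN LIMSEQ_Suc])
          moreover have "0 < s / 2" using True by simp
          ultimately have "\<forall>\<^sub>F n in sequentially. b / real (Suc n) < s / 2" by (rule order_tendstoD(2))
          then show ?thesis
          proof eventually_elim
            case (elim n)
            have "\<theta> (b / real (Suc n)) s = 1" by (rule \<theta>1) (use elim t0 in \<open>auto simp: field_simps\<close>)
            then show ?case by simp
          qed
        qed (simp add: \<kappa>(3))
      qed
    qed measurable
    then show ?thesis by simp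
  qed
  show ?thesis
    unfolding continuous_at_eps_delta
  proof (intro allI impI)
    fix e :: real assume "e > 0"
    define K where "K = M * norm x"
    have K: "K \<ge> 0" using M by (simp add: K_def)
    \<comment> \<open>A quarter of e each for the singular part at t, the singular part at t0 and
      the smooth part; K + 1 because K may be 0.\<close>
    have e4: "e / (4 * (K + 1)) > 0" using \<open>e > 0\<close> K by simp
    have "\<exists>n. m (b / real (Suc n)) t0 < e / (4 * (K + 1))"
      by (rule eventually_happens'[OF trivial_limit_sequentially order_tendstoD(2)[OF m_small e4]])
    then obtain n where n: "m (b / real (Suc n)) t0 < e / (4 * (K + 1))" ..
    define \<delta> where "\<delta> = b / real (Suc n)"
    have \<delta>: "0 < \<delta>" "\<delta> \<le> b" using t0 by (auto simp: \<delta>_def field_simps)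
    have m1: "m \<delta> t0 < e / (4 * (K + 1))" using n by (simp add: \<delta>_def)
    from smooth[OF \<delta> \<sigma>cont[of x]] obtain P where P: "isCont P t0"
      "\<And>t. 0 < t \<Longrightarrow> t < b \<Longrightarrow> bochner_L1 lborel (\<lambda>s. (\<alpha> (t - s) * \<theta> \<delta> s) *\<^sub>R \<sigma> s x)"
      "\<And>t. 0 < t \<Longrightarrow> t < b \<Longrightarrow> P t = integral UNIV (\<lambda>s. (\<alpha> (t - s) * \<theta> \<delta> s) *\<^sub>R \<sigma> s x)" by blast
    have near: "norm (\<beta> t x - P t) \<le> K * m \<delta> t" if t: "0 < t" "t < b" for t
    proof -
      have L: "bochner_L1 lborel (\<lambda>s. \<alpha> (t - s) *\<^sub>R \<sigma> s x)" by (rule bochner_L1_\<beta>_integrand[OF good[OF t]])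
      have "norm (integral UNIV (\<lambda>s. \<alpha> (t - s) *\<^sub>R \<sigma> s x - (\<alpha> (t - s) * \<theta> \<delta> s) *\<^sub>R \<sigma> s x))
          \<le> (\<integral>s. K * (\<alpha> (t - s) * ((1 - \<theta> \<delta> s) * \<kappa> s)) \<partial>lborel)"
      proof (rule norm_integral_bochner_L1_le[OF bochner_L1_diff[OF L P(2)[OF t]]])
        show "integrable lborel (\<lambda>s. K * (\<alpha> (t - s) * ((1 - \<theta> \<delta> s) * \<kappa> s)))"
          using m_int[OF good[OF t], of \<delta>] by simp
        show "AE s in lborel. norm (\<alpha> (t - s) *\<^sub>R \<sigma> s x - (\<alpha> (t - s) * \<theta> \<delta> s) *\<^sub>R \<sigma> s x)
            \<le> K * (\<alpha> (t - s) * ((1 - \<theta> \<delta> s) * \<kappa> s))"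
        proof (intro AE_I2)
          fix s
          have "\<alpha> (t - s) *\<^sub>R \<sigma> s x - (\<alpha> (t - s) * \<theta> \<delta> s) *\<^sub>R \<sigma> s x
              = (1 - \<theta> \<delta> s) *\<^sub>R \<alpha> (t - s) *\<^sub>R \<sigma> s x"
            by (simp add: algebra_simps)
          then have "norm (\<alpha> (t - s) *\<^sub>R \<sigma> s x - (\<alpha> (t - s) * \<theta> \<delta> s) *\<^sub>R \<sigma> s x)
              = norm ((1 - \<theta> \<delta> s) *\<^sub>R \<alpha> (t - s) *\<^sub>R \<sigma> s x)"
            by (simp only:)
          also have "\<dots> = (1 - \<theta> \<delta> s) * (\<bar>\<alpha> (t - s)\<bar> * norm (\<sigma> s x))"
            using \<theta>[of \<delta> s] by (simp add: abs_mult)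
          also have "\<dots> \<le> (1 - \<theta> \<delta> s) * (\<alpha> (t - s) * \<kappa> s * (M * norm x))"
            by (rule mult_left_mono[OF norm_integrand_le]) (use \<theta>[of \<delta> s] in auto)
          also have "\<dots> = K * (\<alpha> (t - s) * ((1 - \<theta> \<delta> s) * \<kappa> s))" by (simp add: K_def mult_ac)
          finally show "norm (\<alpha> (t - s) *\<^sub>R \<sigma> s x - (\<alpha> (t - s) * \<theta> \<delta> s) *\<^sub>R \<sigma> s x)
            \<le> K * (\<alpha> (t - s) * ((1 - \<theta> \<delta> s) * \<kappa> s))" .
        qed
      qed
      then show ?thesis
        unfolding integral_bochner_L1_diff[OF L P(2)[OF t]] P(3)[OF t] \<beta>_def m_def by simp
    qed
    have "\<forall>\<^sub>F t in nhds t0. m \<delta> t < e / (4 * (K + 1))"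
      using m_cont[OF \<delta>] m1 by (simp add: continuous_within order_tendstoD(2) tendsto_nhds_iff)
    moreover have "\<forall>\<^sub>F t in nhds t0. dist (P t) (P t0) < e / 4"
      using tendstoD[OF P(1)[unfolded isCont_def tendsto_at_iff_tendsto_nhds], of "e / 4"] \<open>e > 0\<close> by simp
    moreover have "\<forall>\<^sub>F t in nhds t0. t \<in> {0<..<b}"
      using t0 by (intro eventually_nhds_in_open) auto
    ultimately have "\<forall>\<^sub>F t in nhds t0. dist (\<beta> t x) (\<beta> t0 x) < e"
    proof eventually_elim
      case (elim t)
      have K4: "K * y \<le> e / 4" if "y < e / (4 * (K + 1))" "0 \<le> y" for y
      proof -
        have "K * y \<le> (K + 1) * y" using that by (intro mult_right_mono) auto
        also have "\<dots> \<le> (K + 1) * (e / (4 * (K + 1)))" using that K by (intro mult_left_mono) auto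
        also have "\<dots> = e / 4" using K by (simp add: field_simps)
        finally show ?thesis .
      qed
      have "norm (\<beta> t x - P t) \<le> e / 4"
        using near[of t] K4[OF elim(1) m_nonneg] elim(3) by auto
      moreover have "norm (\<beta> t0 x - P t0) \<le> e / 4"
        using near[OF t0] K4[OF m1 m_nonneg] by auto
      moreover have eq: "\<beta> t x - \<beta> t0 x = (\<beta> t x - P t) - (\<beta> t0 x - P t0) + (P t - P t0)" by simp
      have "norm (\<beta> t x - \<beta> t0 x) \<le> norm (\<beta> t x - P t) + norm (\<beta> t0 x - P t0) + norm (P t - P t0)"
        unfolding eq
        using norm_triangle_ineq[of "(\<beta> t x - P t) - (\<beta> t0 x - P t0)" "P t - P t0"]
          norm_triangle_ineq4[of "\<beta> t x - P t" "\<beta> t0 x - P t0"] by linarith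
      ultimately show ?case using elim(2) \<open>e > 0\<close> unfolding dist_norm by linarith
    qed
    then show "\<exists>d>0. \<forall>x'. dist x' t0 < d \<longrightarrow> dist (\<beta> x' x) (\<beta> t0 x) < e"
      unfolding eventually_nhds_metric .
  qed
qed

end

subsection \<open>Truncation of the given family\<close>

lemma bounded_linear_scaleC: "bounded_linear (\<lambda>x :: 'a::complex_banach. c *\<^sub>C x)"
proof (rule bounded_linear_intro[where K = "cmod c"])
  fix x :: 'a and r :: real
  show "c *\<^sub>C (r *\<^sub>R x) = r *\<^sub>R (c *\<^sub>C x)"
    unfolding scaleC_of_real[symmetric] scaleC_scaleC by (simp add: mult.commute)
qed (auto simp: scaleC_add_right norm_scaleC mult.commute)

lemma integrable_on_UNIV_AE_cong:
  fixes f :: "'n::euclidean_space \<Rightarrow> 'a::banach"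
  assumes "f integrable_on UNIV" "AE x in lborel. f x = g x"
  shows "g integrable_on UNIV"
  by (rule integrable_spike[OF assms(1), of "{x. \<not> f x = g x}"])
     (use assms(2) in \<open>auto simp: AE_lborel_iff_negligible\<close>)

lemma integrable_lborel_iff_integrable_on:
  fixes f :: "real \<Rightarrow> real"
  assumes [measurable]: "f \<in> borel_measurable borel" and "\<And>x. 0 \<le> f x"
  shows "integrable lborel f \<longleftrightarrow> f integrable_on UNIV"
proof
  assume "f integrable_on UNIV"
  then have "f absolutely_integrable_on UNIV"
    using assms(2) by (intro nonnegative_absolutely_integrable_1) auto
  then show "integrable lborel f"
    by (simp add: set_integrable_def integrable_completion)
qed (rule integrable_on_lborel)

lemma integral_norm_bound_AE:
  fixes f :: "real \<Rightarrow> 'a::banach"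
  assumes f: "f integrable_on A" and g: "g integrable_on A"
    and le: "AE s in lborel. s \<in> A \<longrightarrow> norm (f s) \<le> g s"
  shows "norm (integral A f) \<le> integral A g"
proof -
  let ?N = "{s. \<not> (s \<in> A \<longrightarrow> norm (f s) \<le> g s)}"
  have N: "negligible ?N" using le by (simp add: AE_lborel_iff_negligible)
  have "norm (integral A (\<lambda>s. if s \<in> ?N then 0 else f s)) \<le> integral A (\<lambda>s. if s \<in> ?N then 0 else g s)"
    by (rule Henstock_Kurzweil_Integration.integral_norm_bound_integral)
       (auto intro: integrable_spike[OF f N] integrable_spike[OF g N])
  also have "integral A (\<lambda>s. if s \<in> ?N then 0 else f s) = integral A f"
    by (rule integral_spike[OF N]) auto
  also have "integral A (\<lambda>s. if s \<in> ?N then 0 else g s) = integral A g"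
    by (rule integral_spike[OF N]) auto
  finally show ?thesis .
qed

text \<open>The limit at 0 belongs to the setting because it occurs on both sides of each
  equivalence.\<close>

locale commuting_family =
  fixes a k :: "real \<Rightarrow> real" and S :: "real \<Rightarrow> 'a::complex_banach \<Rightarrow> 'a"
  assumes a_int: "locally_integrable a" and a_pos: "AE t in lebesgue. 0 < t \<longrightarrow> 0 < a t"
    and k_int: "locally_integrable k" and k_pos: "\<And>t. 0 < t \<Longrightarrow> 0 < k t"
    and k_cont: "continuous_on {0<..} k"
    and S_cont: "strongly_continuous_family S" and S_comm: "commutative_family S"
    and lim: "\<And>x. ((\<lambda>t. S t x /\<^sub>R k t) \<longlongrightarrow> x) (at_right 0)"
begin

lemma S_lin: "0 < t \<Longrightarrow> bounded_linear (S t)"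
  and S_scaleC: "0 < t \<Longrightarrow> S t (z *\<^sub>C x) = z *\<^sub>C S t x"
  and S_orbit: "continuous_on {0<..} (\<lambda>t. S t x)"
  using S_cont unfolding strongly_continuous_family_def bounded_clinear_def by auto

lemma S_commute: "0 < t \<Longrightarrow> 0 < s \<Longrightarrow> S t (S s x) = S s (S t x)"
  using S_comm unfolding commutative_family_def by blast

lemma a_pos_lborel: "AE t in lborel. 0 < t \<longrightarrow> 0 < a t"
  using a_pos by (simp add: AE_completion_iff)

text \<open>For each x the quotient S(t)x / k(t) is bounded near 0 because it converges, and on the
  rest of (0, T] by continuity and compactness; the uniform boundedness principle removes the
  dependence on x.\<close>

lemma uniform_bound:
  assumes "0 < T"
  obtains M where "0 \<le> M" "\<And>t x. 0 < t \<Longrightarrow> t \<le> T \<Longrightarrow> norm (S t x) \<le> M * k t * norm x"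
proof -
  have pw: "\<exists>B. \<forall>t\<in>{0<..T}. norm (S t x /\<^sub>R k t) \<le> B" for x
  proof -
    have "\<forall>\<^sub>F t in at_right 0. dist (S t x /\<^sub>R k t) x < 1"
      by (rule tendstoD[OF lim]) simp
    then obtain b where b: "b > 0" "\<And>t. 0 < t \<Longrightarrow> t < b \<Longrightarrow> dist (S t x /\<^sub>R k t) x < 1"
      unfolding eventually_at_right_field by auto
    define d where "d = min (b / 2) T"
    have d: "0 < d" "d < b" using b(1) \<open>0 < T\<close> by (auto simp: d_def)
    have sub: "{d..T} \<subseteq> {0<..}" using d(1) by auto
    have kn: "\<forall>t\<in>{d..T}. k t \<noteq> 0"
    proof
      fix t assume "t \<in> {d..T}"
      then have "0 < t" using d(1) by auto
      from k_pos[OF this] show "k t \<noteq> 0" by simp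
    qed
    have "continuous_on {d..T} (\<lambda>t. S t x /\<^sub>R k t)"
      by (intro continuous_intros continuous_on_subset[OF S_orbit] continuous_on_subset[OF k_cont] sub kn)
    then have "bounded ((\<lambda>t. S t x /\<^sub>R k t) ` {d..T})"
      by (intro compact_imp_bounded compact_continuous_image compact_Icc)
    then obtain C where C: "\<And>t. t \<in> {d..T} \<Longrightarrow> norm (S t x /\<^sub>R k t) \<le> C"
      unfolding bounded_iff by blast
    have "norm (S t x /\<^sub>R k t) \<le> max C (norm x + 1)" if "t \<in> {0<..T}" for t
    proof (cases "t < d")
      case True
      then have "dist (S t x /\<^sub>R k t) x < 1" using that d b(2)[of t] by auto
      then have "norm (S t x /\<^sub>R k t) \<le> norm x + 1"
        unfolding dist_norm using norm_triangle_sub[of "S t x /\<^sub>R k t" x] by linarith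
      then show ?thesis by linarith
    next
      case False
      then show ?thesis using that C[of t] by auto
    qed
    then show ?thesis by blast
  qed
  have lin: "bounded_linear (\<lambda>x. S t x /\<^sub>R k t)" if "t \<in> {0<..T}" for t
    using bounded_linear_compose[OF bounded_linear_scaleR_right S_lin[of t]] that by simp
  obtain C where C: "C > 0" "\<And>t x. t \<in> {0<..T} \<Longrightarrow> norm (S t x /\<^sub>R k t) \<le> C * norm x"
    by (rule uniform_boundedness[of "{0<..T}" "\<lambda>t x. S t x /\<^sub>R k t", OF lin pw]) blast+
  show thesis
  proof (rule that[of C])
    show "norm (S t x) \<le> C * k t * norm x" if "0 < t" "t \<le> T" for t x
    proof -
      have "norm (S t x) / k t \<le> C * norm x"
        using C(2)[of t x] that k_pos[of t] by (simp add: divide_inverse mult.commute)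
      then show ?thesis using k_pos[OF that(1)] by (simp add: divide_le_eq mult_ac)
    qed
  qed (use C(1) in simp)
qed

lemma integrable_truncation:
  assumes f: "locally_integrable f" and "0 < T"
  shows "integrable lebesgue (\<lambda>t. indicat_real {0<..<T} t * f t)"
proof -
  have "set_integrable lebesgue {0..T} f" using f \<open>0 < T\<close> unfolding locally_integrable_def by blast
  then have "set_integrable lebesgue {0<..<T} f" by (rule set_integrable_subset) auto
  then show ?thesis by (simp add: set_integrable_def)
qed

end

text \<open>\<open>\<alpha>\<close> agrees with \<open>a\<close> only almost everywhere, since
  \<open>a\<close> is merely Lebesgue measurable and positive almost everywhere. \<open>k\<close>
  and the orbits are continuous and can be cut off literally.\<close>

locale truncated_setting = commuting_family a k S + truncated_family \<alpha> \<kappa> \<sigma> M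
  for a k :: "real \<Rightarrow> real" and S :: "real \<Rightarrow> 'a::complex_banach \<Rightarrow> 'a"
    and \<alpha> \<kappa> :: "real \<Rightarrow> real" and \<sigma> :: "real \<Rightarrow> 'a \<Rightarrow> 'a" and M :: real +
  fixes T :: real
  assumes T: "0 < T"
    and \<kappa>_eq: "\<kappa> t = (if 0 < t \<and> t < T then k t else 0)"
    and \<sigma>_eq: "\<sigma> t x = (if 0 < t \<and> t < T then S t x else 0)"
    and \<alpha>_eq: "AE t in lborel. 0 < t \<and> t < T \<longrightarrow> \<alpha> t = a t"
    and \<alpha>_supp: "T \<le> t \<Longrightarrow> \<alpha> t = 0"

context commuting_family
begin

lemma truncation_exists:
  assumes T: "0 < T"
  shows "\<exists>\<alpha> \<kappa> \<sigma> M. truncated_setting a k S \<alpha> \<kappa> \<sigma> M T"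
proof -
  obtain M where M: "0 \<le> M" "\<And>t x. 0 < t \<Longrightarrow> t \<le> T \<Longrightarrow> norm (S t x) \<le> M * k t * norm x"
    using uniform_bound[OF T] by blast
  have ai: "integrable lebesgue (\<lambda>t. indicat_real {0<..<T} t * a t)"
    by (rule integrable_truncation[OF a_int T])
  \<comment> \<open>A Borel representative, because the product measure \<open>plane\<close> is
    formed over Borel sets.\<close>
  obtain g where g[measurable]: "g \<in> borel_measurable lborel"
    and ag: "AE t in lborel. indicat_real {0<..<T} t * a t = g t"
    using completion_ex_borel_measurable_real[OF borel_measurable_integrable[OF ai]] by blast
  have gi: "integrable lborel g"
  proof -
    have "integrable lebesgue g"
      by (rule integrable_cong_AE_imp[OF ai measurable_completion[OF g] AE_completion[OF ag]])
    then show ?thesis using integrable_completion[OF g] by simp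
  qed
  \<comment> \<open>The maximum makes \<open>\<alpha>\<close> nonnegative everywhere; since
    \<open>a\<close> is positive almost everywhere, it changes \<open>g\<close> only on a null
    subset of (0, T).\<close>
  define \<alpha> where "\<alpha> t = indicat_real {0<..<T} t * max 0 (g t)" for t
  define \<kappa> where "\<kappa> t = (if 0 < t \<and> t < T then k t else 0)" for t
  define \<sigma> where "\<sigma> t x = (if 0 < t \<and> t < T then S t x else 0)" for t x
  have \<kappa>_ind: "\<kappa> = (\<lambda>t. indicat_real {0<..<T} t *\<^sub>R k t)" unfolding \<kappa>_def by (auto simp: indicator_def)
  have [measurable]: "\<kappa> \<in> borel_measurable borel"
    unfolding \<kappa>_ind
    by (rule borel_measurable_continuous_on_indicator) (auto intro: continuous_on_subset[OF k_cont])
  have \<kappa>i: "integrable lborel \<kappa>"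
  proof -
    have "integrable lebesgue \<kappa>"
      unfolding \<kappa>_ind real_scaleR_def by (rule integrable_truncation[OF k_int T])
    then show ?thesis using integrable_completion[of \<kappa> lborel] by simp
  qed
  have \<sigma>_ind: "\<sigma> t x = indicat_real {0<..<T} t *\<^sub>R S t x" for t x
    unfolding \<sigma>_def by (auto simp: indicator_def)
  have "truncated_setting a k S \<alpha> \<kappa> \<sigma> M T"
  proof (intro truncated_setting.intro truncated_family.intro truncated_setting_axioms.intro commuting_family_axioms)
    show "integrable lborel \<alpha>"
      by (rule Bochner_Integration.integrable_bound[OF gi]) (auto simp: \<alpha>_def[abs_def] split: split_indicator)
    show "integrable lborel \<kappa>" by (rule \<kappa>i)
    show "bochner_L1 lborel (\<lambda>t. \<sigma> t x)" for x
      unfolding \<sigma>_ind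
    proof (rule bochner_L1_continuous_dominated[OF S_orbit _ T])
      show "integrable lborel (\<lambda>t. M * \<kappa> t * norm x)" using \<kappa>i by simp
      show "norm (S t x) \<le> M * \<kappa> t * norm x" if "0 < t" "t < T" for t
        using M(2)[of t x] that by (simp add: \<kappa>_def)
    qed
    show "bounded_linear (\<sigma> t)" for t
      unfolding \<sigma>_def using S_lin[of t] by (cases "0 < t \<and> t < T") auto
    show "norm (\<sigma> t x) \<le> M * \<kappa> t * norm x" for t x
      using M(2)[of t x] by (auto simp: \<sigma>_def \<kappa>_def)
    show "\<sigma> s (\<sigma> t x) = \<sigma> t (\<sigma> s x)" for s t x
      using S_commute[of s t x] S_lin[of s] S_lin[of t]
      by (auto simp: \<sigma>_def linear_simps)
    show "AE t in lborel. 0 < t \<and> t < T \<longrightarrow> \<alpha> t = a t"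
      using ag a_pos_lborel by eventually_elim (auto simp: \<alpha>_def indicator_def max_def split: if_splits)
    show "0 \<le> \<kappa> t" for t using k_pos[of t] by (auto simp: \<kappa>_def)
  qed (use T M(1) in \<open>auto simp: \<alpha>_def \<kappa>_def \<sigma>_def\<close>)
  then show ?thesis by blast
qed

end

section \<open>Convolutions as truncated integrals below the cut-off\<close>

context truncated_setting
begin

lemma \<alpha>_reflect: "AE s in lborel. 0 < q - s \<and> q - s < T \<longrightarrow> \<alpha> (q - s) = a (q - s)"
  by (rule AE_reflect[OF \<alpha>_eq])

text \<open>The endpoints 0 and q are left out because \<open>k 0\<close> and \<open>a 0\<close> are
  arbitrary.\<close>

lemma AE_k_integrand:
  assumes "0 < q" "q < T"
  shows "AE s in lborel. (if s \<in> {0..q} then a (q - s) * k s else 0) = \<alpha> (q - s) * \<kappa> s"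
  using \<alpha>_reflect[of q] AE_lborel_singleton[of 0] AE_lborel_singleton[of q]
proof eventually_elim
  case (elim s)
  then show ?case using assms \<alpha>(3)[of "q - s"] by (cases "s < 0"; cases "s > q") (auto simp: \<kappa>_eq)
qed

lemma AE_S_integrand:
  assumes "0 < q" "q < T"
  shows "AE s in lborel. (if s \<in> {0..q} then a (q - s) *\<^sub>R S s x else 0) = \<alpha> (q - s) *\<^sub>R \<sigma> s x"
  using \<alpha>_reflect[of q] AE_lborel_singleton[of 0] AE_lborel_singleton[of q]
proof eventually_elim
  case (elim s)
  then show ?case using assms \<alpha>(3)[of "q - s"] by (cases "s < 0"; cases "s > q") (auto simp: \<sigma>_eq)
qed

lemma AE_eq_commute: "(AE s in M'. f s = g s) \<Longrightarrow> (AE s in M'. g s = f s)"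
  by (auto elim: eventually_mono)

text \<open>The truncated integrand is Borel and nonnegative, so Lebesgue and gauge integrability
  coincide for it; the other integrand differs from it only on a null set.\<close>

lemma good_iff:
  assumes "0 < q" "q < T"
  shows "q \<in> good \<longleftrightarrow> (\<lambda>s. a (q - s) * k s) integrable_on {0..q}"
proof -
  have "q \<in> good \<longleftrightarrow> (\<lambda>s. \<alpha> (q - s) * \<kappa> s) integrable_on UNIV"
    unfolding good_def mem_Collect_eq by (rule integrable_lborel_iff_integrable_on) (use \<alpha>(2) \<kappa>(2) in auto)
  also have "\<dots> \<longleftrightarrow> (\<lambda>s. if s \<in> {0..q} then a (q - s) * k s else 0) integrable_on UNIV"
    using integrable_on_UNIV_AE_cong[OF _ AE_k_integrand[OF assms]]
      integrable_on_UNIV_AE_cong[OF _ AE_eq_commute[OF AE_k_integrand[OF assms]]] by (rule iffI[rotated])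
  finally show ?thesis by (simp only: Henstock_Kurzweil_Integration.integrable_restrict_UNIV)
qed

lemma c_eq:
  assumes "0 < q" "q < T" "q \<in> good"
  shows "c q = conv a k q"
proof -
  have "c q = integral UNIV (\<lambda>s. \<alpha> (q - s) * \<kappa> s)"
    unfolding c_def using assms(3) by (simp add: good_def integral_lborel)
  also have "\<dots> = integral UNIV (\<lambda>s. if s \<in> {0..q} then a (q - s) * k s else 0)"
    by (rule integral_UNIV_AE_cong[OF AE_eq_commute[OF AE_k_integrand[OF assms(1,2)]]])
  finally show ?thesis
    unfolding conv_def real_scaleR_def by (simp only: Henstock_Kurzweil_Integration.integral_restrict_UNIV)
qed

text \<open>Holds at every q, good or not: gauge integrals of functions equal almost everywhere
  agree, default value included.\<close>

lemma \<beta>_eq: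
  assumes "0 < q" "q < T"
  shows "\<beta> q x = conv a (\<lambda>s. S s x) q"
proof -
  have "\<beta> q x = integral UNIV (\<lambda>s. if s \<in> {0..q} then a (q - s) *\<^sub>R S s x else 0)"
    unfolding \<beta>_def by (rule integral_UNIV_AE_cong[OF AE_eq_commute[OF AE_S_integrand[OF assms]]])
  then show ?thesis
    unfolding conv_def by (simp only: Henstock_Kurzweil_Integration.integral_restrict_UNIV)
qed

lemma integrable_S_integrand:
  assumes "0 < q" "q < T" "q \<in> good"
  shows "(\<lambda>s. a (q - s) *\<^sub>R S s x) integrable_on {0..q}"
proof -
  have "(\<lambda>s. if s \<in> {0..q} then a (q - s) *\<^sub>R S s x else 0) integrable_on UNIV"
    by (rule integrable_on_UNIV_AE_cong[OF bochner_L1_integrable_on[OF bochner_L1_\<beta>_integrand[OF assms(3)]]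
        AE_eq_commute[OF AE_S_integrand[OF assms(1,2)]]])
  then show ?thesis by (simp only: Henstock_Kurzweil_Integration.integrable_restrict_UNIV)
qed

lemma conv2_eq:
  assumes ts: "0 < t" "0 < s" "t + s < T"
  shows "conv2 (\<lambda>t s. a (t + s)) (\<lambda>t s. S t (S s x)) t s
    = double_integral t s x"
proof -
  define I where "I r1 = integral {0..s} (\<lambda>r2. a (t - r1 + (s - r2)) *\<^sub>R S r1 (S r2 x))" for r1
  \<comment> \<open>r1 = 0 is excluded since \<open>S 0\<close> is arbitrary whereas
    \<open>\<sigma> 0\<close> vanishes.\<close>
  have inner: "(if r1 \<in> {0..t} then I r1 else 0) = integral UNIV (\<lambda>r2. (indicat_real {..t} r1 * indicat_real {..s} r2) *\<^sub>R
           \<alpha> (t + s - r1 - r2) *\<^sub>R \<sigma> r1 (\<sigma> r2 x))" if "r1 \<noteq> 0" for r1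
  proof (cases "0 < r1 \<and> r1 \<le> t")
    case True
    have "I r1 = integral UNIV (\<lambda>r2. if r2 \<in> {0..s} then a (t - r1 + (s - r2)) *\<^sub>R S r1 (S r2 x) else 0)"
      unfolding I_def by (simp only: Henstock_Kurzweil_Integration.integral_restrict_UNIV)
    also have "\<dots> = integral UNIV (\<lambda>r2. (indicat_real {..t} r1 * indicat_real {..s} r2) *\<^sub>R
           \<alpha> (t + s - r1 - r2) *\<^sub>R \<sigma> r1 (\<sigma> r2 x))"
    proof (rule integral_UNIV_AE_cong)
      show "AE r2 in lborel. (if r2 \<in> {0..s} then a (t - r1 + (s - r2)) *\<^sub>R S r1 (S r2 x) else 0)
        = (indicat_real {..t} r1 * indicat_real {..s} r2) *\<^sub>R \<alpha> (t + s - r1 - r2) *\<^sub>R \<sigma> r1 (\<sigma> r2 x)"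
        using \<alpha>_reflect[of "t + s - r1"] AE_lborel_singleton[of 0] AE_lborel_singleton[of s]
      proof eventually_elim
        case (elim r2)
        have arg: "t - r1 + (s - r2) = t + s - r1 - r2" by simp
        show ?case
        proof (cases "0 < r2 \<and> r2 < s")
          case r2: True
          then have "\<alpha> (t + s - r1 - r2) = a (t + s - r1 - r2)" using elim(1) True ts by auto
          then show ?thesis using True r2 ts unfolding arg by (auto simp: \<sigma>_eq)
        next
          case False
          with elim(2,3) consider "r2 < 0" | "s < r2" by linarith
          then show ?thesis
          proof cases
            case 1
            moreover have "\<sigma> r1 0 = 0" by (simp add: \<sigma>_simps)
            ultimately show ?thesis by (simp add: \<sigma>_eq[of r2])
          qed simp
        qed
      qed
    qed
    finally show ?thesis using True by simp
  next
    case False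
    then have z: "(indicat_real {..t} r1 * indicat_real {..s} r2) *\<^sub>R \<alpha> (t + s - r1 - r2) *\<^sub>R \<sigma> r1 (\<sigma> r2 x) = 0" for r2
      using that by (cases "r1 \<le> t") (auto simp: \<sigma>_eq)
    show ?thesis unfolding z using False that by auto
  qed
  have "conv2 (\<lambda>t s. a (t + s)) (\<lambda>t s. S t (S s x)) t s = integral UNIV (\<lambda>r1. if r1 \<in> {0..t} then I r1 else 0)"
    unfolding conv2_def I_def by (simp only: Henstock_Kurzweil_Integration.integral_restrict_UNIV)
  also have "\<dots> = double_integral t s x"
    by (rule integral_UNIV_AE_cong) (rule eventually_mono[OF AE_lborel_singleton[of 0] inner])
  finally show ?thesis .
qed

text \<open>Reflecting the variable of the first convolution about s / 2 brings the two terms to the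
  antidiagonal forms \<kappa>(\<rho>) \<beta>(\<tau> - \<rho>) and \<kappa>(\<tau> - \<rho>)
  \<beta>(\<rho>) with \<tau> = t + s.\<close>

lemma functional_equation_at_iff:
  assumes ts: "0 < t" "0 < s" "t + s < T" and good: "t + s \<in> good_pairs"
  shows "functional_equation_at a k S t s x
    \<longleftrightarrow> integral UNIV (\<lambda>\<rho>. indicat_real {..s} \<rho> *\<^sub>R W x (\<rho>, t + s - \<rho>)) = 0"
proof -
  let ?B = "conv a (\<lambda>r. S r x)"
  define G where "G \<rho> = indicat_real {..s} \<rho> *\<^sub>R \<kappa> \<rho> *\<^sub>R \<beta> (t + s - \<rho>) x" for \<rho>
  have G: "bochner_L1 lborel G" unfolding G_def
    by (rule bochner_L1_bounded_mult[OF bochner_L1_\<kappa>\<beta>[OF good], where C = 1]) (auto split: split_indicator)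
  have "conv k (translate t ?B) s = integral UNIV (\<lambda>r. if r \<in> {0..s} then k (s - r) *\<^sub>R ?B (r + t) else 0)"
    unfolding conv_def[of k] translate_def by (simp only: Henstock_Kurzweil_Integration.integral_restrict_UNIV)
  also have "\<dots> = integral UNIV (\<lambda>r. G (s - r))"
  proof (rule integral_UNIV_AE_cong)
    show "AE r in lborel. (if r \<in> {0..s} then k (s - r) *\<^sub>R ?B (r + t) else 0) = G (s - r)"
      using AE_lborel_singleton[of 0] AE_lborel_singleton[of s]
    proof eventually_elim
      case (elim r)
      have arg: "t + s - (s - r) = r + t" by simp
      show ?case
      proof (cases "0 < r \<and> r < s")
        case True
        then show ?thesis unfolding G_def arg using ts by (simp add: \<kappa>_eq \<beta>_eq)
      next
        case False
        with elim show ?thesis unfolding G_def by (auto simp: \<kappa>_eq indicator_def)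
      qed
    qed
  qed
  also have "\<dots> = integral UNIV G" by (rule integral_reflect_bochner_L1[OF G])
  finally have 1: "conv k (translate t ?B) s = integral UNIV (\<lambda>\<rho>. indicat_real {..s} \<rho> *\<^sub>R \<kappa> \<rho> *\<^sub>R \<beta> (t + s - \<rho>) x)"
    unfolding G_def .
  have "conv (translate t k) ?B s = integral UNIV (\<lambda>r. if r \<in> {0..s} then k (s - r + t) *\<^sub>R ?B r else 0)"
    unfolding conv_def[of "translate t k"] unfolding translate_def
    by (simp only: Henstock_Kurzweil_Integration.integral_restrict_UNIV)
  also have "\<dots> = integral UNIV (\<lambda>\<rho>. indicat_real {..s} \<rho> *\<^sub>R \<kappa> (t + s - \<rho>) *\<^sub>R \<beta> \<rho> x)"
  proof (rule integral_UNIV_AE_cong)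
    show "AE r in lborel. (if r \<in> {0..s} then k (s - r + t) *\<^sub>R ?B r else 0)
        = indicat_real {..s} r *\<^sub>R \<kappa> (t + s - r) *\<^sub>R \<beta> r x"
      using AE_lborel_singleton[of 0] AE_lborel_singleton[of s]
    proof eventually_elim
      case (elim r)
      have arg: "t + s - r = s - r + t" by simp
      show ?case
      proof (cases "0 < r \<and> r < s")
        case True
        then show ?thesis unfolding arg using ts by (simp add: \<kappa>_eq \<beta>_eq)
      next
        case False
        with elim show ?thesis by (auto simp: \<beta>_nonpos indicator_def)
      qed
    qed
  qed
  finally have 2: "conv (translate t k) ?B s = integral UNIV (\<lambda>\<rho>. indicat_real {..s} \<rho> *\<^sub>R \<kappa> (t + s - \<rho>) *\<^sub>R \<beta> \<rho> x)" .
  show ?thesis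
    unfolding functional_equation_at_def conv2_eq[OF ts] 1 2 by (rule functional_equation_iff[OF good])
qed

end

section \<open>The functional and the resolvent equation below the cut-off\<close>

context truncated_setting
begin

lemma W_eq:
  assumes "0 < p" "p < T" "0 < q" "q < T"
  shows "W x (p, q) = S p (conv a (\<lambda>s. S s x) q) - S q (conv a (\<lambda>s. S s x) p)
    - (k p *\<^sub>R conv a (\<lambda>s. S s x) q - k q *\<^sub>R conv a (\<lambda>s. S s x) p)"
  using assms by (simp add: W_def \<sigma>_eq \<kappa>_eq \<beta>_eq)

text \<open>On (0, q) the integrand is positive almost everywhere, so its integral cannot
  vanish.\<close>

lemma c_pos:
  assumes q: "0 < q" "q < T" "q \<in> good"
  shows "0 < c q"
proof (rule ccontr)
  assume "\<not> 0 < c q"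
  then have "(\<integral>s. \<alpha> (q - s) * \<kappa> s \<partial>lborel) = 0" using c_nonneg[of q] by (simp add: c_def)
  then have "AE s in lborel. \<alpha> (q - s) * \<kappa> s = 0"
    using q(3) \<alpha>(2) \<kappa>(2) by (subst (asm) integral_nonneg_eq_0_iff_AE) (auto simp: good_def)
  with \<alpha>_reflect[of q] AE_reflect[OF a_pos_lborel, of q]
  have "AE s in lborel. 0 < s \<and> s < q \<longrightarrow> False"
  proof eventually_elim
    case (elim s)
    show ?case
    proof
      assume s: "0 < s \<and> s < q"
      then have "0 < \<alpha> (q - s)" "0 < \<kappa> s" using elim(1,2) q(1,2) k_pos[of s] by (auto simp: \<kappa>_eq)
      with elim(3) show False by simp
    qed
  qed
  from AE_interval_witness[OF this q(1)] show False by blast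
qed

lemma good_nonpos: "q \<le> 0 \<Longrightarrow> q \<in> good"
proof -
  assume "q \<le> 0"
  then have "\<alpha> (q - s) * \<kappa> s = 0" for s
    using \<alpha>(3)[of "q - s"] \<kappa>(3)[of s] by (cases "s \<le> 0") auto
  then have eq: "(\<lambda>s. \<alpha> (q - s) * \<kappa> s) = (\<lambda>s. 0)" by (rule ext)
  show ?thesis unfolding good_def mem_Collect_eq eq by simp
qed

lemma c_nonpos: "q \<le> 0 \<Longrightarrow> c q = 0"
proof -
  assume "q \<le> 0"
  then have "\<alpha> (q - s) * \<kappa> s = 0" for s
    using \<alpha>(3)[of "q - s"] \<kappa>(3)[of s] by (cases "s \<le> 0") auto
  then have eq: "(\<lambda>s. \<alpha> (q - s) * \<kappa> s) = (\<lambda>s. 0)" by (rule ext)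
  show ?thesis unfolding c_def eq by simp
qed

text \<open>The region p + q < T is a union of antidiagonals, and for positive p and q in it
  \<open>W\<close> is expressed by the original \<open>k\<close> and \<open>S\<close> (see
  \<open>W_eq\<close>).\<close>

lemma bochner_L1_W_truncated:
  "bochner_L1 plane (\<lambda>z. indicat_real {..<T} (fst z + snd z) *\<^sub>R W x z)"
proof (rule bochner_L1_bounded_mult[OF bochner_L1_W])
  have "(\<lambda>z. fst z + snd z) \<in> borel_measurable plane" by measurable
  then show "(\<lambda>z. indicat_real {..<T} (fst z + snd z)) \<in> borel_measurable plane"
    by (rule measurable_compose) (rule borel_measurable_indicator, rule lessThan_borel)
  show "\<bar>indicat_real {..<T} (fst z + snd z)\<bar> \<le> 1" for z :: "real \<times> real"
    unfolding indicator_def by auto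
qed

text \<open>On an antidiagonal with good \<tau> the functional equation for almost every s amounts
  to the vanishing of \<open>W\<close> almost everywhere. The second claim is uniform in s: its
  exceptional set depends on \<tau> alone, so it passes to the plane without measurability of the
  functional equation.\<close>

lemma W_zero_iff_functional_equation:
  "(AE \<tau> in lborel. AE s in lborel. 0 < s \<and> s < \<tau> \<and> \<tau> < T \<longrightarrow> functional_equation_at a k S (\<tau> - s) s x)
    \<longleftrightarrow> (AE q in lborel. AE p in lborel. p + q < T \<longrightarrow> W x (p, q) = 0)"
    (is "?FE \<longleftrightarrow> ?RE")
  and functional_equation_at_if_W_zero:
  "AE q in lborel. AE p in lborel. p + q < T \<longrightarrow> W x (p, q) = 0 \<Longrightarrow>
    AE \<tau> in lborel. \<forall>s. 0 < s \<and> s < \<tau> \<and> \<tau> < T \<longrightarrow> functional_equation_at a k S (\<tau> - s) s x"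
proof -
  define V where "V z = indicat_real {..<T} (fst z + snd z) *\<^sub>R W x z" for z
  have V: "bochner_L1 plane V" unfolding V_def by (rule bochner_L1_W_truncated)
  have V0: "V z = 0 \<longleftrightarrow> (fst z + snd z < T \<longrightarrow> W x z = 0)" for z
    by (auto simp: V_def indicator_def)
  have "?RE \<longleftrightarrow> (AE q in lborel. AE p in lborel. V (p, q) = 0)"
    unfolding V0 fst_conv snd_conv ..
  also have "\<dots> \<longleftrightarrow> (AE \<tau> in lborel. AE \<rho> in lborel. V (\<rho>, \<tau> - \<rho>) = 0)"
    by (simp only: bochner_L1_zero_antidiagonal_iff[OF V])
  finally have RE': "?RE \<longleftrightarrow> (AE \<tau> in lborel. AE \<rho> in lborel. \<tau> < T \<longrightarrow> W x (\<rho>, \<tau> - \<rho>) = 0)"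
    unfolding V0 fst_conv snd_conv by (simp only: add_diff_cancel_left' add_diff_eq)
  have all: "AE \<tau> in lborel. \<forall>s. 0 < s \<and> s < \<tau> \<and> \<tau> < T \<longrightarrow> functional_equation_at a k S (\<tau> - s) s x" if ?RE
    using that[unfolded RE'] AE_good_pairs
  proof eventually_elim
    case (elim \<tau>)
    show ?case
    proof (intro allI impI)
      fix s assume s: "0 < s \<and> s < \<tau> \<and> \<tau> < T"
      have "integral UNIV (\<lambda>\<rho>. indicat_real {..s} \<rho> *\<^sub>R W x (\<rho>, \<tau> - \<rho>)) = integral UNIV (\<lambda>\<rho>::real. 0 :: 'a)"
        by (rule integral_UNIV_AE_cong) (use elim(1) s in \<open>auto elim!: eventually_mono\<close>)
      then show "functional_equation_at a k S (\<tau> - s) s x"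
        using functional_equation_at_iff[of "\<tau> - s" s x] s elim(2) by simp
    qed
  qed
  then show "AE \<tau> in lborel. \<forall>s. 0 < s \<and> s < \<tau> \<and> \<tau> < T \<longrightarrow> functional_equation_at a k S (\<tau> - s) s x" if ?RE
    using that .
  show "?FE \<longleftrightarrow> ?RE"
  proof
    assume ?FE
    with AE_good_pairs show ?RE
      unfolding RE'
    proof eventually_elim
      case (elim \<tau>)
      show ?case
      proof (cases "0 < \<tau> \<and> \<tau> < T")
        case True
        have "AE s in lborel. 0 < s \<and> s < \<tau> \<longrightarrow> integral UNIV (\<lambda>\<rho>. indicat_real {..s} \<rho> *\<^sub>R W x (\<rho>, \<tau> - \<rho>)) = 0"
          using elim(2)
        proof eventually_elim
          case (elim s)
          then show ?case
            using functional_equation_at_iff[of "\<tau> - s" s x] True \<open>\<tau> \<in> good_pairs\<close> by simp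
        qed
        from W_zero_on_antidiagonal[OF elim(1) _ this] True show ?thesis by (auto elim: eventually_mono)
      next
        case False
        \<comment> \<open>For \<tau> \<le> 0 the antidiagonal does not meet the open
          quadrant.\<close>
        have "\<tau> < T \<longrightarrow> W x (\<rho>, \<tau> - \<rho>) = 0" for \<rho>
        proof
          assume "\<tau> < T"
          with False have "\<rho> \<le> 0 \<or> \<tau> \<le> \<rho>" by linarith
          then show "W x (\<rho>, \<tau> - \<rho>) = 0" by (rule W_antidiagonal_outside)
        qed
        then show ?thesis by simp
      qed
    qed
  next
    assume ?RE
    from all[OF this] show ?FE by eventually_elim auto
  qed
qed

end

section \<open>Bounds and algebraic rules for B = a * S\<close>

context commuting_family
begin

abbreviation B :: "real \<Rightarrow> 'a \<Rightarrow> 'a" where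
  "B t x \<equiv> conv a (\<lambda>s. S s x) t"

definition convolvable :: "real \<Rightarrow> bool" where
  "convolvable t \<longleftrightarrow> (\<lambda>s. a (t - s) * k s) integrable_on {0..t}"

definition resolvent_equation_at :: "'a \<Rightarrow> real \<Rightarrow> real \<Rightarrow> bool" where
  "resolvent_equation_at x p q \<longleftrightarrow> S p (B q x) - k p *\<^sub>R B q x = S q (B p x) - k q *\<^sub>R B p x"

lemma obtain_truncation:
  assumes "0 < T"
  obtains \<alpha> \<kappa> \<sigma> M where "truncated_setting a k S \<alpha> \<kappa> \<sigma> M T"
  using truncation_exists[OF assms] by blast

lemma AE_nat_bound:
  assumes "\<And>n::nat. AE t in lborel. t < real n + 1 \<longrightarrow> P t"
  shows "AE t in lborel. P (t :: real)"
proof -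
  have "AE t in lborel. \<forall>n::nat. t < real n + 1 \<longrightarrow> P t" unfolding AE_all_countable by (intro allI assms)
  then show ?thesis
  proof eventually_elim
    case (elim t)
    obtain n :: nat where "t < real n" using reals_Archimedean2 by blast
    then show ?case using elim[rule_format, of n] by simp
  qed
qed

lemma AE_convolvable: "AE t in lborel. 0 < t \<longrightarrow> convolvable t"
proof (rule AE_nat_bound)
  fix n :: nat
  obtain \<alpha> \<kappa> \<sigma> M where "truncated_setting a k S \<alpha> \<kappa> \<sigma> M (real n + 1)"
    by (rule obtain_truncation[of "real n + 1"]) auto
  then interpret truncated_setting a k S \<alpha> \<kappa> \<sigma> M "real n + 1" .
  show "AE t in lborel. t < real n + 1 \<longrightarrow> 0 < t \<longrightarrow> convolvable t"
    using AE_good by eventually_elim (auto simp: good_iff[symmetric] convolvable_def)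
qed

lemma B_integrable:
  assumes "0 < t" "convolvable t"
  shows "(\<lambda>s. a (t - s) *\<^sub>R S s x) integrable_on {0..t}"
proof -
  have "0 < t + 1" using assms(1) by simp
  from obtain_truncation[OF this] obtain \<alpha> \<kappa> \<sigma> M where "truncated_setting a k S \<alpha> \<kappa> \<sigma> M (t + 1)" by metis
  then interpret truncated_setting a k S \<alpha> \<kappa> \<sigma> M "t + 1" .
  show ?thesis
    by (rule integrable_S_integrand) (use assms in \<open>auto simp: good_iff convolvable_def\<close>)
qed

lemma conv_a_k_pos:
  assumes "0 < t" "convolvable t"
  shows "0 < conv a k t"
proof -
  have "0 < t + 1" using assms(1) by simp
  from obtain_truncation[OF this] obtain \<alpha> \<kappa> \<sigma> M where "truncated_setting a k S \<alpha> \<kappa> \<sigma> M (t + 1)" by metis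
  then interpret truncated_setting a k S \<alpha> \<kappa> \<sigma> M "t + 1" .
  have "t \<in> good" using assms by (simp add: good_iff convolvable_def)
  then show ?thesis using c_pos[of t] c_eq[of t] assms(1) by simp
qed

text \<open>The parameter \<open>r\<close> allows two uses: r = 1 compares B(t)x with the scalar
  convolution of \<open>a\<close> and \<open>k\<close> times x, and r = 0 bounds the operator
  B(t).\<close>

lemma norm_B_diff_le:
  assumes t: "0 < t" "convolvable t" and K: "\<And>s. 0 < s \<Longrightarrow> s \<le> t \<Longrightarrow> norm (S s x - r *\<^sub>R k s *\<^sub>R x) \<le> K * k s"
  shows "norm (B t x - r *\<^sub>R conv a k t *\<^sub>R x) \<le> K * conv a k t"
proof -
  note kint = t(2)[unfolded convolvable_def]
  have kx: "((\<lambda>s. a (t - s) *\<^sub>R (r *\<^sub>R k s *\<^sub>R x)) has_integral r *\<^sub>R conv a k t *\<^sub>R x) {0..t}"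
    using has_integral_cmul[OF has_integral_scaleR_left[OF integrable_integral[OF kint], of x], of r]
    by (simp add: conv_def mult_ac)
  have "B t x - r *\<^sub>R conv a k t *\<^sub>R x = integral {0..t} (\<lambda>s. a (t - s) *\<^sub>R S s x - a (t - s) *\<^sub>R (r *\<^sub>R k s *\<^sub>R x))"
    unfolding conv_def[of a "\<lambda>s. S s x"]
    using Henstock_Kurzweil_Integration.integral_diff[OF B_integrable[OF t, of x] has_integral_integrable[OF kx]]
      integral_unique[OF kx] by simp
  also have "norm \<dots> \<le> integral {0..t} (\<lambda>s. K * (a (t - s) * k s))"
  proof (rule integral_norm_bound_AE)
    show "(\<lambda>s. a (t - s) *\<^sub>R S s x - a (t - s) *\<^sub>R (r *\<^sub>R k s *\<^sub>R x)) integrable_on {0..t}"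
      by (rule Henstock_Kurzweil_Integration.integrable_diff[OF B_integrable[OF t] has_integral_integrable[OF kx]])
    show "(\<lambda>s. K * (a (t - s) * k s)) integrable_on {0..t}"
      using integrable_cmul[OF kint, of K] by simp
    show "AE s in lborel. s \<in> {0..t} \<longrightarrow> norm (a (t - s) *\<^sub>R S s x - a (t - s) *\<^sub>R (r *\<^sub>R k s *\<^sub>R x)) \<le> K * (a (t - s) * k s)"
      using AE_reflect[OF a_pos_lborel, of t] AE_lborel_singleton[of 0] AE_lborel_singleton[of t]
    proof eventually_elim
      case (elim s)
      show ?case
      proof
        assume "s \<in> {0..t}"
        with elim have s: "0 < s" "s \<le> t" "0 < a (t - s)" by auto
        have "norm (a (t - s) *\<^sub>R S s x - a (t - s) *\<^sub>R (r *\<^sub>R k s *\<^sub>R x)) = a (t - s) * norm (S s x - r *\<^sub>R k s *\<^sub>R x)"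
          unfolding scaleR_diff_right[symmetric] norm_scaleR using s(3) by simp
        also have "\<dots> \<le> a (t - s) * (K * k s)"
          by (rule mult_left_mono[OF K[OF s(1,2)]]) (use s(3) in simp)
        finally show "norm (a (t - s) *\<^sub>R S s x - a (t - s) *\<^sub>R (r *\<^sub>R k s *\<^sub>R x)) \<le> K * (a (t - s) * k s)"
          by (simp add: mult_ac)
      qed
    qed
  qed
  also have "\<dots> = K * conv a k t" by (simp add: conv_def)
  finally show ?thesis .
qed

text \<open>A relative error of 1/2 near 0 is enough: B(t)y then differs from (a * k)(t)y by at most
  half the norm of the latter, hence is nonzero.\<close>

lemma B_injective:
  assumes "AE t in lborel. 0 < t \<longrightarrow> B t y = 0"
  shows "y = 0"
proof (rule ccontr)
  assume "y \<noteq> 0"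
  have "\<forall>\<^sub>F t in at_right 0. dist (S t y /\<^sub>R k t) y < norm y / 2"
    by (rule tendstoD[OF lim]) (use \<open>y \<noteq> 0\<close> in simp)
  then obtain b where b: "b > 0" "\<And>t. 0 < t \<Longrightarrow> t < b \<Longrightarrow> dist (S t y /\<^sub>R k t) y < norm y / 2"
    unfolding eventually_at_right_field by auto
  \<comment> \<open>Both \<open>B t y = 0\<close> and the existence of the convolution are known
    only almost everywhere, so t is picked from an interval of positive length.\<close>
  have "AE t in lborel. 0 < t \<and> t < b \<longrightarrow> B t y = 0 \<and> convolvable t"
    using assms AE_convolvable by eventually_elim auto
  from AE_interval_witness[OF this b(1)]
  obtain t where t: "0 < t" "t < b" "B t y = 0" "convolvable t" by auto
  have "norm (B t y - 1 *\<^sub>R conv a k t *\<^sub>R y) \<le> (norm y / 2) * conv a k t"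
  proof (rule norm_B_diff_le[OF t(1,4)])
    fix s assume s: "0 < s" "s \<le> t"
    then have ks: "0 < k s" by (simp add: k_pos)
    have "S s y - 1 *\<^sub>R k s *\<^sub>R y = k s *\<^sub>R (S s y /\<^sub>R k s - y)"
      using ks by (simp add: scaleR_diff_right)
    then have "norm (S s y - 1 *\<^sub>R k s *\<^sub>R y) = k s * dist (S s y /\<^sub>R k s) y"
      using ks by (simp only: norm_scaleR dist_norm abs_of_pos)
    also have "\<dots> \<le> k s * (norm y / 2)"
      using b(2)[of s] s t(2) ks by (intro mult_left_mono) auto
    finally show "norm (S s y - 1 *\<^sub>R k s *\<^sub>R y) \<le> norm y / 2 * k s" by (simp add: mult.commute)
  qed
  then have "conv a k t * norm y \<le> (norm y / 2) * conv a k t"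
    using conv_a_k_pos[OF t(1,4)] by (simp add: t(3))
  with conv_a_k_pos[OF t(1,4)] \<open>y \<noteq> 0\<close> show False by (simp add: mult.commute)
qed

lemma norm_B_le:
  assumes "0 < T"
  obtains M where "\<And>t x. 0 < t \<Longrightarrow> t \<le> T \<Longrightarrow> convolvable t \<Longrightarrow> norm (B t x) \<le> M * conv a k t * norm x"
proof -
  obtain M where M: "0 \<le> M" "\<And>t x. 0 < t \<Longrightarrow> t \<le> T \<Longrightarrow> norm (S t x) \<le> M * k t * norm x"
    using uniform_bound[OF assms] by blast
  show thesis
  proof (rule that[of M])
    fix t x assume t: "0 < t" "t \<le> T" "convolvable t"
    have "norm (B t x - 0 *\<^sub>R conv a k t *\<^sub>R x) \<le> (M * norm x) * conv a k t"
      by (rule norm_B_diff_le[OF t(1,3)]) (use M(2)[of _ x] t(2) in \<open>simp add: mult_ac\<close>)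
    then show "norm (B t x) \<le> M * conv a k t * norm x" by (simp add: mult_ac)
  qed
qed

lemma has_integral_B:
  assumes "(\<lambda>s. a (t - s) *\<^sub>R S s x) integrable_on {0..t}"
  shows "((\<lambda>s. a (t - s) *\<^sub>R S s x) has_integral B t x) {0..t}"
  unfolding conv_def using assms by (rule integrable_integral)

text \<open>The value at \<open>s = 0\<close> of an orbit is arbitrary, hence the exceptional point.\<close>

lemma B_unique:
  assumes "(f has_integral y) {0..t}" "\<And>s. 0 < s \<Longrightarrow> s \<le> t \<Longrightarrow> f s = a (t - s) *\<^sub>R S s x"
  shows "B t x = y" "(\<lambda>s. a (t - s) *\<^sub>R S s x) integrable_on {0..t}"
proof -
  have "((\<lambda>s. a (t - s) *\<^sub>R S s x) has_integral y) {0..t}"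
    by (rule has_integral_spike[OF negligible_sing[of 0] _ assms(1)]) (use assms(2) in auto)
  then show "B t x = y" "(\<lambda>s. a (t - s) *\<^sub>R S s x) integrable_on {0..t}"
    unfolding conv_def by auto
qed

text \<open>Used for scalars, for S(q) and for S(q) - k(q): a bounded operator commuting with the
  family can be taken out of the integral B(t).\<close>

lemma B_linear_image:
  assumes int: "(\<lambda>s. a (t - s) *\<^sub>R S s x) integrable_on {0..t}"
    and L: "bounded_linear L" "\<And>s. 0 < s \<Longrightarrow> L (S s x) = S s (L x)"
  shows "B t (L x) = L (B t x)" "(\<lambda>s. a (t - s) *\<^sub>R S s (L x)) integrable_on {0..t}"
proof -
  have "((\<lambda>s. L (a (t - s) *\<^sub>R S s x)) has_integral L (B t x)) {0..t}"
    using has_integral_linear[OF has_integral_B[OF int] L(1)] by (simp add: o_def)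
  from B_unique[OF this, of "L x"]
  show "B t (L x) = L (B t x)" "(\<lambda>s. a (t - s) *\<^sub>R S s (L x)) integrable_on {0..t}"
    by (auto simp: linear_simps[OF L(1)] L(2))
qed

lemma B_add:
  assumes "(\<lambda>s. a (t - s) *\<^sub>R S s x) integrable_on {0..t}" "(\<lambda>s. a (t - s) *\<^sub>R S s y) integrable_on {0..t}"
  shows "B t (x + y) = B t x + B t y"
  by (rule B_unique(1)[OF has_integral_add[OF has_integral_B[OF assms(1)] has_integral_B[OF assms(2)]]])
     (simp add: linear_simps[OF S_lin] scaleR_add_right)

lemma B_diff:
  assumes "(\<lambda>s. a (t - s) *\<^sub>R S s x) integrable_on {0..t}" "(\<lambda>s. a (t - s) *\<^sub>R S s y) integrable_on {0..t}"
  shows "B t (x - y) = B t x - B t y"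
  by (rule B_unique(1)[OF has_integral_diff[OF has_integral_B[OF assms(1)] has_integral_B[OF assms(2)]]])
     (simp add: linear_simps[OF S_lin] scaleR_diff_right)

lemma B_scaleR:
  assumes "(\<lambda>s. a (t - s) *\<^sub>R S s x) integrable_on {0..t}"
  shows "B t (r *\<^sub>R x) = r *\<^sub>R B t x"
  by (rule B_linear_image(1)[OF assms bounded_linear_scaleR_right]) (simp add: linear_simps[OF S_lin])

end

subsection \<open>Closed operators and the generator\<close>

lemma has_integral_in_closed_subspace:
  fixes f :: "real \<Rightarrow> 'a::real_normed_vector"
  assumes G: "closed G" "0 \<in> G" "\<And>x y. x \<in> G \<Longrightarrow> y \<in> G \<Longrightarrow> x + y \<in> G" "\<And>c x. x \<in> G \<Longrightarrow> c *\<^sub>R x \<in> G"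
    and f: "(f has_integral y) {a..b}" "\<And>s. s \<in> {a..b} \<Longrightarrow> f s \<in> G"
  shows "y \<in> G"
proof -
  have "\<exists>z\<in>G. dist z y < e" if e: "e > 0" for e
  proof -
    obtain \<gamma> where \<gamma>: "gauge \<gamma>" "\<And>\<D>. \<D> tagged_division_of {a..b} \<Longrightarrow> \<gamma> fine \<D> \<Longrightarrow>
        norm ((\<Sum>(x,k)\<in>\<D>. content k *\<^sub>R f x) - y) < e"
      using f(1)[unfolded has_integral_real, rule_format, OF e] by auto
    obtain \<D> where \<D>: "\<D> tagged_division_of {a..b}" "\<gamma> fine \<D>"
      by (rule fine_division_exists_real[OF \<gamma>(1)])
    have tags: "f x \<in> G" if "(x, k) \<in> \<D>" for x k
      using tagged_division_ofD(2,3)[OF \<D>(1) that] f(2) by blast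
    from tagged_division_of_finite[OF \<D>(1)] tags
    have "(\<Sum>(x,k)\<in>\<D>. content k *\<^sub>R f x) \<in> G"
    proof (induction \<D> rule: finite_induct[consumes 1, case_names empty insert])
      case empty
      then show ?case using G(2) by simp
    next
      case (insert p \<D>)
      obtain x k where p: "p = (x, k)" by (cases p)
      have "f x \<in> G" by (rule insert.prems[of x k]) (simp add: p)
      moreover have "(\<Sum>(x,k)\<in>\<D>. content k *\<^sub>R f x) \<in> G"
        by (rule insert.IH) (use insert.prems in blast)
      ultimately show ?case using insert.hyps G(3,4) by (simp add: p)
    qed
    with \<gamma>(2)[OF \<D>] show ?thesis by (auto simp: dist_norm)
  qed
  then show ?thesis using G(1) closed_approachable by blast
qed

lemma closed_operator_scaleR:
  assumes "closed_operator D A" "x \<in> D"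
  shows "r *\<^sub>R x \<in> D" "A (r *\<^sub>R x) = r *\<^sub>R A x"
proof -
  have "complex_of_real r *\<^sub>C x \<in> D \<and> A (complex_of_real r *\<^sub>C x) = complex_of_real r *\<^sub>C A x"
    using assms unfolding closed_operator_def by blast
  then show "r *\<^sub>R x \<in> D" "A (r *\<^sub>R x) = r *\<^sub>R A x" unfolding scaleC_of_real by auto
qed

lemma closed_operator_zero:
  assumes "closed_operator D A"
  shows "0 \<in> D" "A 0 = 0"
proof -
  show "0 \<in> D" using assms unfolding closed_operator_def by blast
  from closed_operator_scaleR(2)[OF assms this, of 0] show "A 0 = 0" by simp
qed

text \<open>Riemann sums of \<open>(f, A f)\<close> stay in the graph of \<open>A\<close>, which is closed.\<close>

lemma closed_operator_has_integral:
  fixes f g :: "real \<Rightarrow> 'a::complex_banach"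
  assumes A: "closed_operator D A"
    and f: "(f has_integral y) {a..b}" and g: "(g has_integral z) {a..b}"
    and fg: "\<And>s. s \<in> {a..b} \<Longrightarrow> f s \<in> D \<and> A (f s) = g s"
  shows "y \<in> D" "A y = z"
proof -
  let ?G = "(\<lambda>x. (x, A x)) ` D"
  have "((\<lambda>s. (f s, 0) + (0, g s)) has_integral (y, 0) + (0, z)) {a..b}"
    using has_integral_linear[OF f bounded_linear_Pair[OF bounded_linear_ident bounded_linear_zero]]
      has_integral_linear[OF g bounded_linear_Pair[OF bounded_linear_zero bounded_linear_ident]]
    by (intro has_integral_add) (simp_all add: o_def)
  then have fg_int: "((\<lambda>s. (f s, g s)) has_integral (y, z)) {a..b}" by simp
  have "(y, z) \<in> ?G"
  proof (rule has_integral_in_closed_subspace[OF _ _ _ _ fg_int])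
    show "closed ?G" using A unfolding closed_operator_def by blast
    show "0 \<in> ?G" using closed_operator_zero[OF A] by (intro image_eqI[of _ _ 0]) (simp_all add: zero_prod_def)
    show "u + v \<in> ?G" if uv: "u \<in> ?G" "v \<in> ?G" for u v
    proof -
      from uv obtain x x' where x: "x \<in> D" "x' \<in> D" "u = (x, A x)" "v = (x', A x')" by blast
      then have "x + x' \<in> D \<and> A (x + x') = A x + A x'" using A unfolding closed_operator_def by blast
      with x show ?thesis by (intro image_eqI[of _ _ "x + x'"]) simp_all
    qed
    show "c *\<^sub>R u \<in> ?G" if u: "u \<in> ?G" for c u
    proof -
      from u obtain x where x: "x \<in> D" "u = (x, A x)" by blast
      with closed_operator_scaleR[OF A x(1), of c] show ?thesis by (intro image_eqI[of _ _ "c *\<^sub>R x"]) simp_all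
    qed
    show "(f s, g s) \<in> ?G" if "s \<in> {a..b}" for s
      using fg[OF that] by (intro image_eqI[of _ _ "f s"]) simp_all
  qed
  then show "y \<in> D" "A y = z" by auto
qed

lemma closed_operator_tendsto:
  assumes "closed_operator D A" "\<And>n::nat. x n \<in> D" "x \<longlonglongrightarrow> l" "(\<lambda>n. A (x n)) \<longlonglongrightarrow> m"
  shows "l \<in> D" "A l = m"
proof -
  have cl: "closed ((\<lambda>x. (x, A x)) ` D)" using assms(1) unfolding closed_operator_def by blast
  have "(x n, A (x n)) \<in> (\<lambda>x. (x, A x)) ` D" for n using assms(2)[of n] by (rule imageI)
  from closed_sequentially[OF cl this tendsto_Pair[OF assms(3,4)]]
  have "(l, m) \<in> (\<lambda>x. (x, A x)) ` D" .
  then show "l \<in> D" "A l = m" by auto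
qed

section \<open>The resolvent equation and the operator it determines\<close>

context commuting_family
begin

text \<open>A passes through B(p) because it is closed and commutes with each S(s): with y = B(q)x
  and z = Ay one gets A B(p)y = B(p)z, and B(p)z = S(q)B(p)x - k(q)B(p)x by commutativity of the
  family.\<close>

lemma resolvent_equation_if_generator:
  assumes A: "closed_operator D A" and comm: "commutes_with S D A" and pq: "0 < p" "0 < q"
    and q: "resolvent_identity_at a k S D A q x"
    and p: "resolvent_identity_at a k S D A p x" "resolvent_identity_at a k S D A p (B q x)"
  shows "resolvent_equation_at x p q"
proof -
  define y where "y = B q x"
  define z where "z = S q x - k q *\<^sub>R x"
  have y: "y \<in> D" "A y = z" using q unfolding resolvent_identity_at_def y_def z_def by auto
  have xint: "(\<lambda>s. a (p - s) *\<^sub>R S s x) integrable_on {0..p}"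
    using p(1) unfolding resolvent_identity_at_def by blast
  have yint: "(\<lambda>s. a (p - s) *\<^sub>R S s y) integrable_on {0..p}" and Ay: "A (B p y) = S p y - k p *\<^sub>R y"
    using p(2) unfolding resolvent_identity_at_def y_def by auto
  have L: "bounded_linear (\<lambda>v. S q v - k q *\<^sub>R v)"
    by (intro bounded_linear_sub S_lin pq bounded_linear_scaleR_right)
  have Lc: "S q (S s v) - k q *\<^sub>R S s v = S s (S q v - k q *\<^sub>R v)" if "0 < s" for s v
    using S_commute[OF pq(2) that] by (simp add: linear_simps[OF S_lin[OF that]])
  note zB = B_linear_image[OF xint L Lc, folded z_def]
  \<comment> \<open>The value at 0 is set to 0: S(0)y need not lie in D, and membership is required
    at every point of the interval.\<close>
  define f where "f s = (if s = 0 then 0 else a (p - s) *\<^sub>R S s y)" for s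
  define g where "g s = (if s = 0 then 0 else a (p - s) *\<^sub>R S s z)" for s
  have f: "(f has_integral B p y) {0..p}"
    by (rule has_integral_spike[OF negligible_sing[of 0] _ has_integral_B[OF yint]]) (auto simp: f_def)
  have g: "(g has_integral B p z) {0..p}"
    by (rule has_integral_spike[OF negligible_sing[of 0] _ has_integral_B[OF zB(2)]]) (auto simp: g_def)
  have "A (B p y) = B p z"
  proof (rule closed_operator_has_integral(2)[OF A f g])
    fix s assume "s \<in> {0..p}"
    show "f s \<in> D \<and> A (f s) = g s"
    proof (cases "s = 0")
      case False
      then have "S s y \<in> D" "A (S s y) = S s z"
        using comm y \<open>s \<in> {0..p}\<close> unfolding commutes_with_def by auto
      then show ?thesis using False closed_operator_scaleR[OF A] by (simp add: f_def g_def)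
    qed (use closed_operator_zero[OF A] in \<open>simp add: f_def g_def\<close>)
  qed
  then show ?thesis unfolding resolvent_equation_at_def using Ay zB(1) by (simp add: y_def)
qed

text \<open>The graph of the generator. The equation is imposed for almost every t because the
  integral defining \<open>B t y\<close> need not converge for the others.\<close>

definition generates :: "'a \<Rightarrow> 'a \<Rightarrow> bool" where
  "generates x y \<longleftrightarrow> (AE t in lborel. 0 < t \<longrightarrow> S t x - k t *\<^sub>R x = B t y)"

definition gen_domain :: "'a set" where
  "gen_domain = {x. \<exists>y. generates x y}"

definition gen :: "'a \<Rightarrow> 'a" where
  "gen x = (THE y. generates x y)"

lemma AE_B_integrable: "AE t in lborel. 0 < t \<longrightarrow> (\<lambda>s. a (t - s) *\<^sub>R S s x) integrable_on {0..t}"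
  using AE_convolvable by eventually_elim (auto intro: B_integrable)

lemma generates_unique:
  assumes "generates x y" "generates x z"
  shows "y = z"
proof -
  have "AE t in lborel. 0 < t \<longrightarrow> B t (y - z) = 0"
    using assms[unfolded generates_def] AE_B_integrable[of y] AE_B_integrable[of z]
    by eventually_elim (auto simp: B_diff)
  from B_injective[OF this] show ?thesis by simp
qed

lemma gen_eq: "generates x y \<Longrightarrow> x \<in> gen_domain \<and> gen x = y"
  unfolding gen_domain_def gen_def using generates_unique by blast

lemma generates_gen: "x \<in> gen_domain \<Longrightarrow> generates x (gen x)"
  using gen_eq unfolding gen_domain_def by blast

lemma generates_add:
  assumes "generates x y" "generates x' y'"
  shows "generates (x + x') (y + y')"
  unfolding generates_def
  using assms[unfolded generates_def] AE_B_integrable[of y] AE_B_integrable[of y']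
proof eventually_elim
  case (elim t)
  show ?case
  proof
    assume t: "0 < t"
    then have "S t (x + x') - k t *\<^sub>R (x + x') = (S t x - k t *\<^sub>R x) + (S t x' - k t *\<^sub>R x')"
      by (simp add: linear_simps[OF S_lin] scaleR_add_right)
    also have "\<dots> = B t (y + y')" using elim t by (simp add: B_add)
    finally show "S t (x + x') - k t *\<^sub>R (x + x') = B t (y + y')" .
  qed
qed

lemma generates_linear_image:
  assumes "generates x y" and L: "bounded_linear L" "\<And>s v. 0 < s \<Longrightarrow> L (S s v) = S s (L v)"
  shows "generates (L x) (L y)"
  unfolding generates_def
  using assms(1)[unfolded generates_def] AE_B_integrable[of y]
proof eventually_elim
  case (elim t)
  show ?case
  proof
    assume t: "0 < t"
    then have "S t (L x) - k t *\<^sub>R L x = L (S t x - k t *\<^sub>R x)"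
      by (simp add: L(2) linear_simps[OF L(1)])
    also have "\<dots> = B t (L y)" using elim t L(2) by (simp add: B_linear_image(1)[OF _ L])
    finally show "S t (L x) - k t *\<^sub>R L x = B t (L y)" .
  qed
qed

text \<open>Outside a countable union of null sets t can be fixed for the whole sequence, and there
  B(t) is a bounded operator.\<close>

lemma generates_tendsto:
  assumes gen: "\<And>n::nat. generates (x n) (y n)" and x: "x \<longlonglongrightarrow> l" and y: "y \<longlonglongrightarrow> m"
  shows "generates l m"
proof -
  have "AE t in lborel. \<forall>n. 0 < t \<longrightarrow> S t (x n) - k t *\<^sub>R x n = B t (y n)"
    using gen unfolding generates_def AE_all_countable by blast
  then show ?thesis
    unfolding generates_def using AE_convolvable
  proof eventually_elim
    case (elim t)
    show ?case
    proof
      assume t: "0 < t"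
      then have conv: "convolvable t" using elim by blast
      obtain M where M: "\<And>x. norm (B t x) \<le> M * conv a k t * norm x"
        by (rule norm_B_le[OF t]) (use t conv in blast)
      have "(\<lambda>n. S t (x n) - k t *\<^sub>R x n) \<longlonglongrightarrow> S t l - k t *\<^sub>R l"
        by (intro tendsto_intros x bounded_linear.tendsto[OF S_lin[OF t]])
      moreover have "(\<lambda>n. B t (y n)) \<longlonglongrightarrow> B t m"
      proof -
        have "(\<lambda>n. B t (y n - m)) \<longlonglongrightarrow> 0"
        proof (rule Lim_null_comparison)
          show "\<forall>\<^sub>F n in sequentially. norm (B t (y n - m)) \<le> M * conv a k t * norm (y n - m)"
            by (intro always_eventually allI M)
          show "(\<lambda>n. M * conv a k t * norm (y n - m)) \<longlonglongrightarrow> 0"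
            using y by (intro tendsto_mult_right_zero tendsto_norm_zero) (simp add: LIM_zero_iff)
        qed
        then show ?thesis by (simp add: B_diff B_integrable[OF t conv] LIM_zero_iff)
      qed
      moreover have "(\<lambda>n. S t (x n) - k t *\<^sub>R x n) = (\<lambda>n. B t (y n))" using elim(1) t by auto
      ultimately show "S t l - k t *\<^sub>R l = B t m" using LIMSEQ_unique by metis
    qed
  qed
qed

lemma closed_operator_gen: "closed_operator gen_domain gen"
proof -
  have "generates 0 0"
    unfolding generates_def using AE_B_integrable[of 0]
    by eventually_elim (use B_scaleR[of _ 0 0] in \<open>auto simp: linear_simps[OF S_lin]\<close>)
  then have "0 \<in> gen_domain" using gen_eq by blast
  moreover have "x + y \<in> gen_domain \<and> gen (x + y) = gen x + gen y" if "x \<in> gen_domain" "y \<in> gen_domain" for x y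
    by (rule gen_eq[OF generates_add[OF generates_gen[OF that(1)] generates_gen[OF that(2)]]])
  moreover have "z *\<^sub>C x \<in> gen_domain \<and> gen (z *\<^sub>C x) = z *\<^sub>C gen x" if "x \<in> gen_domain" for z x
    by (rule gen_eq[OF generates_linear_image[OF generates_gen[OF that] bounded_linear_scaleC]])
       (simp add: S_scaleC)
  moreover have "closed ((\<lambda>x. (x, gen x)) ` gen_domain)"
    unfolding closed_sequential_limits
  proof (intro allI impI)
    fix u :: "nat \<Rightarrow> 'a \<times> 'a" and l
    assume u: "(\<forall>n. u n \<in> (\<lambda>x. (x, gen x)) ` gen_domain) \<and> u \<longlonglongrightarrow> l"
    have "generates (fst (u n)) (snd (u n))" for n
    proof -
      from u obtain x where "x \<in> gen_domain" "u n = (x, gen x)" by blast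
      then show ?thesis by (simp add: generates_gen)
    qed
    moreover have "(\<lambda>n. fst (u n)) \<longlonglongrightarrow> fst l" "(\<lambda>n. snd (u n)) \<longlonglongrightarrow> snd l"
      using u by (auto intro: tendsto_fst tendsto_snd)
    ultimately have "generates (fst l) (snd l)" by (rule generates_tendsto)
    from gen_eq[OF this] show "l \<in> (\<lambda>x. (x, gen x)) ` gen_domain"
      by (intro image_eqI[of _ _ "fst l"]) (simp_all add: prod_eq_iff)
  qed
  ultimately show ?thesis unfolding closed_operator_def by blast
qed

lemma commutes_with_gen: "commutes_with S gen_domain gen"
  unfolding commutes_with_def
proof (intro allI impI ballI)
  fix t :: real and x assume t: "0 < t" and x: "x \<in> gen_domain"
  show "S t x \<in> gen_domain \<and> gen (S t x) = S t (gen x)"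
    by (rule gen_eq[OF generates_linear_image[OF generates_gen[OF x] S_lin[OF t] S_commute[OF t]]])
qed

text \<open>For fixed q the resolvent equation in p says that B(q)x is mapped to S(q)x - k(q)x. The
  exceptional q depend on x, but the operator does not.\<close>

lemma AE_resolvent_identity_gen:
  assumes "AE q in lborel. AE p in lborel. 0 < p \<and> 0 < q \<longrightarrow> resolvent_equation_at x p q"
  shows "AE q in lborel. 0 < q \<longrightarrow> resolvent_identity_at a k S gen_domain gen q x"
  using assms AE_B_integrable[of x]
proof eventually_elim
  case (elim q)
  show ?case
  proof
    assume q: "0 < q"
    have L: "bounded_linear (\<lambda>v. S q v - k q *\<^sub>R v)"
      by (intro bounded_linear_sub S_lin q bounded_linear_scaleR_right)
    have Lc: "S q (S s v) - k q *\<^sub>R S s v = S s (S q v - k q *\<^sub>R v)" if "0 < s" for s v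
      using S_commute[OF q that] by (simp add: linear_simps[OF S_lin[OF that]])
    have "generates (B q x) (S q x - k q *\<^sub>R x)"
      unfolding generates_def using elim(1) AE_B_integrable[of x]
      by eventually_elim (use q B_linear_image(1)[OF _ L Lc] in \<open>auto simp: resolvent_equation_at_def\<close>)
    from gen_eq[OF this] show "resolvent_identity_at a k S gen_domain gen q x"
      unfolding resolvent_identity_at_def using elim(2) q by blast
  qed
qed

text \<open>The iterated quantifier has its origin here: the identity at p is used for the vector
  B(q)x, so the null set of exceptional p depends on q.\<close>

lemma regularized_resolvent_family_ae_iff:
  "regularized_resolvent_family_ae a k S \<longleftrightarrow>
    (\<forall>x. AE q in lborel. AE p in lborel. 0 < p \<and> 0 < q \<longrightarrow> resolvent_equation_at x p q)"
proof
  assume "regularized_resolvent_family_ae a k S"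
  then obtain D A where A: "closed_operator D A" "commutes_with S D A"
    and ri: "\<And>x. AE t in lborel. 0 < t \<longrightarrow> resolvent_identity_at a k S D A t x"
    unfolding regularized_resolvent_family_ae_def AE_completion_iff by blast
  show "\<forall>x. AE q in lborel. AE p in lborel. 0 < p \<and> 0 < q \<longrightarrow> resolvent_equation_at x p q"
  proof
    fix x
    show "AE q in lborel. AE p in lborel. 0 < p \<and> 0 < q \<longrightarrow> resolvent_equation_at x p q"
      using ri[of x]
    proof eventually_elim
      case (elim q)
      show ?case using ri[of x] ri[of "B q x"]
        by eventually_elim (use elim resolvent_equation_if_generator[OF A] in blast)
    qed
  qed
next
  assume re: "\<forall>x. AE q in lborel. AE p in lborel. 0 < p \<and> 0 < q \<longrightarrow> resolvent_equation_at x p q"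
  show "regularized_resolvent_family_ae a k S"
    unfolding regularized_resolvent_family_ae_def AE_completion_iff
    using S_cont closed_operator_gen commutes_with_gen lim AE_resolvent_identity_gen re by blast
qed

end

section \<open>From the truncations to the whole half-line\<close>

context truncated_setting
begin

lemma W_zero_iff_resolvent_equation:
  assumes "0 < p" "p < T" "0 < q" "q < T"
  shows "W x (p, q) = 0 \<longleftrightarrow> resolvent_equation_at x p q"
  unfolding W_eq[OF assms] resolvent_equation_at_def by (auto simp: algebra_simps)

lemma W_nonpos: "p \<le> 0 \<or> q \<le> 0 \<Longrightarrow> W x (p, q) = 0"
  unfolding W_def by (auto simp: \<beta>_nonpos \<sigma>_zero \<kappa>(3) \<sigma>_simps)

end

context commuting_family
begin

text \<open>The truncations at n + 1 exhaust the quadrant, and the union of their exceptional null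
  sets is again null. The shear to the coordinates \<tau> = t + s and s links the plane with the
  antidiagonals.\<close>

lemma AE_functional_equation_iff:
  "(AE (t, s) in lebesgue. 0 < t \<and> 0 < s \<longrightarrow> functional_equation_at a k S t s x) \<longleftrightarrow>
    (AE q in lborel. AE p in lborel. 0 < p \<and> 0 < q \<longrightarrow> resolvent_equation_at x p q)"
proof
  assume "AE (t, s) in lebesgue. 0 < t \<and> 0 < s \<longrightarrow> functional_equation_at a k S t s x"
  then have "AE z in plane. 0 < fst z \<and> 0 < snd z \<longrightarrow> functional_equation_at a k S (fst z) (snd z) x"
    unfolding AE_completion_iff lborel_prod by (simp add: split_def)
  from lborel_pair.AE_pair[OF AE_shear[OF this, of "-1"]]
  have fe: "AE \<tau> in lborel. AE s in lborel. 0 < \<tau> - s \<and> 0 < s \<longrightarrow> functional_equation_at a k S (\<tau> - s) s x"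
    by simp
  have "AE q in lborel. AE p in lborel. p + q < real n + 1 \<longrightarrow> 0 < p \<and> 0 < q \<longrightarrow> resolvent_equation_at x p q" for n
  proof -
    obtain \<alpha> \<kappa> \<sigma> M where "truncated_setting a k S \<alpha> \<kappa> \<sigma> M (real n + 1)"
      by (rule obtain_truncation[of "real n + 1"]) auto
    then interpret truncated_setting a k S \<alpha> \<kappa> \<sigma> M "real n + 1" .
    have "AE \<tau> in lborel. AE s in lborel. 0 < s \<and> s < \<tau> \<and> \<tau> < real n + 1 \<longrightarrow> functional_equation_at a k S (\<tau> - s) s x"
      using fe by eventually_elim (auto elim: eventually_mono)
    then have "AE q in lborel. AE p in lborel. p + q < real n + 1 \<longrightarrow> W x (p, q) = 0"
      unfolding W_zero_iff_functional_equation .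
    then show ?thesis
    proof eventually_elim
      case (elim q)
      then show ?case
      proof eventually_elim
        case (elim p)
        then show ?case using W_zero_iff_resolvent_equation[of p q x] by auto
      qed
    qed
  qed
  then have "AE q in lborel. \<forall>n::nat. AE p in lborel. p + q < real n + 1 \<longrightarrow> 0 < p \<and> 0 < q \<longrightarrow> resolvent_equation_at x p q"
    unfolding AE_all_countable by blast
  then show "AE q in lborel. AE p in lborel. 0 < p \<and> 0 < q \<longrightarrow> resolvent_equation_at x p q"
  proof eventually_elim
    case (elim q)
    then have "AE p in lborel. \<forall>n::nat. p + q < real n + 1 \<longrightarrow> 0 < p \<and> 0 < q \<longrightarrow> resolvent_equation_at x p q"
      unfolding AE_all_countable .
    then show ?case
    proof eventually_elim
      case (elim p)
      obtain n :: nat where "p + q < real n" using reals_Archimedean2 by blast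
      then show ?case using elim[rule_format, of n] by simp
    qed
  qed
next
  assume re: "AE q in lborel. AE p in lborel. 0 < p \<and> 0 < q \<longrightarrow> resolvent_equation_at x p q"
  have "AE \<tau> in lborel. \<forall>s. 0 < s \<and> s < \<tau> \<longrightarrow> functional_equation_at a k S (\<tau> - s) s x"
  proof (rule AE_nat_bound)
    fix n :: nat
    obtain \<alpha> \<kappa> \<sigma> M where "truncated_setting a k S \<alpha> \<kappa> \<sigma> M (real n + 1)"
      by (rule obtain_truncation[of "real n + 1"]) auto
    then interpret truncated_setting a k S \<alpha> \<kappa> \<sigma> M "real n + 1" .
    have "AE q in lborel. AE p in lborel. p + q < real n + 1 \<longrightarrow> W x (p, q) = 0"
      using re
    proof eventually_elim
      case (elim q)
      then show ?case
      proof eventually_elim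
        case (elim p)
        then show ?case
          using W_zero_iff_resolvent_equation[of p q x] W_nonpos[of p q x] by (cases "0 < p \<and> 0 < q") auto
      qed
    qed
    from functional_equation_at_if_W_zero[OF this]
    show "AE \<tau> in lborel. \<tau> < real n + 1 \<longrightarrow> (\<forall>s. 0 < s \<and> s < \<tau> \<longrightarrow> functional_equation_at a k S (\<tau> - s) s x)"
      by eventually_elim blast
  qed
  from AE_shear[OF AE_pair_fst[OF this], of 1]
  have "AE z in plane. 0 < fst z \<and> 0 < snd z \<longrightarrow> functional_equation_at a k S (fst z) (snd z) x"
  proof eventually_elim
    case (elim z)
    then show ?case by (auto dest: spec[of _ "snd z"])
  qed
  then show "AE (t, s) in lebesgue. 0 < t \<and> 0 < s \<longrightarrow> functional_equation_at a k S t s x"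
    unfolding AE_completion_iff lborel_prod by (simp add: split_def)
qed

end

section \<open>The pointwise equivalence for continuous scalar convolution\<close>

context truncated_setting
begin

lemma good_if_convolvable:
  assumes "\<And>t. 0 < t \<Longrightarrow> convolvable t" "q < T"
  shows "q \<in> good"
proof (cases "0 < q")
  case True
  then show ?thesis using assms good_iff[of q] by (simp add: convolvable_def)
qed (simp add: good_nonpos)

text \<open>The integrand \<kappa>(\<rho>) c(\<tau> - \<rho>) can be singular only at the two ends
  of (0, \<tau>), and one factor is always bounded: c(\<tau> - \<rho>) for \<rho> \<le> \<tau>/2 and
  \<kappa>(\<rho>) for \<rho> \<ge> \<tau>/2. The other factor is integrable.\<close>

lemma good_pairs_if_continuous:
  assumes conv: "\<And>t. 0 < t \<Longrightarrow> convolvable t" and cont: "continuous_on {0<..} (conv a k)"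
    and \<tau>: "0 < \<tau>" "\<tau> < T"
  shows "\<tau> \<in> good_pairs"
proof (rule good_pairsI)
  have sub: "{\<tau> / 2..\<tau>} \<subseteq> {0<..}" using \<tau> by auto
  have "bounded (conv a k ` {\<tau> / 2..\<tau>})" "bounded (k ` {\<tau> / 2..\<tau>})"
    by (intro compact_imp_bounded compact_continuous_image compact_Icc continuous_on_subset[OF cont sub]
        continuous_on_subset[OF k_cont sub])+
  then obtain C1 C2 where C1: "\<And>u. u \<in> {\<tau> / 2..\<tau>} \<Longrightarrow> \<bar>conv a k u\<bar> \<le> C1"
    and C2: "\<And>u. u \<in> {\<tau> / 2..\<tau>} \<Longrightarrow> \<bar>k u\<bar> \<le> C2"
    unfolding bounded_iff real_norm_def by blast
  have C0: "0 \<le> C1" "0 \<le> C2" using C1[of \<tau>] C2[of \<tau>] \<tau>(1) by auto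
  note [measurable] = borel_measurable_integrable[OF integrable_c]
  show "integrable lborel (\<lambda>\<rho>. \<kappa> \<rho> * c (\<tau> - \<rho>))"
  proof (rule Bochner_Integration.integrable_bound)
    show "integrable lborel (\<lambda>\<rho>. C1 * \<kappa> \<rho> + C2 * c (\<tau> - \<rho>))"
      using \<kappa>(1) integrable_reflect[OF integrable_c, of \<tau>] by simp
    show "AE \<rho> in lborel. norm (\<kappa> \<rho> * c (\<tau> - \<rho>)) \<le> norm (C1 * \<kappa> \<rho> + C2 * c (\<tau> - \<rho>))"
    proof (intro AE_I2)
      fix \<rho>
      have nn: "0 \<le> \<kappa> \<rho> * c (\<tau> - \<rho>)" "0 \<le> C1 * \<kappa> \<rho>" "0 \<le> C2 * c (\<tau> - \<rho>)"
        using \<kappa>(2) c_nonneg C0 by auto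
      consider "\<rho> \<le> 0" | "\<tau> \<le> \<rho>" | "0 < \<rho>" "\<rho> \<le> \<tau> / 2" | "\<tau> / 2 \<le> \<rho>" "\<rho> < \<tau>" by linarith
      then have "\<kappa> \<rho> * c (\<tau> - \<rho>) \<le> C1 * \<kappa> \<rho> + C2 * c (\<tau> - \<rho>)"
      proof cases
        case 1
        then show ?thesis using nn by (simp add: \<kappa>(3))
      next
        case 2
        then show ?thesis using nn by (simp add: c_nonpos)
      next
        case 3
        then have "c (\<tau> - \<rho>) = conv a k (\<tau> - \<rho>)"
          using \<tau> by (intro c_eq good_if_convolvable conv) auto
        also have "\<dots> \<le> C1" using C1[of "\<tau> - \<rho>"] 3 by auto
        finally have "\<kappa> \<rho> * c (\<tau> - \<rho>) \<le> \<kappa> \<rho> * C1" using \<kappa>(2) by (rule mult_left_mono)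
        then show ?thesis using nn(3) by (simp add: mult.commute)
      next
        case 4
        then have "\<kappa> \<rho> \<le> C2" using C2[of \<rho>] \<tau> by (simp add: \<kappa>_eq)
        then have "\<kappa> \<rho> * c (\<tau> - \<rho>) \<le> C2 * c (\<tau> - \<rho>)" using c_nonneg by (rule mult_right_mono)
        then show ?thesis using nn(2) by simp
      qed
      with nn show "norm (\<kappa> \<rho> * c (\<tau> - \<rho>)) \<le> norm (C1 * \<kappa> \<rho> + C2 * c (\<tau> - \<rho>))"
        unfolding real_norm_def by linarith
    qed
  qed measurable
  have "\<tau> - \<rho> \<in> good" if "\<kappa> \<rho> \<noteq> 0" for \<rho>
    using that \<tau>(2) \<kappa>(3)[of \<rho>] by (intro good_if_convolvable conv) (auto simp: not_le intro: ccontr)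
  then show "AE \<rho> in lborel. \<kappa> \<rho> \<noteq> 0 \<longrightarrow> \<tau> - \<rho> \<in> good" by simp
qed

end

context commuting_family
begin

lemma isCont_B:
  assumes conv: "\<And>t. 0 < t \<Longrightarrow> convolvable t" and cont: "continuous_on {0<..} (conv a k)"
    and t0: "0 < t0"
  shows "isCont (\<lambda>t. B t x) t0"
proof -
  \<comment> \<open>b = t0 + 1 makes t0 an interior point, and T = t0 + 2 keeps the interval up to
    and including b below the cut-off.\<close>
  obtain \<alpha> \<kappa> \<sigma> M where "truncated_setting a k S \<alpha> \<kappa> \<sigma> M (t0 + 2)"
    by (rule obtain_truncation[of "t0 + 2"]) (use t0 in auto)
  then interpret truncated_setting a k S \<alpha> \<kappa> \<sigma> M "t0 + 2" .
  have near: "\<forall>\<^sub>F t in nhds t0. t \<in> {0<..<t0 + 1}"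
    by (rule eventually_nhds_in_open) (use t0 in auto)
  have "isCont (\<lambda>t. \<beta> t x) t0"
  proof (rule isCont_\<beta>[where T = "t0 + 2" and b = "t0 + 1"])
    show "continuous_on {0<..t0 + 1} (\<lambda>s. \<sigma> s x)" for x
      by (rule continuous_on_eq[OF continuous_on_subset[OF S_orbit[of x]]]) (auto simp: \<sigma>_eq)
    show "continuous_on {0<..t0 + 1} \<kappa>"
      by (rule continuous_on_eq[OF continuous_on_subset[OF k_cont]]) (auto simp: \<kappa>_eq)
    show "t \<in> good" if "0 < t" "t < t0 + 1" for t
      by (rule good_if_convolvable[OF conv]) (use that in auto)
    have "isCont (conv a k) t0"
      using cont t0 by (auto simp: continuous_on_eq_continuous_at)
    moreover have "\<forall>\<^sub>F t in nhds t0. c t = conv a k t"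
      using near by eventually_elim (auto intro!: c_eq good_if_convolvable[OF conv])
    ultimately show "isCont c t0" by (simp only: isCont_cong)
  qed (use t0 \<alpha>_supp in auto)
  moreover have "\<forall>\<^sub>F t in nhds t0. \<beta> t x = B t x"
    using near by eventually_elim (auto intro: \<beta>_eq)
  ultimately show ?thesis by (simp only: isCont_cong)
qed

text \<open>Every \<tau> > 0 below the cut-off is now good, so the vanishing of \<open>W\<close>
  along one antidiagonal gives the equation at the single point (t, s).\<close>

lemma functional_equation_if_resolvent_equation:
  assumes conv: "\<And>t. 0 < t \<Longrightarrow> convolvable t" and cont: "continuous_on {0<..} (conv a k)"
    and re: "\<And>p q. 0 < p \<Longrightarrow> 0 < q \<Longrightarrow> resolvent_equation_at x p q" and ts: "0 < t" "0 < s"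
  shows "functional_equation_at a k S t s x"
proof -
  obtain \<alpha> \<kappa> \<sigma> M where "truncated_setting a k S \<alpha> \<kappa> \<sigma> M (t + s + 1)"
    by (rule obtain_truncation[of "t + s + 1"]) (use ts in auto)
  then interpret truncated_setting a k S \<alpha> \<kappa> \<sigma> M "t + s + 1" .
  have "W x (\<rho>, t + s - \<rho>) = 0" for \<rho>
  proof (cases "0 < \<rho> \<and> \<rho> < t + s")
    case True
    then show ?thesis using re[of \<rho> "t + s - \<rho>"] by (simp add: W_zero_iff_resolvent_equation)
  next
    case False
    then show ?thesis by (intro W_nonpos) auto
  qed
  moreover have "t + s \<in> good_pairs" by (rule good_pairs_if_continuous[OF conv cont]) (use ts in auto)
  ultimately show ?thesis using functional_equation_at_iff[OF ts, of x] by simp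
qed

text \<open>The identity holds on a dense set of times. Approaching t from the right within it,
  continuity of B, S and k and closedness of A give the identity at t.\<close>

lemma regularized_resolvent_family_if_ae:
  assumes conv: "\<And>t. 0 < t \<Longrightarrow> convolvable t" and cont: "continuous_on {0<..} (conv a k)"
    and ae: "regularized_resolvent_family_ae a k S"
  shows "regularized_resolvent_family a k S"
proof -
  from ae obtain D A where A: "closed_operator D A" "commutes_with S D A"
    and ri: "\<And>x. AE t in lborel. 0 < t \<longrightarrow> resolvent_identity_at a k S D A t x"
    unfolding regularized_resolvent_family_ae_def AE_completion_iff by blast
  have "resolvent_identity_at a k S D A t x" if t: "0 < t" for t x
  proof -
    have "\<exists>u. t < u \<and> u < t + inverse (real (Suc n)) \<and> resolvent_identity_at a k S D A u x" for n
    proof (rule AE_interval_witness)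
      show "AE u in lborel. t < u \<and> u < t + inverse (real (Suc n)) \<longrightarrow> resolvent_identity_at a k S D A u x"
        using ri[of x] by eventually_elim (use t in auto)
    qed simp
    then have "\<forall>n. \<exists>u. t < u \<and> u < t + inverse (real (Suc n)) \<and> resolvent_identity_at a k S D A u x" by blast
    from choice[OF this] obtain u where u: "\<forall>n. t < u n \<and> u n < t + inverse (real (Suc n))
        \<and> resolvent_identity_at a k S D A (u n) x" ..
    have u_lim: "u \<longlonglongrightarrow> t"
    proof (rule tendsto_sandwich)
      show "\<forall>\<^sub>F n in sequentially. t \<le> u n" "\<forall>\<^sub>F n in sequentially. u n \<le> t + inverse (real (Suc n))"
        using u by (auto intro!: always_eventually less_imp_le)
      show "(\<lambda>n. t + inverse (real (Suc n))) \<longlonglongrightarrow> t"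
        using tendsto_add[OF tendsto_const LIMSEQ_inverse_real_of_nat, of t] by simp
    qed simp
    have uid: "B (u n) x \<in> D" "A (B (u n) x) = S (u n) x - k (u n) *\<^sub>R x" for n
      using u unfolding resolvent_identity_at_def by auto
    have "isCont (\<lambda>t. S t x) t" "isCont k t"
      using S_orbit[of x] k_cont t by (auto simp: continuous_on_eq_continuous_at)
    then have "(\<lambda>n. S (u n) x - k (u n) *\<^sub>R x) \<longlonglongrightarrow> S t x - k t *\<^sub>R x"
      by (intro tendsto_intros isCont_tendsto_compose[OF _ u_lim])
    then have lim2: "(\<lambda>n. A (B (u n) x)) \<longlonglongrightarrow> S t x - k t *\<^sub>R x" by (simp only: uid(2))
    have lim1: "(\<lambda>n. B (u n) x) \<longlonglongrightarrow> B t x"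
      by (rule isCont_tendsto_compose[OF isCont_B[OF conv cont t] u_lim])
    show ?thesis
      unfolding resolvent_identity_at_def
      using closed_operator_tendsto[OF A(1) uid(1) lim1 lim2] B_integrable[OF t conv[OF t], of x] by blast
  qed
  then show ?thesis
    unfolding regularized_resolvent_family_def using S_cont A lim by blast
qed

text \<open>The forward direction is pointwise throughout. Conversely, the operator is produced by
  the almost everywhere equivalence, and its identity is then extended to all t.\<close>

lemma regularized_resolvent_family_iff:
  assumes conv: "\<And>t. 0 < t \<Longrightarrow> convolvable t" and cont: "continuous_on {0<..} (conv a k)"
  shows "regularized_resolvent_family a k S \<longleftrightarrow> (\<forall>t>0. \<forall>s>0. \<forall>x. functional_equation_at a k S t s x)"
proof
  assume "regularized_resolvent_family a k S"
  then obtain D A where A: "closed_operator D A" "commutes_with S D A"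
    and ri: "\<And>t x. 0 < t \<Longrightarrow> resolvent_identity_at a k S D A t x"
    unfolding regularized_resolvent_family_def by blast
  have "resolvent_equation_at x p q" if "0 < p" "0 < q" for x p q
    by (rule resolvent_equation_if_generator[OF A that ri[OF that(2)] ri[OF that(1)] ri[OF that(1)]])
  then show "\<forall>t>0. \<forall>s>0. \<forall>x. functional_equation_at a k S t s x"
    using functional_equation_if_resolvent_equation[OF conv cont] by blast
next
  assume fe: "\<forall>t>0. \<forall>s>0. \<forall>x. functional_equation_at a k S t s x"
  then have "AE (t, s) in lebesgue. 0 < t \<and> 0 < s \<longrightarrow> functional_equation_at a k S t s x" for x
    by (intro AE_I2) auto
  then have ae: "regularized_resolvent_family_ae a k S"
    unfolding AE_functional_equation_iff regularized_resolvent_family_ae_iff by blast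
  show "regularized_resolvent_family a k S"
    by (rule regularized_resolvent_family_if_ae[OF _ cont ae]) (rule conv)
qed

end

theorem theorem1:
  fixes a k :: "real \<Rightarrow> real" and S :: "real \<Rightarrow> 'a::complex_banach \<Rightarrow> 'a"
  assumes "locally_integrable a" and "AE t in lebesgue. 0 < t \<longrightarrow> 0 < a t"
    and "laplace_transformable a"
    and "locally_integrable k" and "\<forall>t>0. 0 < k t"
    and "laplace_transformable k" and "continuous_on {0<..} k"
    and "strongly_continuous_family S" and "locally_integrable_family S"
    and "laplace_transformable_family S" and "commutative_family S"
  shows "(regularized_resolvent_family_ae a k S \<longleftrightarrow>
            (\<forall>x. ((\<lambda>t. S t x /\<^sub>R k t) \<longlongrightarrow> x) (at_right 0)) \<and>
            (\<forall>x. AE (t, s) in lebesgue. 0 < t \<and> 0 < s \<longrightarrow> functional_equation_at a k S t s x))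
       \<and> (continuous_convolution a k \<longrightarrow>
          (regularized_resolvent_family a k S \<longleftrightarrow>
            (\<forall>x. ((\<lambda>t. S t x /\<^sub>R k t) \<longlongrightarrow> x) (at_right 0)) \<and>
            (\<forall>t>0. \<forall>s>0. \<forall>x. functional_equation_at a k S t s x)))"
proof (cases "\<forall>x. ((\<lambda>t. S t x /\<^sub>R k t) \<longlongrightarrow> x) (at_right 0)")
  case True
  interpret commuting_family a k S
    by unfold_locales (use assms True in auto)
  have "regularized_resolvent_family a k S \<longleftrightarrow> (\<forall>t>0. \<forall>s>0. \<forall>x. functional_equation_at a k S t s x)"
    if "continuous_convolution a k"
  proof (rule regularized_resolvent_family_iff)
    show "convolvable t" if "0 < t" for t
      using \<open>continuous_convolution a k\<close> that unfolding continuous_convolution_def convolvable_def by blast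
    show "continuous_on {0<..} (conv a k)"
      using that unfolding continuous_convolution_def by blast
  qed
  with True show ?thesis
    unfolding regularized_resolvent_family_ae_iff AE_functional_equation_iff by blast
next
  case False
  \<comment> \<open>The limit is part of both definitions, so both sides of each equivalence are
    false.\<close>
  then have "\<not> regularized_resolvent_family_ae a k S" "\<not> regularized_resolvent_family a k S"
    unfolding regularized_resolvent_family_ae_def regularized_resolvent_family_def by blast+
  with False show ?thesis by blast
qed

end
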